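(* Let $X$ be a simply-connected (not necessarily compact) CW complex with $\operatorname{Hom}(H_2(X),\mathbb{Z})=0$ (in particular, this holds if $H_2(X)$ is torsion). Then for every $n$, any two normal multiplicity-free matrices $A,B\in M_n(C(X))$ with the same eigenvalues at each point of $X$ are unitarily equivalent. In particular, any normal multiplicity-free matrix in $M_n(C(X))$ is diagonalizable.
   Context: $C(X)$ is the algebra of continuous functions $X\to\mathbb{C}$, and $M_n(C(X))$ is the ring of $n\times n$ matrices over $C(X)$; $A(x)\in M_n(\mathbb{C})$ denotes evaluation at $x$, and $A^*$ is the pointwise adjoint. $A$ is normal if $AA^*=A^*A$, and multiplicity free if for every $x\in X$ the $n$ eigenvalues of $A(x)$ are distinct. $A,B$ are unitarily equivalent if there is $U\in M_n(C(X))$ with $UU^*=U^*U=I$ and $B=UAU^*$. $A$ is diagonalizable if it is unitarily equivalent to a diagonal matrix in $M_n(C(X))$. $H_2(X)$ is singular homology with integer coefficients. *)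

theory Defs
  imports "HOL-Homology.Homology" "Jordan_Normal_Form.Spectral_Radius"
begin

section \<open>CW complexes\<close>

text \<open>
  The closed unit disk \<open>D\<^sup>n\<close>, its interior and its boundary sphere inside
  \<^term>\<open>Euclidean_space n\<close>, whose points are the real sequences vanishing from index \<open>n\<close> on.
  For \<open>n = 0\<close> the disk and its interior are a single point and the boundary is empty.
\<close>

definition disk_topology :: "nat \<Rightarrow> (nat \<Rightarrow> real) topology" where
  "disk_topology n = subtopology (Euclidean_space n) {v. (\<Sum>i<n. (v i)\<^sup>2) \<le> 1}"

definition disk_interior :: "nat \<Rightarrow> (nat \<Rightarrow> real) set" where
  "disk_interior n = {v \<in> topspace (Euclidean_space n). (\<Sum>i<n. (v i)\<^sup>2) < 1}"

definition disk_boundary :: "nat \<Rightarrow> (nat \<Rightarrow> real) set" where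
  "disk_boundary n = {v \<in> topspace (Euclidean_space n). (\<Sum>i<n. (v i)\<^sup>2) = 1}"

text \<open>
  J. H. C. Whitehead's definition: \<open>E n\<close> is the set of open \<open>n\<close>-cells.  The cells partition a
  Hausdorff space, every cell has a characteristic map sending the boundary sphere into a finite
  union of cells of smaller dimension (closure-finiteness), and the space carries the weak topology
  determined by the closed cells.  No bound on the dimension or on the number of cells is imposed.
\<close>

definition characteristic_map ::
  "'a topology \<Rightarrow> (nat \<Rightarrow> 'a set set) \<Rightarrow> nat \<Rightarrow> 'a set \<Rightarrow> ((nat \<Rightarrow> real) \<Rightarrow> 'a) \<Rightarrow> bool" where
  "characteristic_map X E n e \<Phi> \<longleftrightarrow>
     continuous_map (disk_topology n) X \<Phi> \<and>
     homeomorphic_map (subtopology (disk_topology n) (disk_interior n)) (subtopology X e) \<Phi> \<and>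
     (\<exists>F. finite F \<and> F \<subseteq> (\<Union>m<n. E m) \<and> \<Phi> ` disk_boundary n \<subseteq> \<Union>F)"

definition cw_structure :: "'a topology \<Rightarrow> (nat \<Rightarrow> 'a set set) \<Rightarrow> bool" where
  "cw_structure X E \<longleftrightarrow>
     Hausdorff_space X \<and>
     (\<Union>n. \<Union>(E n)) = topspace X \<and>
     (\<forall>m n. \<forall>e\<in>E m. \<forall>f\<in>E n. e \<inter> f \<noteq> {} \<longrightarrow> m = n \<and> e = f) \<and>
     (\<forall>n. \<forall>e\<in>E n. \<exists>\<Phi>. characteristic_map X E n e \<Phi>) \<and>
     (\<forall>S\<subseteq>topspace X. (\<forall>n. \<forall>e\<in>E n. closedin X (S \<inter> X closure_of e)) \<longrightarrow> closedin X S)"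

definition CW_complex :: "'a topology \<Rightarrow> bool" where
  "CW_complex X \<longleftrightarrow> (\<exists>E. cw_structure X E)"

section \<open>Simple connectedness and second homology\<close>

text \<open>
  The library's \<^const>\<open>simply_connected\<close> is about subsets of a type of class
  \<^class>\<open>topological_space\<close>; this is the notion for abstract topologies: path-connected,
  and every loop is null-homotopic relative to its base point.
\<close>

definition simply_connected_space :: "'a topology \<Rightarrow> bool" where
  "simply_connected_space X \<longleftrightarrow>
     path_connected_space X \<and>
     (\<forall>p. pathin X p \<and> p 1 = p 0 \<longrightarrow>
        homotopic_with (\<lambda>q. q 0 = p 0 \<and> q 1 = p 0) (top_of_set {0..1}) X p (\<lambda>t. p 0))"

definition Hom_to_int_trivial :: "('g, 'r) monoid_scheme \<Rightarrow> bool" where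
  "Hom_to_int_trivial G \<longleftrightarrow>
     (\<forall>h \<in> hom G integer_group. trivial_homomorphism G integer_group h)"

definition torsion_group :: "('g, 'r) monoid_scheme \<Rightarrow> bool" where
  "torsion_group G \<longleftrightarrow> (\<forall>c\<in>carrier G. \<exists>k::nat. 0 < k \<and> c [^]\<^bsub>G\<^esub> k = \<one>\<^bsub>G\<^esub>)"

section \<open>Matrices over the algebra of continuous functions\<close>

text \<open>
  An element \<open>A\<close> of \<open>M\<^sub>n(C(X))\<close> is identified with the function \<open>x \<mapsto> A(x)\<close>, whose entries are
  continuous.  Its values outside \<^term>\<open>topspace X\<close> are irrelevant, so identities between
  matrices over \<open>C(X)\<close> are required at the points of \<^term>\<open>topspace X\<close> only.
\<close>

definition cmat :: "'a topology \<Rightarrow> nat \<Rightarrow> ('a \<Rightarrow> complex mat) set" where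
  "cmat X n = {A. (\<forall>x\<in>topspace X. A x \<in> carrier_mat n n) \<and>
                  (\<forall>i<n. \<forall>j<n. continuous_map X euclidean (\<lambda>x. A x $$ (i, j)))}"

definition normal_cmat :: "'a topology \<Rightarrow> ('a \<Rightarrow> complex mat) \<Rightarrow> bool" where
  "normal_cmat X A \<longleftrightarrow>
     (\<forall>x\<in>topspace X. A x * mat_adjoint (A x) = mat_adjoint (A x) * A x)"

definition multiplicity_free :: "'a topology \<Rightarrow> nat \<Rightarrow> ('a \<Rightarrow> complex mat) \<Rightarrow> bool" where
  "multiplicity_free X n A \<longleftrightarrow> (\<forall>x\<in>topspace X. card (spectrum (A x)) = n)"

definition same_eigenvalues ::
  "'a topology \<Rightarrow> ('a \<Rightarrow> complex mat) \<Rightarrow> ('a \<Rightarrow> complex mat) \<Rightarrow> bool" where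
  "same_eigenvalues X A B \<longleftrightarrow> (\<forall>x\<in>topspace X. spectrum (A x) = spectrum (B x))"

definition unitary_cmat :: "'a topology \<Rightarrow> nat \<Rightarrow> ('a \<Rightarrow> complex mat) \<Rightarrow> bool" where
  "unitary_cmat X n U \<longleftrightarrow>
     U \<in> cmat X n \<and>
     (\<forall>x\<in>topspace X. U x * mat_adjoint (U x) = 1\<^sub>m n \<and> mat_adjoint (U x) * U x = 1\<^sub>m n)"

definition unitarily_equivalent ::
  "'a topology \<Rightarrow> nat \<Rightarrow> ('a \<Rightarrow> complex mat) \<Rightarrow> ('a \<Rightarrow> complex mat) \<Rightarrow> bool" where
  "unitarily_equivalent X n A B \<longleftrightarrow>
     (\<exists>U. unitary_cmat X n U \<and> (\<forall>x\<in>topspace X. B x = U x * A x * mat_adjoint (U x)))"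

definition diagonalizable_cmat :: "'a topology \<Rightarrow> nat \<Rightarrow> ('a \<Rightarrow> complex mat) \<Rightarrow> bool" where
  "diagonalizable_cmat X n A \<longleftrightarrow>
     (\<exists>D\<in>cmat X n. (\<forall>x\<in>topspace X. diagonal_mat (D x)) \<and> unitarily_equivalent X n A D)"

end

theory Submission
  imports Defs "HOL-Analysis.Analysis"
begin

text \<open>
  Over a simply connected complex the \<open>n\<close> distinct eigenvalues of \<open>A(x)\<close> form a trivial covering, so
  they are the values of continuous functions \<open>l k\<close>, and each gives a continuous field of eigenlines.
  Once every such complex line bundle \<open>L\<close> is known to be trivial, unit sections of the eigenlines are
  the columns of a unitary \<open>V\<close> with \<open>A = V diag(l) V\<^sup>*\<close>; two matrices with the same eigenvalues are
  diagonalized to the same diagonal matrix.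

  To trivialize \<open>L\<close>, fix a unit vector \<open>s x\<close> in each line and, over each singular 1-simplex, a
  section joining the chosen vectors at its ends.  The winding numbers around the boundaries of
  singular 2-simplices form the integral cocycle that represents the first Chern class.  It vanishes
  on cycles because \<open>Hom(H\<^sub>2(X), \<int>) = 0\<close>, so by simple connectedness it is the coboundary of an
  integral 1-cochain.  Correcting by this cochain gives an additive real-valued phase change
  along paths: the circle bundle of \<open>L\<close> is reduced to a bundle of real lines (the ``potentials'').
  That bundle has contractible fibres, hence a section can be built cell by cell without obstruction.
\<close>

section \<open>Compact convex sets of sequences\<close>

text \<open>A CW complex need be neither metrizable nor locally compact, so everything is tested on
  continuous maps from compact convex sets of sequences. Over such a set, lines, phases and
  eigenvalues are continued along the segments from one point in uniformly many small steps. Such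
  tests reach the whole complex because a convergent sequence in it has a subsequence inside a
  single cell. The hypothesis concerns Hom only, whereas classes in second cohomology may also come
  from Ext of the first homology. Simple connectedness removes that part in an explicit way: each
  path is coned off to a base point, and the curvature of the filled triangle is the value of the
  correcting cochain. The delicate point over cells is not the extension itself, which extends a
  real function from a sphere to a disk. It is that the new function must stay compatible with paths
  crossing from an open cell into the lower skeleton. A definition cell by cell controls the
  section, hence its phase only up to multiples of 2 pi; a radial deformation onto the lower
  skeleton excludes jumps by such multiples.\<close>

definition seg :: "(nat \<Rightarrow> real) \<Rightarrow> (nat \<Rightarrow> real) \<Rightarrow> real \<Rightarrow> nat \<Rightarrow> real" where
  "seg a b t = (\<lambda>i. (1 - t) * a i + t * b i)"

text \<open>The class of test domains: simplices, closed disks, cylinders over them and small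
  neighbourhoods inside them. Each contracts along segments to any of its points, and compactness
  gives one subdivision that is fine enough for all these segments.\<close>

definition compact_convex :: "(nat \<Rightarrow> real) set \<Rightarrow> bool" where
  "compact_convex D \<longleftrightarrow> compact D \<and> (\<forall>a\<in>D. \<forall>b\<in>D. \<forall>t\<in>{0..1}. seg a b t \<in> D)"

lemma seg_0 [simp]: "seg a b 0 = a" and seg_1 [simp]: "seg a b 1 = b"
  by (auto simp: seg_def)

lemma seg_in: "compact_convex D \<Longrightarrow> a \<in> D \<Longrightarrow> b \<in> D \<Longrightarrow> 0 \<le> t \<Longrightarrow> t \<le> 1 \<Longrightarrow> seg a b t \<in> D"
  by (auto simp: compact_convex_def)

lemma compact_convex_compact: "compact_convex D \<Longrightarrow> compact D"
  by (simp add: compact_convex_def)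

(* otherwise this rule is tried before continuous_on_seg *)
declare continuous_on_coordinatewise_then_product [continuous_intros del]

lemma continuous_on_seg [continuous_intros]:
  assumes "continuous_on S f" "continuous_on S g" "continuous_on S h"
  shows "continuous_on S (\<lambda>x. seg (f x) (g x) (h x))"
  unfolding seg_def
  by (intro continuous_on_coordinatewise_then_product continuous_intros assms
      continuous_on_product_then_coordinatewise[OF assms(1)]
      continuous_on_product_then_coordinatewise[OF assms(2)])

lemma continuous_on_coordinate [continuous_intros]:
  "continuous_on S (\<lambda>v::'b \<Rightarrow> 'c::topological_space. v i)"
  by (rule continuous_on_product_then_coordinatewise[OF continuous_on_id])

lemma compact_convex_standard_simplex: "compact_convex (standard_simplex p)"
  using compactin_standard_simplex[of p] convex_standard_simplex[of _ p]
  by (auto simp: compact_convex_def seg_def euclidean_product_topology)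

lemma compact_box: "compact {v::nat \<Rightarrow> real. \<forall>i. v i \<in> {l i..u i}}"
proof -
  have "{v. \<forall>i. v i \<in> {l i..u i}} = PiE UNIV (\<lambda>i. {l i..u i})"
    by auto
  moreover have "compactin (powertop_real UNIV) (PiE UNIV (\<lambda>i. {l i..u i}))"
    by (simp add: compactin_PiE)
  ultimately show ?thesis by (simp add: euclidean_product_topology)
qed

lemma closed_coordinate_box: "closed {v::nat \<Rightarrow> real. \<forall>i\<in>I. v i \<in> {l i..u i}}"
proof -
  have eq: "{v::nat \<Rightarrow> real. \<forall>i\<in>I. v i \<in> {l i..u i}} =
      (\<Inter>i\<in>I. {v. l i \<le> v i} \<inter> {v. v i \<le> u i})"
    by auto
  show ?thesis
    unfolding eq
    by (intro closed_INT ballI closed_Int closed_Collect_le continuous_intros)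
qed

section \<open>Closed disks, cylinders and convex neighbourhoods\<close>

definition cdisk :: "nat \<Rightarrow> (nat \<Rightarrow> real) set" where
  "cdisk n = {v. (\<forall>i\<ge>n. v i = 0) \<and> (\<Sum>i<n. (v i)\<^sup>2) \<le> 1}"

lemma disk_topology_eq: "disk_topology n = top_of_set (cdisk n)"
proof -
  have "Collect (\<lambda>x::nat\<Rightarrow>real. \<forall>i\<ge>n. x i = 0) \<inter> {v. (\<Sum>i<n. (v i)\<^sup>2) \<le> 1} = cdisk n"
    by (auto simp: cdisk_def)
  then show ?thesis
    unfolding disk_topology_def Euclidean_space_def subtopology_subtopology
    by (simp add: euclidean_product_topology)
qed

lemma disk_interior_eq: "disk_interior n = {v\<in>cdisk n. (\<Sum>i<n. (v i)\<^sup>2) < 1}"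
  by (auto simp: disk_interior_def cdisk_def topspace_Euclidean_space)

lemma disk_boundary_eq: "disk_boundary n = {v\<in>cdisk n. (\<Sum>i<n. (v i)\<^sup>2) = 1}"
  by (auto simp: disk_boundary_def cdisk_def topspace_Euclidean_space)

lemma cdisk_cases: "cdisk n = disk_interior n \<union> disk_boundary n"
  by (force simp: disk_interior_eq disk_boundary_eq cdisk_def)

lemma sum_square_seg_le:
  assumes "0 \<le> t" "t \<le> 1"
  shows "(\<Sum>i<n. (seg a b t i)\<^sup>2) \<le> (1 - t) * (\<Sum>i<n. (a i)\<^sup>2) + t * (\<Sum>i<n. (b i)\<^sup>2)"
proof -
  have "(\<Sum>i<n. (seg a b t i)\<^sup>2) \<le> (\<Sum>i<n. (1 - t) * (a i)\<^sup>2 + t * (b i)\<^sup>2)"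
  proof (rule sum_mono)
    fix i
    have "(1 - t) * (a i)\<^sup>2 + t * (b i)\<^sup>2 - (seg a b t i)\<^sup>2 = t * (1 - t) * (a i - b i)\<^sup>2"
      by (simp add: seg_def power2_eq_square algebra_simps)
    moreover have "\<dots> \<ge> 0" using assms by simp
    ultimately show "(seg a b t i)\<^sup>2 \<le> (1 - t) * (a i)\<^sup>2 + t * (b i)\<^sup>2" by linarith
  qed
  then show ?thesis by (simp add: sum.distrib sum_distrib_left)
qed

lemma compact_convex_cdisk: "compact_convex (cdisk n)"
proof -
  let ?B = "{v::nat \<Rightarrow> real. \<forall>i. v i \<in> {(if i < n then -1 else 0)..(if i < n then 1 else 0)}}"
  have sub: "cdisk n = ?B \<inter> {v. (\<Sum>i<n. (v i)\<^sup>2) \<le> 1}" (is "_ = ?R")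
  proof
    show "cdisk n \<subseteq> ?R"
    proof
      fix v assume v: "v \<in> cdisk n"
      have "\<bar>v i\<bar> \<le> 1" if "i < n" for i
      proof -
        have "(v i)\<^sup>2 \<le> (\<Sum>i<n. (v i)\<^sup>2)"
          by (rule member_le_sum) (use that in auto)
        then have "(v i)\<^sup>2 \<le> 1" using v by (auto simp: cdisk_def)
        then show ?thesis by (simp add: abs_square_le_1)
      qed
      then show "v \<in> ?R"
        using v by (force simp: cdisk_def abs_le_iff)
    qed
    show "?R \<subseteq> cdisk n"
    proof
      fix v assume v: "v \<in> ?R"
      have "v i = 0" if "i \<ge> n" for i
        using v that by (auto dest!: spec[of _ i])
      then show "v \<in> cdisk n" using v by (auto simp: cdisk_def)
    qed
  qed
  have "compact (cdisk n)"
    unfolding sub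
    by (intro compact_Int_closed compact_box closed_Collect_le continuous_intros)
  moreover have "seg a b t \<in> cdisk n" if "a \<in> cdisk n" "b \<in> cdisk n" "t \<in> {0..1}" for a b t
  proof -
    have "(\<Sum>i<n. (seg a b t i)\<^sup>2) \<le> (1 - t) * (\<Sum>i<n. (a i)\<^sup>2) + t * (\<Sum>i<n. (b i)\<^sup>2)"
      using that by (intro sum_square_seg_le) auto
    also have "\<dots> \<le> (1 - t) * 1 + t * 1"
      using that by (intro add_mono mult_left_mono) (auto simp: cdisk_def)
    finally show ?thesis using that by (auto simp: cdisk_def seg_def)
  qed
  ultimately show ?thesis by (auto simp: compact_convex_def)
qed

text \<open>The product of the unit interval with \<open>D\<close>, coded with time as coordinate 0
  and the point of \<open>D\<close> shifted by one. In this form it is again a set of sequences, so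
  the domain of a homotopy is itself a test domain.\<close>

definition cylinder :: "(nat \<Rightarrow> real) set \<Rightarrow> (nat \<Rightarrow> real) set" where
  "cylinder D = {v. 0 \<le> v 0 \<and> v 0 \<le> 1 \<and> v \<circ> Suc \<in> D}"

lemma cylinder_eq_image: "cylinder D = (\<lambda>(s, y). case_nat s y) ` ({0..1} \<times> D)"
proof -
  have "v = (case_nat (v 0) (v \<circ> Suc))" for v :: "nat \<Rightarrow> real"
    by (auto simp: fun_eq_iff split: nat.split)
  then show ?thesis
    by (force simp: cylinder_def image_iff comp_def)
qed

lemma continuous_on_case_nat:
  assumes "continuous_on S f" "continuous_on S g"
  shows "continuous_on S (\<lambda>x. case_nat (f x :: real) (g x))"
proof (rule continuous_on_coordinatewise_then_product)
  show "continuous_on S (\<lambda>x. case_nat (f x) (g x) i)" for i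
    using assms(1) continuous_on_product_then_coordinatewise[OF assms(2)] by (cases i) auto
qed

lemma compact_convex_cylinder:
  assumes "compact_convex D"
  shows "compact_convex (cylinder D)"
proof -
  have "compact (cylinder D)"
    unfolding cylinder_eq_image split_beta
    by (intro compact_continuous_image compact_Times continuous_on_case_nat
        continuous_intros compact_convex_compact assms) auto
  moreover have "seg a b t \<in> cylinder D" if "a \<in> cylinder D" "b \<in> cylinder D" "t \<in> {0..1}" for a b t
  proof -
    have "seg a b t \<circ> Suc = seg (a \<circ> Suc) (b \<circ> Suc) t" by (auto simp: seg_def)
    moreover have "0 \<le> seg a b t 0" "seg a b t 0 \<le> 1"
      using that by (auto simp: seg_def cylinder_def convex_bound_le)
    ultimately show ?thesis
      using that assms by (auto simp: cylinder_def seg_in)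
  qed
  ultimately show ?thesis by (auto simp: compact_convex_def)
qed

text \<open>A basic open set of the product topology restricts finitely many coordinates;
  \<open>D'\<close> is cut out by a closed box in these coordinates and \<open>V\<close> is the open
  box. This reduces continuity on \<open>D\<close> to continuity on small compact convex
  pieces.\<close>

lemma compact_convex_nbhd:
  assumes D: "compact_convex D" and U: "open U" "t \<in> U" "t \<in> D"
  obtains D' V where "compact_convex D'" "D' \<subseteq> D \<inter> U" "open V" "t \<in> V" "D \<inter> V \<subseteq> D'"
proof -
  have "openin (powertop_real UNIV) U" using U by (simp add: euclidean_product_topology)
  from product_topology_open_contains_basis[OF this \<open>t \<in> U\<close>]
  obtain Y where Y: "t \<in> PiE UNIV Y" "\<And>i. open (Y i)" "finite {i. Y i \<noteq> UNIV}" "PiE UNIV Y \<subseteq> U"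
    by auto
  define I where "I = {i. Y i \<noteq> UNIV}"
  have "\<exists>d>0. cball (t i) d \<subseteq> Y i" for i
  proof -
    have "t i \<in> Y i" using Y(1) by (simp add: PiE_iff)
    then show ?thesis using Y(2)[of i] by (simp add: open_contains_cball)
  qed
  then obtain d where d: "\<And>i. d i > 0" "\<And>i. cball (t i) (d i) \<subseteq> Y i" by metis
  define C where "C = {v::nat\<Rightarrow>real. \<forall>i\<in>I. v i \<in> {t i - d i..t i + d i}}"
  define V where "V = {v::nat\<Rightarrow>real. \<forall>i\<in>I. v i \<in> {t i - d i<..<t i + d i}}"
  have "V = (\<Inter>i\<in>I. {v. t i - d i < v i} \<inter> {v. v i < t i + d i})"
    by (auto simp: V_def)
  then have 1: "open V"
    using Y(3) by (auto simp: I_def intro!: open_INT open_Int open_Collect_less continuous_intros)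
  have 2: "t \<in> V" "V \<subseteq> C" using d by (auto simp: V_def C_def less_imp_le)
  have 3: "C \<subseteq> U"
  proof
    fix v assume v: "v \<in> C"
    have "v i \<in> Y i" for i
    proof (cases "i \<in> I")
      case True
      then have "v i \<in> cball (t i) (d i)" using v by (auto simp: C_def dist_real_def abs_le_iff)
      then show ?thesis using d(2)[of i] by blast
    qed (auto simp: I_def)
    then show "v \<in> U" using Y(4) by auto
  qed
  have "compact (D \<inter> C)"
    unfolding C_def by (intro compact_Int_closed closed_coordinate_box compact_convex_compact D)
  moreover have "seg a b s \<in> D \<inter> C" if "a \<in> D \<inter> C" "b \<in> D \<inter> C" "s \<in> {0..1}" for a b s
  proof -
    have "t i - d i \<le> seg a b s i \<and> seg a b s i \<le> t i + d i" if "i \<in> I" for i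
    proof -
      have "t i - d i \<le> a i" "a i \<le> t i + d i" "t i - d i \<le> b i" "b i \<le> t i + d i"
        using \<open>a \<in> D \<inter> C\<close> \<open>b \<in> D \<inter> C\<close> \<open>i \<in> I\<close> by (auto simp: C_def)
      moreover have "(1 - s) * (t i - d i) + s * (t i - d i) = t i - d i" by (simp add: algebra_simps)
      moreover have "(1 - s) * (t i - d i) + s * (t i - d i) \<le> seg a b s i"
        unfolding seg_def using calculation \<open>s \<in> {0..1}\<close> by (intro add_mono mult_left_mono) auto
      moreover have "seg a b s i \<le> t i + d i"
        unfolding seg_def using calculation \<open>s \<in> {0..1}\<close> by (intro convex_bound_le) auto
      ultimately show ?thesis by linarith
    qed
    then show ?thesis using that D by (auto simp: C_def seg_in)
  qed
  ultimately have "compact_convex (D \<inter> C)" by (auto simp: compact_convex_def)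
  moreover have "D \<inter> C \<subseteq> D \<inter> U" "D \<inter> V \<subseteq> D \<inter> C" using 2 3 by auto
  ultimately show thesis using that[of "D \<inter> C" V, OF _ _ 1 2(1)] by simp
qed

section \<open>Continuous phases\<close>

text \<open>Uniform continuity on a compact product. There are two time arguments because in
  \<open>sec_exists\<close> the quantity to be controlled compares the lines at two different
  times.\<close>

lemma seg_uniform_partition:
  fixes g :: "real \<Rightarrow> real \<Rightarrow> (nat \<Rightarrow> real) \<Rightarrow> 'b::metric_space"
  assumes D: "compact D"
    and cont: "continuous_on ({0..1} \<times> {0..1} \<times> D) (\<lambda>(t, t', y). g t t' y)" and "e > 0"
  obtains N :: nat where "N > 0"
    "\<And>k y. k < N \<Longrightarrow> y \<in> D \<Longrightarrow> dist (g (real (Suc k) / N) (real k / N) y) (g (real k / N) (real k / N) y) < e"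
proof -
  have "uniformly_continuous_on ({0..1} \<times> {0..1} \<times> D) (\<lambda>(t, t', y). g t t' y)"
    using D cont by (intro compact_uniformly_continuous compact_Times) auto
  then obtain d where d: "d > 0" "\<And>p p'. p \<in> {0..1} \<times> {0..1} \<times> D \<Longrightarrow>
     p' \<in> {0..1} \<times> {0..1} \<times> D \<Longrightarrow> dist p' p < d \<Longrightarrow>
     dist (case p' of (t, t', y) \<Rightarrow> g t t' y) (case p of (t, t', y) \<Rightarrow> g t t' y) < e"
    using \<open>e > 0\<close> unfolding uniformly_continuous_on_def by (elim allE[of _ e]) auto
  obtain M :: nat where "1 / real (Suc M) < d"
    using d(1) nat_approx_posE by blast
  then obtain N :: nat where N: "N > 0" "1 / real N < d" by blast
  show thesis
  proof (rule that[OF N(1)])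
    fix k y assume k: "k < N" "y \<in> D"
    have "dist (real (Suc k) / N, real k / N, y) (real k / N, real k / N, y) = 1 / N"
      using N by (simp add: dist_prod_def dist_real_def flip: diff_divide_distrib)
    then show "dist (g (real (Suc k) / N) (real k / N) y) (g (real k / N) (real k / N) y) < e"
      using k N d(2)[of "(real k / N, real k / N, y)" "(real (Suc k) / N, real k / N, y)"] by simp
  qed
qed

text \<open>Along each segment from a fixed point \<open>a\<close>, \<open>g y\<close> is
  \<open>g a\<close> times the product of the quotients of consecutive values at \<open>N\<close>
  equally spaced times. Every quotient lies within distance 1 of 1, hence off the negative axis,
  where \<open>Arg\<close> is continuous; the sum of these arguments is the lift.\<close>

lemma cis_lift:
  assumes D: "compact_convex D" and g: "continuous_on D g" "\<And>y. y \<in> D \<Longrightarrow> cmod (g y) = 1"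
  obtains \<eta> :: "(nat \<Rightarrow> real) \<Rightarrow> real" where "continuous_on D \<eta>" "\<And>y. y \<in> D \<Longrightarrow> g y = cis (\<eta> y)"
proof (cases "D = {}")
  case False
  then obtain a where a: "a \<in> D" by auto
  define h where "h t y = g (seg a y t)" for t y
  have hD: "seg a y t \<in> D" if "t \<in> {0..1}" "y \<in> D" for t y
    using seg_in[OF D a] that by auto
  have "continuous_on ({0..1} \<times> {0..1} \<times> D) (\<lambda>(t, t'::real, y). h t y)"
    unfolding h_def split_beta
    by (rule continuous_on_compose2[OF g(1)]) (auto intro!: continuous_intros hD)
  then obtain N :: nat where N: "N > 0"
    "\<And>k y. k < N \<Longrightarrow> y \<in> D \<Longrightarrow> dist (h (real (Suc k) / N) y) (h (real k / N) y) < 1"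
    using seg_uniform_partition[of D "\<lambda>t t'. h t" 1] compact_convex_compact[OF D] by auto
  define q where "q k y = h (real (Suc k) / N) y / h (real k / N) y" for k y
  have norm_h: "cmod (h (real k / N) y) = 1" if "k \<le> N" "y \<in> D" for k y
    unfolding h_def using that N by (intro g(2) hD) auto
  have q: "cmod (q k y) = 1" "q k y \<notin> nonpos_Reals" if "k < N" "y \<in> D" for k y
  proof -
    show 1: "cmod (q k y) = 1"
      using norm_h[of "Suc k" y] norm_h[of k y] that by (simp add: q_def norm_divide)
    have nz: "h (real k / N) y \<noteq> 0" using norm_h[of k y] that by auto
    have "cmod (q k y - 1) = cmod (h (real (Suc k) / N) y - h (real k / N) y)"
    proof -
      have "q k y - 1 = (h (real (Suc k) / N) y - h (real k / N) y) / h (real k / N) y"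
        using nz by (simp add: q_def diff_divide_distrib)
      then show ?thesis using norm_h[of k y] that by (simp add: norm_divide)
    qed
    also have "\<dots> < 1" using N(2)[OF that] by (simp add: dist_norm)
    finally have "cmod (q k y - 1) < 1" .
    then show "q k y \<notin> nonpos_Reals"
      using abs_Re_le_cmod[of "q k y - 1"] by (auto simp: complex_nonpos_Reals_iff)
  qed
  define \<eta> where "\<eta> y = Arg (g a) + (\<Sum>k<N. Arg (q k y))" for y
  show thesis
  proof
    have "continuous_on D (\<lambda>y. h (real k / N) y)" if "k \<le> N" for k
      unfolding h_def
      by (rule continuous_on_compose2[OF g(1)]) (use that N in \<open>auto intro!: continuous_intros hD\<close>)
    then have ch: "continuous_on D (h (real k / N))" if "k \<le> N" for k using that .
    have cq: "continuous_on D (q k)" if "k < N" for k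
      unfolding q_def
    proof (rule continuous_on_divide)
      show "\<forall>y\<in>D. h (real k / N) y \<noteq> 0" using norm_h[of k] that by force
    qed (use ch[of "Suc k"] ch[of k] that in auto)
    have "continuous_on D (\<lambda>y. Arg (q k y))" if "k < N" for k
      by (rule continuous_on_Arg') (use that q cq in auto)
    then show "continuous_on D \<eta>"
      unfolding \<eta>_def by (intro continuous_on_add continuous_on_const continuous_on_sum) auto
    show "g y = cis (\<eta> y)" if y: "y \<in> D" for y
    proof -
      have "cis (Arg (g a) + (\<Sum>k<m. Arg (q k y))) = h (real m / N) y" if "m \<le> N" for m
        using that
      proof (induction m)
        case 0
        have "g a \<noteq> 0" using g(2)[OF a] by auto
        then show ?case using g(2)[OF a] by (simp add: h_def cis_Arg sgn_eq)
      next
        case (Suc m)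
        have "cis (Arg (q m y)) = q m y"
          using q(1)[of m y] Suc y by (subst cis_Arg) (auto simp: sgn_eq)
        moreover have "h (real m / N) y \<noteq> 0" using norm_h[of m y] Suc y by auto
        ultimately show ?case
          using Suc by (simp add: q_def flip: cis_mult add.assoc)
      qed
      from this[of N] show ?thesis using N by (simp add: \<eta>_def h_def)
    qed
  qed
qed auto

lemma compact_convex_connected:
  assumes D: "compact_convex D"
  shows "connected D"
  unfolding connected_iff_connected_component
proof (intro ballI)
  fix a b assume ab: "a \<in> D" "b \<in> D"
  have "connected (seg a b ` {0..1})"
    by (intro connected_continuous_image continuous_intros) auto
  moreover have "seg a b ` {0..1} \<subseteq> D" using ab D by (auto simp: seg_in)
  moreover have "a \<in> seg a b ` {0..1}" "b \<in> seg a b ` {0..1}"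
    by (auto simp: image_iff intro: bexI[of _ 0] bexI[of _ 1])
  ultimately show "connected_component D a b"
    by (meson connected_component_def)
qed

text \<open>The values of \<open>k\<close> are multiples of 2 pi, and distinct ones are at least 2
  pi apart.\<close>

lemma cis_eq_1_constant:
  assumes D: "connected D" and k: "continuous_on D k" "\<And>y. y \<in> D \<Longrightarrow> cis (k y) = 1"
    and ab: "a \<in> D" "b \<in> D"
  shows "k a = k b"
proof -
  have "k constant_on D"
  proof (rule continuous_discrete_range_constant[OF D k(1)])
    fix x assume x: "x \<in> D"
    have "2 * pi \<le> norm (k y - k x)" if y: "y \<in> D" "k y \<noteq> k x" for y
    proof -
      have "cis (k y - k x) = 1" using k(2) x y by (simp add: cis_divide[symmetric])
      then obtain m :: int where m: "k y - k x = 2 * pi * m"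
        by (auto simp: complex_eq_iff cos_one_2pi_int mult_ac)
      then have "m \<noteq> 0" using y(2) by auto
      then have "\<bar>m\<bar> \<ge> 1" by linarith
      then have "\<bar>real_of_int m\<bar> \<ge> 1" by linarith
      then show ?thesis using m by (simp add: abs_mult)
    qed
    then show "\<exists>e>0. \<forall>y. y \<in> D \<and> k y \<noteq> k x \<longrightarrow> e \<le> norm (k y - k x)"
      by (intro exI[of _ "2 * pi"]) auto
  qed
  then show ?thesis using ab by (auto simp: constant_on_def)
qed

section \<open>Sequences and continuity in CW complexes\<close>

text \<open>Only the domain has to be metric. A subsequence suffices: to show that the preimage of a
  closed set is closed, it is enough that \<open>f y\<close> inherits membership in that
  set.\<close>

lemma continuous_map_top_of_set_sequentially:
  fixes D :: "'m::metric_space set"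
  assumes "\<And>y. y \<in> D \<Longrightarrow> f y \<in> topspace X"
    and "\<And>\<sigma> y. (\<And>k::nat. \<sigma> k \<in> D) \<Longrightarrow> y \<in> D \<Longrightarrow> \<sigma> \<longlonglongrightarrow> y \<Longrightarrow>
      \<exists>r::nat\<Rightarrow>nat. limitin X (\<lambda>k. f (\<sigma> (r k))) (f y) sequentially"
  shows "continuous_map (top_of_set D) X f"
  unfolding continuous_map_closedin
proof (intro conjI allI impI ballI)
  fix C assume C: "closedin X C"
  have "closedin (top_of_set D) {x \<in> D. f x \<in> C}"
    unfolding closedin_limpt
  proof (intro conjI allI impI)
    fix y assume y: "y islimpt {x \<in> D. f x \<in> C} \<and> y \<in> D"
    then obtain \<sigma> where \<sigma>: "\<And>k::nat. \<sigma> k \<in> {x \<in> D. f x \<in> C} - {y}" "\<sigma> \<longlonglongrightarrow> y"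
      unfolding islimpt_sequential by blast
    then obtain r :: "nat \<Rightarrow> nat" where r: "limitin X (\<lambda>k. f (\<sigma> (r k))) (f y) sequentially"
      using assms(2)[of \<sigma> y] y by auto
    have "f y \<in> C"
    proof (rule limitin_closedin[OF r C])
      show "\<forall>\<^sub>F k in sequentially. f (\<sigma> (r k)) \<in> C" using \<sigma> by auto
    qed auto
    then show "y \<in> {x \<in> D. f x \<in> C}" using y by auto
  qed auto
  then show "closedin (top_of_set D) {x \<in> topspace (top_of_set D). f x \<in> C}" by simp
qed (use assms(1) in auto)

lemma limitin_continuous_map_top_of_set:
  assumes "continuous_map (top_of_set D) X f" "\<And>k. \<sigma> k \<in> D" "y \<in> D" "\<sigma> \<longlonglongrightarrow> y"
  shows "limitin X (\<lambda>k. f (\<sigma> k)) (f y) sequentially"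
proof -
  have "limitin (top_of_set D) \<sigma> y sequentially"
    using assms by (simp add: limitin_subtopology)
  from continuous_map_limit[OF assms(1) this] show ?thesis by (simp add: comp_def)
qed

lemma closedin_continuous_map_compact_image:
  assumes "Hausdorff_space X" "continuous_map (top_of_set D) X f" "compact D"
  shows "closedin X (f ` D)"
  by (intro compactin_imp_closedin assms image_compactin[OF _ assms(2)])
     (use assms(3) in \<open>auto simp: compactin_subtopology\<close>)

locale cw_space =
  fixes X :: "'a topology" and E :: "nat \<Rightarrow> 'a set set"
  assumes cw: "cw_structure X E"
begin

lemma Hausdorff: "Hausdorff_space X"
  and cells_cover: "(\<Union>n. \<Union>(E n)) = topspace X"
  using cw by (simp_all add: cw_structure_def)

lemma cells_disjoint: "e \<in> E m \<Longrightarrow> f \<in> E n \<Longrightarrow> x \<in> e \<Longrightarrow> x \<in> f \<Longrightarrow> m = n \<and> e = f"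
  using cw unfolding cw_structure_def by (metis disjoint_iff)

lemma characteristic_map_ex: "e \<in> E n \<Longrightarrow> \<exists>\<Phi>. characteristic_map X E n e \<Phi>"
  using cw by (simp add: cw_structure_def)

lemma weak_closed:
  "S \<subseteq> topspace X \<Longrightarrow> (\<And>n e. e \<in> E n \<Longrightarrow> closedin X (S \<inter> X closure_of e)) \<Longrightarrow> closedin X S"
  using cw by (simp add: cw_structure_def)

definition chr :: "nat \<Rightarrow> 'a set \<Rightarrow> (nat \<Rightarrow> real) \<Rightarrow> 'a" where
  "chr n e = (SOME \<Phi>. characteristic_map X E n e \<Phi>)"

text \<open>Shifted by one: \<open>skel n\<close> collects the cells of dimension less than
  \<open>n\<close>, so it is the skeleton of dimension \<open>n - 1\<close>. In particular
  \<open>skel 0\<close> is empty and inductions over skeleta start from nothing.\<close>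

definition skel :: "nat \<Rightarrow> 'a set" where
  "skel n = (\<Union>m<n. \<Union>(E m))"

definition chr_inv :: "nat \<Rightarrow> 'a set \<Rightarrow> 'a \<Rightarrow> nat \<Rightarrow> real" where
  "chr_inv n e = inv_into (disk_interior n) (chr n e)"

lemma cell_subset: "e \<in> E n \<Longrightarrow> e \<subseteq> topspace X"
  using cells_cover by blast

lemma skel_subset: "skel n \<subseteq> topspace X"
  using cells_cover by (auto simp: skel_def)

lemma skel_mono: "m \<le> n \<Longrightarrow> skel m \<subseteq> skel n"
  by (force simp: skel_def)

lemma skel_Suc: "skel (Suc n) = skel n \<union> \<Union>(E n)"
  by (auto simp: skel_def lessThan_Suc)

lemma cell_not_skel: "e \<in> E n \<Longrightarrow> x \<in> e \<Longrightarrow> x \<notin> skel n"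
  using cells_disjoint by (fastforce simp: skel_def)

lemma topspace_cell:
  assumes "x \<in> topspace X" obtains n e where "e \<in> E n" "x \<in> e"
  using assms cells_cover by blast

context
  fixes n e
  assumes e: "e \<in> E n"
begin

lemma chr: "characteristic_map X E n e (chr n e)"
  unfolding chr_def using characteristic_map_ex[OF e] by (rule someI_ex)

lemma chr_cont: "continuous_map (top_of_set (cdisk n)) X (chr n e)"
  using chr by (simp add: characteristic_map_def disk_topology_eq)

lemma chr_homeo: "homeomorphic_map (top_of_set (disk_interior n)) (subtopology X e) (chr n e)"
proof -
  have "cdisk n \<inter> disk_interior n = disk_interior n" by (auto simp: disk_interior_eq)
  then show ?thesis
    using chr by (simp add: characteristic_map_def disk_topology_eq subtopology_subtopology)
qed

lemma chr_inj: "inj_on (chr n e) (disk_interior n)"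
  using homeomorphic_imp_injective_map[OF chr_homeo] by simp

lemma chr_image: "chr n e ` disk_interior n = e"
  using homeomorphic_imp_surjective_map[OF chr_homeo] cell_subset[OF e] by auto

lemma chr_inv: "x \<in> e \<Longrightarrow> chr_inv n e x \<in> disk_interior n \<and> chr n e (chr_inv n e x) = x"
  unfolding chr_inv_def using chr_image by (metis inv_into_into f_inv_into_f)

lemma chr_inv_chr: "z \<in> disk_interior n \<Longrightarrow> chr_inv n e (chr n e z) = z"
  unfolding chr_inv_def using chr_inj by simp

lemma chr_inv_cont: "continuous_map (subtopology X e) (top_of_set (disk_interior n)) (chr_inv n e)"
proof -
  obtain g where g: "homeomorphic_maps (top_of_set (disk_interior n)) (subtopology X e) (chr n e) g"
    using chr_homeo homeomorphic_map_maps by blast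
  have "g x = chr_inv n e x" if "x \<in> topspace (subtopology X e)" for x
  proof -
    have "g x \<in> disk_interior n" "chr n e (g x) = x"
      using g that by (auto simp: homeomorphic_maps_def continuous_map_def)
    then show ?thesis using chr_inv_chr by metis
  qed
  then show ?thesis
    using g continuous_map_eq unfolding homeomorphic_maps_def by blast
qed

lemma chr_boundary: "\<exists>F. finite F \<and> F \<subseteq> (\<Union>m<n. E m) \<and> chr n e ` disk_boundary n \<subseteq> \<Union>F"
  using chr by (simp add: characteristic_map_def)

lemma chr_boundary_skel: "z \<in> disk_boundary n \<Longrightarrow> chr n e z \<in> skel n"
proof -
  assume z: "z \<in> disk_boundary n"
  obtain F where F: "F \<subseteq> (\<Union>m<n. E m)" "chr n e ` disk_boundary n \<subseteq> \<Union>F"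
    using chr_boundary by blast
  then obtain f where "f \<in> F" "chr n e z \<in> f" using z by blast
  moreover obtain m where "m < n" "f \<in> E m" using F(1) \<open>f \<in> F\<close> by auto
  ultimately show ?thesis by (auto simp: skel_def)
qed

lemma chr_interior: "z \<in> disk_interior n \<Longrightarrow> chr n e z \<in> e"
  using chr_image by blast

lemma chr_skel: "z \<in> cdisk n \<Longrightarrow> chr n e z \<in> skel (Suc n)"
  using chr_boundary_skel chr_interior e by (auto simp: skel_Suc cdisk_cases)

lemma closure_cell: "X closure_of e \<subseteq> chr n e ` cdisk n"
proof (rule closure_of_minimal)
  show "e \<subseteq> chr n e ` cdisk n" using chr_image by (auto simp: cdisk_cases)
  show "closedin X (chr n e ` cdisk n)"
    by (rule closedin_continuous_map_compact_image[OF Hausdorff chr_cont])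
       (simp add: compact_convex_compact compact_convex_cdisk)
qed

lemma closure_finite_cells:
  obtains F where "finite F" "F \<subseteq> (\<Union>n. E n)" "X closure_of e \<subseteq> \<Union>F"
proof -
  obtain F where F: "finite F" "F \<subseteq> (\<Union>m<n. E m)" "chr n e ` disk_boundary n \<subseteq> \<Union>F"
    using chr_boundary by blast
  show thesis
  proof (rule that[of "insert e F"])
    show "X closure_of e \<subseteq> \<Union>(insert e F)"
    proof
      fix x assume "x \<in> X closure_of e"
      then obtain z where "z \<in> cdisk n" "x = chr n e z" using closure_cell by blast
      then show "x \<in> \<Union>(insert e F)"
        using F(3) chr_image by (auto simp: cdisk_cases)
    qed
    show "insert e F \<subseteq> (\<Union>n. E n)" using F(2) e by blast
  qed (use F in auto)
qed

end

text \<open>Some cell contains infinitely many terms. Otherwise the terms different from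
  \<open>x\<close> meet every closed cell, which lies in finitely many cells, in a finite set; by
  the weak topology they form a closed set, so the sequence is eventually \<open>x\<close> and one
  cell contains almost all of it. Inside one cell, compactness of the disk yields convergence of the
  coordinates. Limits in \<open>X\<close> thereby become limits in a disk.\<close>

lemma sequence_in_cell:
  assumes lim: "limitin X \<sigma> x sequentially" and \<sigma>: "\<And>k::nat. \<sigma> k \<in> topspace X"
  obtains n e r z zk where "e \<in> E n" "strict_mono (r :: nat \<Rightarrow> nat)" "\<And>k. zk k \<in> disk_interior n"
    "\<And>k. \<sigma> (r k) = chr n e (zk k)" "z \<in> cdisk n" "zk \<longlonglongrightarrow> z" "x = chr n e z"
proof -
  have "\<exists>n. \<exists>e\<in>E n. infinite {k. \<sigma> k \<in> e}"
  proof (rule ccontr)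
    assume "\<not> ?thesis"
    then have fin: "finite {k. \<sigma> k \<in> e}" if "e \<in> E n" for e n using that by auto
    \<comment> \<open>Leaving out \<open>x\<close> makes the complement of this set a neighbourhood
      of \<open>x\<close> once the set is known to be closed.\<close>
    define S where "S = range \<sigma> - {x}"
    have "closedin X S"
    proof (rule weak_closed)
      show "S \<subseteq> topspace X" using \<sigma> by (auto simp: S_def)
      fix n e assume e: "e \<in> E n"
      obtain F where F: "finite F" "F \<subseteq> (\<Union>n. E n)" "X closure_of e \<subseteq> \<Union>F"
        using closure_finite_cells[OF e] .
      have "S \<inter> X closure_of e \<subseteq> \<sigma> ` (\<Union>f\<in>F. {k. \<sigma> k \<in> f})"
        using F(3) by (auto simp: S_def)
      moreover have "finite (\<Union>f\<in>F. {k. \<sigma> k \<in> f})"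
        using F(1,2) fin by auto
      ultimately have "finite (S \<inter> X closure_of e)"
        by (meson finite_imageI finite_subset)
      then show "closedin X (S \<inter> X closure_of e)"
        using Hausdorff closure_of_subset_topspace[of X e]
        by (intro closedin_Hausdorff_finite) auto
    qed
    then have "openin X (topspace X - S)" by blast
    moreover have "x \<in> topspace X - S" using lim by (auto simp: S_def limitin_def)
    ultimately have "\<forall>\<^sub>F k in sequentially. \<sigma> k \<in> topspace X - S"
      using lim by (auto simp: limitin_def)
    then have ev: "\<forall>\<^sub>F k in sequentially. \<sigma> k = x"
      by eventually_elim (auto simp: S_def)
    obtain n e where e: "e \<in> E n" "x \<in> e" using topspace_cell limitin_topspace[OF lim] by metis
    have "\<forall>\<^sub>F k in sequentially. \<sigma> k \<in> e" using ev by eventually_elim (use e in auto)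
    then have "infinite {k. \<sigma> k \<in> e}"
      unfolding eventually_sequentially infinite_nat_iff_unbounded_le by (metis le_cases mem_Collect_eq)
    then show False using fin[OF e(1)] by auto
  qed
  then obtain n e where e: "e \<in> E n" "infinite {k. \<sigma> k \<in> e}" by blast
  obtain r0 :: "nat \<Rightarrow> nat" where r0: "strict_mono r0" "\<And>k. \<sigma> (r0 k) \<in> e"
    using infinite_enumerate[OF e(2)] by auto
  define w where "w k = chr_inv n e (\<sigma> (r0 k))" for k
  have w: "w k \<in> disk_interior n" "chr n e (w k) = \<sigma> (r0 k)" for k
    using chr_inv[OF e(1) r0(2)] by (auto simp: w_def)
  have "seq_compact (cdisk n)"
    using compact_convex_compact[OF compact_convex_cdisk] compact_eq_seq_compact_metric by blast
  moreover have w_in: "w k \<in> cdisk n" for k using w(1) by (simp add: cdisk_cases)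
  ultimately have "\<exists>l\<in>cdisk n. \<exists>r::nat\<Rightarrow>nat. strict_mono r \<and> (w \<circ> r) \<longlonglongrightarrow> l"
    by (simp add: seq_compact_def)
  then obtain z r1 where z: "z \<in> cdisk n" "strict_mono (r1 :: nat \<Rightarrow> nat)" "(w \<circ> r1) \<longlonglongrightarrow> z"
    by blast
  have 1: "limitin X (\<lambda>k. chr n e ((w \<circ> r1) k)) (chr n e z) sequentially"
    by (rule limitin_continuous_map_top_of_set[OF chr_cont[OF e(1)] _ z(1,3)]) (simp add: w_in)
  have "limitin X (\<sigma> \<circ> (r0 \<circ> r1)) x sequentially"
    by (rule limitin_subsequence[OF strict_mono_o[OF r0(1) z(2)] lim])
  then have 2: "limitin X (\<lambda>k. chr n e ((w \<circ> r1) k)) x sequentially"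
    by (simp add: w comp_def)
  have "chr n e z = x"
    using limitin_Hausdorff_unique[OF 1 2] Hausdorff by simp
  then show thesis
    using z w by (intro that[of e n "r0 \<circ> r1" "w \<circ> r1" z] e) (auto simp: strict_mono_o r0)
qed

text \<open>The preimage of a closed set meets a closed cell in the trace of the image of a compact
  part of the disk, which is closed in a Hausdorff space.\<close>

lemma continuous_map_cellwise:
  fixes g :: "'a \<Rightarrow> 'b::topological_space"
  assumes "\<And>n e. e \<in> E n \<Longrightarrow> continuous_on (cdisk n) (\<lambda>z. g (chr n e z))"
  shows "continuous_map X euclidean g"
  unfolding continuous_map_closedin
proof (intro conjI allI impI)
  fix C :: "'b set" assume C: "closedin euclidean C"
  let ?S = "{x \<in> topspace X. g x \<in> C}"
  show "closedin X ?S"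
  proof (rule weak_closed)
    fix n e assume e: "e \<in> E n"
    let ?K = "{z \<in> cdisk n. g (chr n e z) \<in> C}"
    have "?K = cdisk n \<inter> (\<lambda>z. g (chr n e z)) -` C" by auto
    then have "closed ?K"
      using continuous_closed_preimage[OF assms[OF e]] C compact_convex_compact[OF compact_convex_cdisk]
      by (simp add: compact_imp_closed)
    then have K: "compact ?K"
      using compact_convex_compact[OF compact_convex_cdisk] compact_Int_closed[of "cdisk n" ?K]
      by (simp add: Int_def)
    have "continuous_map (top_of_set ?K) X (chr n e)"
      by (rule continuous_map_from_subtopology_mono[OF chr_cont[OF e]]) auto
    then have "closedin X (chr n e ` ?K)"
      by (rule closedin_continuous_map_compact_image[OF Hausdorff _ K])
    moreover have "?S \<inter> X closure_of e = chr n e ` ?K \<inter> X closure_of e"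
      using closure_cell[OF e] skel_subset chr_skel[OF e] by fastforce
    ultimately show "closedin X (?S \<inter> X closure_of e)" by auto
  qed auto
qed auto

end

section \<open>Integral cochains\<close>

text \<open>The linear extension of \<open>c\<close> to chains. Since \<open>frag_extend\<close>
  takes values in free abelian groups, the integers appear as the free abelian group on the single
  generator \<open>()\<close>.\<close>

definition cochain_eval :: "('b \<Rightarrow> int) \<Rightarrow> ('b \<Rightarrow>\<^sub>0 int) \<Rightarrow> int" where
  "cochain_eval c w = Poly_Mapping.lookup (frag_extend (\<lambda>\<sigma>. frag_cmul (c \<sigma>) (frag_of ())) w) ()"

lemma cochain_eval_add [simp]: "cochain_eval c (v + w) = cochain_eval c v + cochain_eval c w"
  by (simp add: cochain_eval_def frag_extend_add lookup_add)

lemma cochain_eval_diff [simp]: "cochain_eval c (v - w) = cochain_eval c v - cochain_eval c w"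
  by (simp add: cochain_eval_def frag_extend_diff lookup_minus)

lemma cochain_eval_0 [simp]: "cochain_eval c 0 = 0"
  by (simp add: cochain_eval_def)

lemma cochain_eval_of [simp]: "cochain_eval c (frag_of \<sigma>) = c \<sigma>"
  by (simp add: cochain_eval_def)

lemma chain_boundary_2:
  "chain_boundary 2 (frag_of \<sigma>) =
    frag_of (singular_face 2 0 \<sigma>) - frag_of (singular_face 2 1 \<sigma>) + frag_of (singular_face 2 2 \<sigma>)"
  by (simp add: chain_boundary_of numeral_2_eq_2)

lemma chain_boundary_3:
  "chain_boundary 3 (frag_of \<sigma>) =
    frag_of (singular_face 3 0 \<sigma>) - frag_of (singular_face 3 1 \<sigma>) +
    frag_of (singular_face 3 2 \<sigma>) - frag_of (singular_face 3 3 \<sigma>)"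
  by (simp add: chain_boundary_of numeral_2_eq_2 numeral_3_eq_3)

text \<open>The cocycle condition says that \<open>c\<close> kills boundaries, so its restriction to
  cycles factors through homology, where every homomorphism to the integers is trivial.\<close>

lemma cocycle_vanishes_on_cycles:
  assumes Hom: "Hom_to_int_trivial (homology_group 2 X)"
    and cocycle: "\<And>\<tau>. singular_simplex 3 X \<tau> \<Longrightarrow>
      c (singular_face 3 0 \<tau>) - c (singular_face 3 1 \<tau>) + c (singular_face 3 2 \<tau>) - c (singular_face 3 3 \<tau>) = 0"
    and z: "singular_chain 2 X z" "chain_boundary 2 z = 0"
  shows "cochain_eval c z = 0"
proof -
  let ?Z = "relcycle_group 2 X {}" and ?B = "singular_relboundary_set 2 X {}"
  have bd: "cochain_eval c (chain_boundary 3 d) = 0" if "singular_chain 3 X d" for d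
  proof (rule frag_induction[of d "singular_simplex_set 3 X"])
    show "Poly_Mapping.keys d \<subseteq> singular_simplex_set 3 X" using that by (simp add: singular_chain_def)
    show "cochain_eval c (chain_boundary 3 (frag_of \<tau>)) = 0" if "\<tau> \<in> singular_simplex_set 3 X" for \<tau>
      using cocycle[of \<tau>] that by (simp add: chain_boundary_3)
  qed (simp_all add: chain_boundary_diff)
  interpret gh: group_hom ?Z integer_group "cochain_eval c"
    by (intro group_hom.intro group_hom_axioms.intro homI) auto
  have hG: "homology_group 2 X = ?Z Mod ?B"
    by (simp add: relative_homology_group_def)
  have ker: "?B \<subseteq> kernel ?Z integer_group (cochain_eval c)"
  proof
    fix b assume "b \<in> ?B"
    then have b: "singular_relboundary 2 X {} b" by simp
    then obtain d where d: "singular_chain 3 X d" "chain_boundary 3 d = b"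
      by (auto simp: singular_boundary eval_nat_numeral)
    have "singular_relcycle 2 X {} b" by (rule singular_relboundary_imp_relcycle[OF b])
    then show "b \<in> kernel ?Z integer_group (cochain_eval c)"
      using d bd by (auto simp: kernel_def)
  qed
  obtain g where g: "g \<in> hom (?Z Mod ?B) integer_group"
    "\<And>x. x \<in> carrier ?Z \<Longrightarrow> g (r_coset ?Z ?B x) = cochain_eval c x"
    using gh.FactGroup_universal_kernel[OF normal_subgroup_singular_relboundary_relcycle ker] by blast
  have zZ: "z \<in> carrier ?Z" using z by (simp add: singular_cycle)
  then have "r_coset ?Z ?B z \<in> carrier (?Z Mod ?B)"
    by (auto simp: FactGroup_def RCOSETS_def)
  moreover have "trivial_homomorphism (?Z Mod ?B) integer_group g"
    using Hom g(1) by (simp add: Hom_to_int_trivial_def hG)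
  ultimately have "g (r_coset ?Z ?B z) = 0"
    by (simp add: trivial_homomorphism_def)
  then show ?thesis using g(2)[OF zZ] by simp
qed

lemma torsion_Hom_to_int_trivial:
  assumes G: "group G" and "torsion_group G"
  shows "Hom_to_int_trivial G"
  unfolding Hom_to_int_trivial_def trivial_homomorphism_def
proof (intro ballI conjI)
  fix h x assume h: "h \<in> hom G integer_group" and x: "x \<in> carrier G"
  interpret gh: group_hom G integer_group h
    using G h by (simp add: group_hom_def group_hom_axioms_def)
  obtain k :: nat where k: "0 < k" "x [^]\<^bsub>G\<^esub> k = \<one>\<^bsub>G\<^esub>"
    using assms x by (auto simp: torsion_group_def)
  have "int k * h x = h (x [^]\<^bsub>G\<^esub> k)" using x by (simp add: gh.hom_nat_pow)
  also have "\<dots> = 0" using k(2) by simp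
  finally show "h x = \<one>\<^bsub>integer_group\<^esub>" using k(1) by simp
qed auto

section \<open>Simplices\<close>

definition vtx :: "nat \<Rightarrow> nat \<Rightarrow> real" where
  "vtx i = (\<lambda>j. if j = i then 1 else 0)"

lemma vtx_in [simp]: "vtx i \<in> standard_simplex p \<longleftrightarrow> i \<le> p"
  by (simp add: vtx_def)

lemma simplical_face_vtx: "simplical_face k (vtx i) = vtx (if i < k then i else Suc i)"
  by (auto simp: simplical_face_def vtx_def fun_eq_iff)

lemma simplical_face_in:
  "k \<le> Suc p \<Longrightarrow> x \<in> standard_simplex p \<Longrightarrow> simplical_face k x \<in> standard_simplex (Suc p)"
  using simplical_face_in_standard_simplex[of "Suc p" k x] by simp

lemma continuous_on_simplical_face [continuous_intros]:
  "continuous_on S (simplical_face k :: (nat \<Rightarrow> real) \<Rightarrow> _)"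
proof (rule continuous_on_coordinatewise_then_product)
  show "continuous_on S (\<lambda>x::nat\<Rightarrow>real. simplical_face k x i)" for i
    by (cases "i < k"; cases "i = k") (auto simp: simplical_face_def intro: continuous_intros)
qed

text \<open>The cosimplicial identity; it pairs off the edges of a tetrahedron in
  \<open>curv_cocycle\<close>.\<close>

lemma simplical_face_commute:
  "k \<le> j \<Longrightarrow> simplical_face k (simplical_face j x) = simplical_face (Suc j) (simplical_face k x)"
  by (auto simp: simplical_face_def fun_eq_iff)

lemma singular_simplex_iff:
  "singular_simplex p X f \<longleftrightarrow>
    continuous_map (top_of_set (standard_simplex p)) X f \<and> f \<in> extensional (standard_simplex p)"
  by (simp add: singular_simplex_def euclidean_product_topology)

text \<open>Singular simplices are extensional functions. Restricting to the standard simplex makes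
  equality of simplices a matter of values on that simplex, which is what the cochains
  \<open>b\<close> and \<open>curv\<close> need, as they take the simplex itself as
  argument.\<close>

definition sing :: "nat \<Rightarrow> ((nat \<Rightarrow> real) \<Rightarrow> 'a) \<Rightarrow> (nat \<Rightarrow> real) \<Rightarrow> 'a" where
  "sing p f = restrict f (standard_simplex p)"

lemma singular_simplex_sing:
  "continuous_map (top_of_set (standard_simplex p)) X f \<Longrightarrow> singular_simplex p X (sing p f)"
  unfolding singular_simplex_iff sing_def
  by (auto intro: continuous_map_eq)

lemma sing_apply [simp]: "x \<in> standard_simplex p \<Longrightarrow> sing p f x = f x"
  by (simp add: sing_def)

lemma sing_cong: "(\<And>x. x \<in> standard_simplex p \<Longrightarrow> f x = g x) \<Longrightarrow> sing p f = sing p g"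
  by (auto simp: sing_def restrict_def)

lemma singular_face_eq:
  "singular_face (Suc p) k f = sing p (\<lambda>x. f (simplical_face k x))"
  by (simp add: singular_face_def sing_def comp_def)

lemma singular_face_sing:
  "k \<le> Suc p \<Longrightarrow> singular_face (Suc p) k (sing (Suc p) f) = sing p (\<lambda>x. f (simplical_face k x))"
  unfolding singular_face_eq by (rule sing_cong) (simp add: simplical_face_in)

lemma sing_id: "singular_simplex p X f \<Longrightarrow> sing p f = f"
  by (simp add: singular_simplex_iff sing_def extensional_restrict)

section \<open>Triangles in simply connected spaces\<close>

definition edge :: "nat \<Rightarrow> nat \<Rightarrow> real \<Rightarrow> nat \<Rightarrow> real" where
  "edge i j t = seg (vtx i) (vtx j) t"

text \<open>The boundary of the triangle as a closed path in barycentric coordinates: from vertex 0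
  to 1, from 1 to 2, and from 2 back to 0, each in one third of the time.\<close>

definition tri_boundary :: "real \<Rightarrow> nat \<Rightarrow> real" where
  "tri_boundary t = (\<lambda>i. if i = 0 then max 0 (max (1 - 3 * t) (3 * t - 2))
     else if i = 1 then max 0 (min (3 * t) (2 - 3 * t))
     else if i = 2 then max 0 (min (3 * t - 1) (3 - 3 * t)) else 0)"

definition tri_centre :: "nat \<Rightarrow> real" where
  "tri_centre = (\<lambda>i. if i \<le> 2 then 1 / 3 else 0)"

text \<open>Polar coordinates on the triangle: \<open>t\<close> runs around the boundary, and
  \<open>s\<close> runs from the boundary at 0 to the centre at 1.\<close>

definition tri_polar :: "real \<times> real \<Rightarrow> nat \<Rightarrow> real" where
  "tri_polar = (\<lambda>(s, t). seg (tri_boundary t) tri_centre s)"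

lemma mem_standard_simplex_2:
  "x \<in> standard_simplex 2 \<longleftrightarrow>
    0 \<le> x 0 \<and> 0 \<le> x 1 \<and> 0 \<le> x 2 \<and> (\<forall>i>2. x i = 0) \<and> x 0 + x 1 + x 2 = 1"
proof -
  have s: "(\<Sum>i\<le>2. x i) = x 0 + x 1 + x 2" by (simp add: eval_nat_numeral)
  show ?thesis
  proof
    assume r: "0 \<le> x 0 \<and> 0 \<le> x 1 \<and> 0 \<le> x 2 \<and> (\<forall>i>2. x i = 0) \<and> x 0 + x 1 + x 2 = 1"
    have "0 \<le> x i \<and> x i \<le> 1" for i
    proof -
      consider "i = 0" | "i = 1" | "i = 2" | "i > 2" by linarith
      then show ?thesis using r by cases auto
    qed
    then show "x \<in> standard_simplex 2" using r s by (simp add: standard_simplex_def)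
  qed (auto simp: standard_simplex_def s)
qed

lemma tri_eq_iff:
  "x \<in> standard_simplex 2 \<Longrightarrow> y \<in> standard_simplex 2 \<Longrightarrow>
    x = y \<longleftrightarrow> x 0 = y 0 \<and> x 1 = y 1 \<and> x 2 = y 2"
proof (intro iffI ext)
  fix i :: nat
  assume a: "x \<in> standard_simplex 2" "y \<in> standard_simplex 2" "x 0 = y 0 \<and> x 1 = y 1 \<and> x 2 = y 2"
  consider "i = 0" | "i = 1" | "i = 2" | "i > 2" by linarith
  then show "x i = y i" using a by cases (auto simp: mem_standard_simplex_2)
qed auto

lemma tri_boundary_in: "t \<in> {0..1} \<Longrightarrow> tri_boundary t \<in> standard_simplex 2"
  unfolding mem_standard_simplex_2 by (auto simp: tri_boundary_def max_def min_def)

lemma tri_centre_in: "tri_centre \<in> standard_simplex 2"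
  by (simp add: mem_standard_simplex_2 tri_centre_def)

lemma tri_polar_in:
  "s \<in> {0..1} \<Longrightarrow> t \<in> {0..1} \<Longrightarrow> tri_polar (s, t) \<in> standard_simplex 2"
  by (auto simp: tri_polar_def intro!: seg_in compact_convex_standard_simplex tri_boundary_in tri_centre_in)

lemma continuous_on_tri_polar: "continuous_on S tri_polar"
proof -
  have "continuous_on S (\<lambda>p::real \<times> real. tri_boundary (snd p))"
  proof (rule continuous_on_coordinatewise_then_product)
    fix i :: nat
    consider "i = 0" | "i = 1" | "i = 2" | "i > 2" by linarith
    then show "continuous_on S (\<lambda>p. tri_boundary (snd p) i)"
      by cases (auto simp: tri_boundary_def intro!: continuous_intros)
  qed
  then show ?thesis
    unfolding tri_polar_def split_beta by (intro continuous_intros)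
qed

lemma tri_boundary_min:
  assumes "t \<in> {0..1}"
  shows "min (tri_boundary t 0) (min (tri_boundary t 1) (tri_boundary t 2)) = 0"
  using assms by (auto simp: tri_boundary_def max_def min_def)

lemma tri_boundary_values:
  assumes "t \<in> {0..1}"
  shows "t \<le> 1/3 \<and> tri_boundary t 0 = 1 - 3 * t \<and> tri_boundary t 1 = 3 * t \<and> tri_boundary t 2 = 0 \<or>
    1/3 \<le> t \<and> t \<le> 2/3 \<and> tri_boundary t 0 = 0 \<and> tri_boundary t 1 = 2 - 3 * t \<and> tri_boundary t 2 = 3 * t - 1 \<or>
    2/3 \<le> t \<and> tri_boundary t 0 = 3 * t - 2 \<and> tri_boundary t 1 = 0 \<and> tri_boundary t 2 = 3 - 3 * t"
proof -
  consider "t \<le> 1/3" | "1/3 \<le> t" "t \<le> 2/3" | "2/3 \<le> t" by linarith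
  then show ?thesis
    using assms by cases (simp_all add: tri_boundary_def max_def min_def)
qed

text \<open>On the boundary some barycentric coordinate vanishes, so the least coordinate of
  \<open>tri_polar (s, t)\<close> is \<open>s / 3\<close> and determines \<open>s\<close>. Away from
  the centre the boundary point is then determined, and with it \<open>t\<close> up to the two ends
  of the interval.\<close>

lemma tri_polar_inj:
  assumes "s \<in> {0..1}" "t \<in> {0..1}" "s' \<in> {0..1}" "t' \<in> {0..1}"
    and eq: "tri_polar (s, t) = tri_polar (s', t')"
  shows "s = s'" "s = 1 \<or> t = t' \<or> (t = 0 \<and> t' = 1) \<or> (t = 1 \<and> t' = 0)"
proof -
  have min_shift: "min (u + r) (min (v + r) (w + r)) = r"
    if "0 \<le> u" "0 \<le> v" "0 \<le> w" "u = 0 \<or> v = 0 \<or> w = 0" for u v w r :: real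
    using that by auto
  have min_polar: "min (tri_polar (s, t) 0) (min (tri_polar (s, t) 1) (tri_polar (s, t) 2)) = s / 3"
    if "s \<in> {0..1}" "t \<in> {0..1}" for s t
  proof -
    have nn: "0 \<le> (1 - s) * tri_boundary t i" if "i \<le> 2" for i
      using \<open>s \<in> {0..1}\<close> by (intro mult_nonneg_nonneg) (auto simp: tri_boundary_def)
    have "tri_boundary t 0 = 0 \<or> tri_boundary t 1 = 0 \<or> tri_boundary t 2 = 0"
      using tri_boundary_min[OF that(2)] by (auto simp: min_def split: if_splits)
    then have "(1 - s) * tri_boundary t 0 = 0 \<or> (1 - s) * tri_boundary t 1 = 0 \<or> (1 - s) * tri_boundary t 2 = 0"
      by auto
    moreover have "tri_polar (s, t) i = (1 - s) * tri_boundary t i + s / 3" if "i \<le> 2" for i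
      using that by (simp add: tri_polar_def seg_def tri_centre_def)
    ultimately show ?thesis
      using nn[of 0] nn[of 1] nn[of 2] min_shift by simp
  qed
  show s: "s = s'" using min_polar[of s t] min_polar[of s' t'] assms by simp
  have "tri_boundary t i = tri_boundary t' i" if "s \<noteq> 1" for i
    using fun_cong[OF eq, of i] s that by (auto simp: tri_polar_def seg_def)
  from this[of 0] this[of 1] this[of 2]
  show "s = 1 \<or> t = t' \<or> (t = 0 \<and> t' = 1) \<or> (t = 1 \<and> t' = 0)"
    using tri_boundary_values[OF assms(2)] tri_boundary_values[OF assms(4)] assms(2,4)
    unfolding atLeastAtMost_iff by (elim disjE conjE) argo+
qed

lemma tri_boundary_surj:
  assumes y: "y \<in> standard_simplex 2" "y 0 = 0 \<or> y 1 = 0 \<or> y 2 = 0"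
  obtains t where "t \<in> {0..1}" "y = tri_boundary t"
proof -
  define t where "t = (if y 2 = 0 then y 1 / 3 else if y 0 = 0 then (1 + y 2) / 3 else (2 + y 0) / 3)"
  have t: "t \<in> {0..1}" using y by (auto simp: t_def mem_standard_simplex_2)
  moreover have "y = tri_boundary t"
    unfolding tri_eq_iff[OF y(1) tri_boundary_in[OF t]]
    using y by (auto simp: t_def mem_standard_simplex_2 tri_boundary_def max_def min_def field_simps)
  ultimately show thesis using that by blast
qed

lemma tri_polar_surj:
  assumes y: "y \<in> standard_simplex 2"
  obtains s t where "s \<in> {0..1}" "t \<in> {0..1}" "y = tri_polar (s, t)"
proof -
  \<comment> \<open>The least barycentric coordinate of \<open>tri_polar (s, t)\<close> is
    \<open>s / 3\<close>.\<close>
  define s where "s = 3 * min (y 0) (min (y 1) (y 2))"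
  have s: "s \<in> {0..1}" using y by (auto simp: s_def mem_standard_simplex_2 min_def)
  show thesis
  proof (cases "s = 1")
    case True
    have "y = tri_polar (1, 0)"
      unfolding tri_eq_iff[OF y tri_polar_in[of 1 0, simplified]]
      using True y by (auto simp: s_def mem_standard_simplex_2 min_def tri_polar_def tri_centre_def split: if_splits)
    then show thesis using that[of 1 0] by auto
  next
    case False
    \<comment> \<open>The projection of \<open>y\<close> from the centre onto the boundary.\<close>
    define b where "b i = (y i - s * tri_centre i) / (1 - s)" for i
    have le: "s / 3 \<le> y 0" "s / 3 \<le> y 1" "s / 3 \<le> y 2" by (auto simp: s_def)
    have "b 0 + b 1 + b 2 = ((y 0 + y 1 + y 2) - s) / (1 - s)"
      by (simp add: b_def tri_centre_def flip: add_divide_distrib)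
    then have "b \<in> standard_simplex 2"
      using le s y False unfolding mem_standard_simplex_2
      by (auto simp: b_def tri_centre_def)
    moreover have "b 0 = 0 \<or> b 1 = 0 \<or> b 2 = 0"
      by (auto simp: b_def s_def tri_centre_def min_def)
    ultimately obtain t where t: "t \<in> {0..1}" "b = tri_boundary t" using tri_boundary_surj by blast
    have "y = tri_polar (s, t)"
      using False by (simp add: tri_polar_def flip: t(2)) (auto simp: fun_eq_iff seg_def b_def)
    then show thesis using that s t by blast
  qed
qed

lemma edge_boundary:
  assumes "u \<in> {0..1}"
  shows "edge 0 1 u = tri_boundary (u / 3)" "edge 1 2 u = tri_boundary ((1 + u) / 3)"
    "edge 0 2 u = tri_boundary (1 - u / 3)"
  using assms by (auto simp: edge_def seg_def vtx_def tri_boundary_def fun_eq_iff max_def min_def field_simps)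

text \<open>The loop \<open>p\<close>, then \<open>q\<close>, then \<open>p'\<close> backwards, with
  the timing of \<open>tri_boundary\<close>.\<close>

lemma pathin_join3:
  assumes p: "pathin X p" and q: "pathin X q" and p': "pathin X p'"
    and ends: "p 0 = p' 0" "p 1 = q 0" "q 1 = p' 1"
  shows "pathin X (\<lambda>t. if t \<le> 1/3 then p (3 * t) else if t \<le> 2/3 then q (3 * t - 1) else p' (3 - 3 * t))"
proof -
  have sub: "continuous_map (top_of_set S) X (\<lambda>t. g (a * t + b))"
    if "pathin X g" "\<And>t. t \<in> S \<Longrightarrow> a * t + b \<in> {0..1}" for g S and a b :: real
  proof -
    have "continuous_map (top_of_set S) (top_of_set {0..1}) (\<lambda>t. a * t + b)"
      using that(2) by (auto intro!: continuous_intros)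
    from continuous_map_compose[OF this that(1)[unfolded pathin_def]]
    show ?thesis by (simp add: comp_def)
  qed
  have top: "subtopology (top_of_set {a..b}) {x \<in> topspace (top_of_set {a..b}). x \<le> c} = top_of_set {a..c}"
    "subtopology (top_of_set {a..b}) {x \<in> topspace (top_of_set {a..b}). c \<le> x} = top_of_set {c..b}"
    if "a \<le> c" "c \<le> b" for a b c :: real
  proof -
    have "{a..b} \<inter> {x \<in> topspace (top_of_set {a..b}). x \<le> c} = {a..c}"
      "{a..b} \<inter> {x \<in> topspace (top_of_set {a..b}). c \<le> x} = {c..b}" using that by auto
    then show "subtopology (top_of_set {a..b}) {x \<in> topspace (top_of_set {a..b}). x \<le> c} = top_of_set {a..c}"
      "subtopology (top_of_set {a..b}) {x \<in> topspace (top_of_set {a..b}). c \<le> x} = top_of_set {c..b}"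
      by (simp_all only: subtopology_subtopology)
  qed
  have s1: "continuous_map (top_of_set {0..1/3}) X (\<lambda>t. p (3 * t))"
    using sub[OF p, of "{0..1/3}" 3 0] by auto
  have s2: "continuous_map (top_of_set {1/3..2/3}) X (\<lambda>t. q (3 * t - 1))"
    using sub[OF q, of "{1/3..2/3}" 3 "-1"] by auto
  have s3: "continuous_map (top_of_set {2/3..1}) X (\<lambda>t. p' (3 - 3 * t))"
    using sub[OF p', of "{2/3..1}" "-3" 3] by auto
  have s23: "continuous_map (top_of_set {1/3..1}) X (\<lambda>t. if t \<le> 2/3 then q (3 * t - 1) else p' (3 - 3 * t))"
  proof (rule continuous_map_cases_le)
    fix t :: real assume "t = 2/3"
    then have "3 * t - 1 = 1" "3 - 3 * t = 1" by simp_all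
    then show "q (3 * t - 1) = p' (3 - 3 * t)" using ends by (simp only:)
  qed (use s2 s3 in \<open>simp_all only: top\<close>, auto)
  show ?thesis
    unfolding pathin_def
  proof (rule continuous_map_cases_le)
    fix t :: real assume "t = 1/3"
    then have "3 * t = 1" "3 * t - 1 = 0" "t \<le> 2/3" by simp_all
    then show "p (3 * t) = (if t \<le> 2/3 then q (3 * t - 1) else p' (3 - 3 * t))"
      using ends by (simp only: if_True)
  qed (use s1 s23 in \<open>simp_all only: top\<close>, auto)
qed

text \<open>The three paths form a loop, and a null-homotopy of it that keeps the base point fixed
  is a map in polar coordinates. It is constant for \<open>s = 1\<close> and takes the same value at
  \<open>t = 0\<close> and \<open>t = 1\<close>, so it respects the identifications made by
  \<open>tri_polar\<close> and descends to the triangle. Continuity of the descended map follows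
  from compactness of the square of polar coordinates.\<close>

lemma simply_connected_triangle:
  assumes X: "simply_connected_space X"
    and p: "pathin X p" and q: "pathin X q" and p': "pathin X p'"
    and ends: "p 0 = p' 0" "p 1 = q 0" "q 1 = p' 1"
  obtains \<sigma> where "continuous_map (top_of_set (standard_simplex 2)) X \<sigma>"
    "\<And>t. t \<in> {0..1} \<Longrightarrow> \<sigma> (edge 0 1 t) = p t"
    "\<And>t. t \<in> {0..1} \<Longrightarrow> \<sigma> (edge 1 2 t) = q t"
    "\<And>t. t \<in> {0..1} \<Longrightarrow> \<sigma> (edge 0 2 t) = p' t"
proof -
  define l where "l = (\<lambda>t. if t \<le> 1/3 then p (3 * t) else if t \<le> 2/3 then q (3 * t - 1) else p' (3 - 3 * t))"
  have "pathin X l" unfolding l_def by (rule pathin_join3[OF p q p' ends])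
  moreover have "l 1 = l 0" using ends by (simp add: l_def)
  ultimately have "homotopic_with (\<lambda>q. q 0 = l 0 \<and> q 1 = l 0) (top_of_set {0..1}) X l (\<lambda>t. l 0)"
    using X by (auto simp: simply_connected_space_def)
  then obtain h :: "real \<times> real \<Rightarrow> 'a" where
    h: "continuous_map (prod_topology (top_of_set {0..1}) (top_of_set {0..1})) X h"
      "\<And>t. h (0, t) = l t" "\<And>t. h (1, t) = l 0"
      "\<And>s. s \<in> {0..1} \<Longrightarrow> h (s, 0) = l 0 \<and> h (s, 1) = l 0"
    unfolding homotopic_with_def by blast
  have hc: "continuous_map (top_of_set ({0..1} \<times> {0..1})) X h"
    using h(1) by (simp add: prod_topology_subtopology subtopology_subtopology
        Times_Int_Times flip: euclidean_product_topology)
  have uniq: "h a = h b" if "a \<in> {0..1} \<times> {0..1}" "b \<in> {0..1} \<times> {0..1}" "tri_polar a = tri_polar b" for a b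
  proof -
    obtain s t s' t' where ab: "a = (s, t)" "b = (s', t')" by fastforce
    from that have "s = s'" "s = 1 \<or> t = t' \<or> (t = 0 \<and> t' = 1) \<or> (t = 1 \<and> t' = 0)"
      using tri_polar_inj[of s t s' t'] by (auto simp: ab)
    then show ?thesis using h(3) h(4)[of s] that by (auto simp: ab)
  qed
  \<comment> \<open>An arbitrary, generally discontinuous choice of polar coordinates; by
    \<open>uniq\<close> the value of \<open>h\<close> does not depend on it.\<close>
  define c where "c y = (SOME a. a \<in> {0..1} \<times> {0..1} \<and> tri_polar a = y)" for y
  have c: "c y \<in> {0..1} \<times> {0..1}" "tri_polar (c y) = y" if "y \<in> standard_simplex 2" for y
  proof -
    have "\<exists>a. a \<in> {0..1} \<times> {0..1} \<and> tri_polar a = y"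
      by (rule tri_polar_surj[OF that]) auto
    from someI_ex[OF this] show "c y \<in> {0..1} \<times> {0..1}" "tri_polar (c y) = y"
      by (simp_all add: c_def)
  qed
  define \<sigma> where "\<sigma> y = h (c y)" for y
  have \<sigma>: "\<sigma> (tri_polar a) = h a" if "a \<in> {0..1} \<times> {0..1}" for a
  proof -
    have "tri_polar a \<in> standard_simplex 2" using that tri_polar_in by (cases a) auto
    then show ?thesis using uniq[OF c(1) that c(2)] by (simp add: \<sigma>_def)
  qed
  have cont: "continuous_map (top_of_set (standard_simplex 2)) X \<sigma>"
  proof (rule continuous_map_top_of_set_sequentially)
    show "\<sigma> y \<in> topspace X" if "y \<in> standard_simplex 2" for y
      using continuous_map_funspace[OF hc] c(1)[OF that] unfolding \<sigma>_def by auto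
    fix \<tau> :: "nat \<Rightarrow> nat \<Rightarrow> real" and y
    assume \<tau>: "\<And>k. \<tau> k \<in> standard_simplex 2" "y \<in> standard_simplex 2" "\<tau> \<longlonglongrightarrow> y"
    have "seq_compact ({0..1} \<times> {0..1} :: (real \<times> real) set)"
      using compact_eq_seq_compact_metric compact_Times compact_Icc by blast
    moreover have cin: "c (\<tau> k) \<in> {0..1} \<times> {0..1}" for k using c(1)[OF \<tau>(1)] .
    ultimately have "\<exists>a\<in>{0..1} \<times> {0..1}. \<exists>r::nat\<Rightarrow>nat. strict_mono r \<and> ((\<lambda>k. c (\<tau> k)) \<circ> r) \<longlonglongrightarrow> a"
      unfolding seq_compact_def by (elim allE[of _ "\<lambda>k. c (\<tau> k)"]) simp
    then obtain a r where a: "a \<in> {0..1} \<times> {0..1}" "strict_mono (r::nat\<Rightarrow>nat)" "((\<lambda>k. c (\<tau> k)) \<circ> r) \<longlonglongrightarrow> a"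
      by blast
    have "(\<lambda>k. tri_polar (((\<lambda>k. c (\<tau> k)) \<circ> r) k)) \<longlonglongrightarrow> tri_polar a"
      by (rule continuous_on_tendsto_compose[OF continuous_on_tri_polar[of UNIV] a(3)]) auto
    then have "(\<tau> \<circ> r) \<longlonglongrightarrow> tri_polar a"
      using c(2)[OF \<tau>(1)] by (simp add: comp_def)
    then have y: "y = tri_polar a"
      using LIMSEQ_subseq_LIMSEQ[OF \<tau>(3) a(2)] LIMSEQ_unique by blast
    have "limitin X (\<lambda>k. h (((\<lambda>k. c (\<tau> k)) \<circ> r) k)) (h a) sequentially"
      by (rule limitin_continuous_map_top_of_set[OF hc _ a(1,3)]) (use cin in simp)
    then show "\<exists>r::nat\<Rightarrow>nat. limitin X (\<lambda>k. \<sigma> (\<tau> (r k))) (\<sigma> y) sequentially"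
      using \<sigma>[OF a(1)] by (auto simp: y \<sigma>_def comp_def)
  qed
  have bd: "\<sigma> (tri_boundary t) = l t" if "t \<in> {0..1}" for t
    using \<sigma>[of "(0, t)"] that h(2) by (simp add: tri_polar_def)
  show thesis
  proof (rule that[OF cont])
    fix t :: real assume t: "t \<in> {0..1}"
    show "\<sigma> (edge 0 1 t) = p t"
      unfolding edge_boundary(1)[OF t] using t bd[of "t / 3"] by (simp add: l_def)
    show "\<sigma> (edge 1 2 t) = q t"
      unfolding edge_boundary(2)[OF t]
      using t bd[of "(1 + t) / 3"] ends by (cases "t = 0") (auto simp: l_def add_divide_distrib)
    show "\<sigma> (edge 0 2 t) = p' t"
      unfolding edge_boundary(3)[OF t]
      using t bd[of "1 - t / 3"] ends by (cases "t = 1") (auto simp: l_def)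
  qed
qed

section \<open>Sections of a line field\<close>

lemma cis_lift_ratio:
  assumes "compact_convex D" "continuous_on D (\<lambda>y. z' y / z y)"
    and "\<And>y. y \<in> D \<Longrightarrow> cmod (z y) = 1" "\<And>y. y \<in> D \<Longrightarrow> cmod (z' y) = 1"
  obtains \<eta> :: "(nat \<Rightarrow> real) \<Rightarrow> real"
  where "continuous_on D \<eta>" "\<And>y. y \<in> D \<Longrightarrow> z' y = z y * cis (\<eta> y)"
proof -
  have "cmod (z' y / z y) = 1" if "y \<in> D" for y
    using assms(3,4)[OF that] by (simp add: norm_divide)
  from cis_lift[OF assms(1,2) this]
  obtain \<eta> where \<eta>: "continuous_on D \<eta>" "\<And>y. y \<in> D \<Longrightarrow> z' y / z y = cis (\<eta> y)"
    by metis
  have "z' y = z y * cis (\<eta> y)" if "y \<in> D" for y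
  proof -
    have "z y \<noteq> 0" using assms(3)[OF that] by auto
    then show ?thesis using \<eta>(2)[OF that] by (simp add: field_simps)
  qed
  then show thesis using that \<eta>(1) by blast
qed

text \<open>A line field is given by a possibly discontinuous unit vector \<open>s x\<close> in each line; only the
  projection \<open>s x s(x)\<^sup>*\<close> is required to be continuous.  A section over \<open>f\<close> is recorded by its
  phase \<open>z\<close> relative to \<open>s\<close>.\<close>

locale line_field =
  fixes X :: "'a topology" and n :: nat and s :: "'a \<Rightarrow> nat \<Rightarrow> complex"
  assumes unit: "x \<in> topspace X \<Longrightarrow> (\<Sum>i<n. s x i * cnj (s x i)) = 1"
    and proj_cont: "i < n \<Longrightarrow> j < n \<Longrightarrow> continuous_map X euclidean (\<lambda>x. s x i * cnj (s x j))"
begin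

definition sec :: "(nat \<Rightarrow> real) set \<Rightarrow> ((nat \<Rightarrow> real) \<Rightarrow> 'a) \<Rightarrow> ((nat \<Rightarrow> real) \<Rightarrow> complex) \<Rightarrow> bool" where
  "sec D f z \<longleftrightarrow> (\<forall>y\<in>D. cmod (z y) = 1) \<and> (\<forall>i<n. continuous_on D (\<lambda>y. z y * s (f y) i))"

lemma sec_norm: "sec D f z \<Longrightarrow> y \<in> D \<Longrightarrow> cmod (z y) = 1"
  by (simp add: sec_def)

lemma sec_cont: "sec D f z \<Longrightarrow> i < n \<Longrightarrow> continuous_on D (\<lambda>y. z y * s (f y) i)"
  by (simp add: sec_def)

lemma sec_nonzero: "sec D f z \<Longrightarrow> y \<in> D \<Longrightarrow> z y \<noteq> 0"
  using sec_norm by fastforce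

lemma sec_cong:
  assumes "sec D f z" "\<And>y. y \<in> D \<Longrightarrow> f y = f' y" "\<And>y. y \<in> D \<Longrightarrow> z y = z' y"
  shows "sec D f' z'"
proof -
  have "continuous_on D (\<lambda>y. z' y * s (f' y) i)" if "i < n" for i
  proof -
    have "continuous_on D (\<lambda>y. z y * s (f y) i)" using assms(1) that by (simp add: sec_def)
    then show ?thesis by (rule continuous_on_eq) (simp add: assms)
  qed
  then show ?thesis using assms by (simp add: sec_def)
qed

lemma sec_mult:
  assumes "sec D f z" "continuous_on D g" "\<And>y. y \<in> D \<Longrightarrow> cmod (g y) = 1"
  shows "sec D f (\<lambda>y. z y * g y)"
proof -
  have "continuous_on D (\<lambda>y. (z y * s (f y) i) * g y)" if "i < n" for i
    by (rule continuous_on_mult[OF sec_cont[OF assms(1) that] assms(2)])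
  then show ?thesis using assms by (simp add: sec_def norm_mult mult_ac)
qed

lemma sec_mult_cis:
  "sec D f z \<Longrightarrow> continuous_on D \<eta> \<Longrightarrow> sec D f (\<lambda>y. z y * cis (\<eta> y))"
  by (rule sec_mult) (auto intro: continuous_on_compose2[OF continuous_on_cis])

lemma sec_compose:
  assumes "sec D f z" "continuous_on D' g" "g ` D' \<subseteq> D"
  shows "sec D' (\<lambda>y. f (g y)) (\<lambda>y. z (g y))"
proof -
  have "continuous_on D' (\<lambda>y. z (g y) * s (f (g y)) i)" if "i < n" for i
    using assms that by (intro continuous_on_compose2[of D "\<lambda>y. z y * s (f y) i" D' g]) (auto simp: sec_def)
  then show ?thesis using assms by (auto simp: sec_def)
qed

text \<open>As \<open>s\<close> has norm one and \<open>z\<close> has modulus one, the ratio is the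
  inner product of the two continuous sections; the discontinuous \<open>s\<close> cancels.\<close>

lemma sec_ratio:
  assumes z: "sec D f z" and z': "sec D f z'" and f: "\<And>y. y \<in> D \<Longrightarrow> f y \<in> topspace X"
  shows "continuous_on D (\<lambda>y. z' y / z y)"
proof -
  have "continuous_on D (\<lambda>y. \<Sum>i<n. (z' y * s (f y) i) * cnj (z y * s (f y) i))"
    by (intro continuous_on_sum continuous_on_mult[OF sec_cont[OF z'] continuous_on_cnj[OF sec_cont[OF z]]]) auto
  then show ?thesis
  proof (rule continuous_on_eq)
    fix y assume y: "y \<in> D"
    have "z y * cnj (z y) = 1"
      using complex_norm_square[of "z y"] sec_norm[OF z y] by simp
    then have "cnj (z y) = 1 / z y"
      using sec_nonzero[OF z y] by (simp add: field_simps)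
    then have "(\<Sum>i<n. (z' y * s (f y) i) * cnj (z y * s (f y) i)) =
        z' y / z y * (\<Sum>i<n. s (f y) i * cnj (s (f y) i))"
      by (simp add: sum_distrib_left mult_ac)
    then show "(\<Sum>i<n. (z' y * s (f y) i) * cnj (z y * s (f y) i)) = z' y / z y"
      using unit[OF f[OF y]] by simp
  qed
qed

lemma sec_ratio_lift:
  assumes "compact_convex D" "continuous_map (top_of_set D) X f" "sec D f z" "sec D f z'"
  obtains \<eta> :: "(nat \<Rightarrow> real) \<Rightarrow> real"
  where "continuous_on D \<eta>" "\<And>y. y \<in> D \<Longrightarrow> z' y = z y * cis (\<eta> y)"
proof (rule cis_lift_ratio[OF assms(1)])
  show "continuous_on D (\<lambda>y. z' y / z y)"
    by (rule sec_ratio[OF assms(3,4)]) (use assms(2) in \<open>auto simp: continuous_map_def\<close>)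
qed (use that sec_norm assms in auto)

lemma proj_cont_along:
  assumes "continuous_map (top_of_set D) X f" "i < n" "j < n"
  shows "continuous_on D (\<lambda>y. s (f y) i * cnj (s (f y) j))"
  using continuous_map_compose[OF assms(1) proj_cont[OF assms(2,3)]] by (simp add: comp_def)

text \<open>A section over a compact convex set is obtained by projecting a unit vector successively onto
  the lines over the points of a fine subdivision of each segment from a fixed point.\<close>

lemma sec_exists:
  assumes D: "compact_convex D" and f: "continuous_map (top_of_set D) X f"
  obtains z where "sec D f z"
proof (cases "D = {}")
  case True
  then show thesis using that[of "\<lambda>_. 1"] by (simp add: sec_def)
next
  case False
  then obtain a where a: "a \<in> D" by auto
  define h where "h t y = f (seg a y t)" for t y
  have hD: "seg a y t \<in> D" if "t \<in> {0..1}" "y \<in> D" for t y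
    using seg_in[OF D a] that by auto
  then have hX: "h t y \<in> topspace X" if "t \<in> {0..1}" "y \<in> D" for t y
    using f that by (auto simp: h_def continuous_map_def)
  have P: "continuous_on S (\<lambda>x. s (h (u x) (v x)) i * cnj (s (h (u x) (v x)) j))"
    if "continuous_on S u" "continuous_on S v" "u ` S \<subseteq> {0..1}" "v ` S \<subseteq> D" "i < n" "j < n"
    for S :: "'m::topological_space set" and u v i j
    unfolding h_def
  proof (rule continuous_on_compose2[OF proj_cont_along[OF f that(5,6)], of S "\<lambda>x. seg a (v x) (u x)"])
    show "continuous_on S (\<lambda>x. seg a (v x) (u x))" by (intro continuous_intros that)
    show "(\<lambda>x. seg a (v x) (u x)) ` S \<subseteq> D" using that(3,4) by (intro image_subsetI hD) auto
  qed
  define ip where "ip x x' = (\<Sum>j<n. s x j * cnj (s x' j))" for x x'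
  \<comment> \<open>The squared modulus of the inner product of two unit vectors is the trace of the
    product of their projections, so it is continuous although \<open>s\<close> is not.\<close>
  have ip_sq: "(\<Sum>j<n. \<Sum>k<n. (s x j * cnj (s x k)) * cnj (s x' j * cnj (s x' k))) = ip x x' * cnj (ip x x')" for x x'
    unfolding ip_def cnj_sum sum_product by (simp add: mult_ac)
  have "continuous_on ({0..1} \<times> {0..1} \<times> D) (\<lambda>(t, t', y). ip (h t y) (h t' y) * cnj (ip (h t y) (h t' y)))"
    unfolding ip_sq[symmetric] split_beta
    by (intro continuous_intros P) auto
  then obtain N :: nat where N: "N > 0" "\<And>k y. k < N \<Longrightarrow> y \<in> D \<Longrightarrow>
      dist (ip (h (real (Suc k) / N) y) (h (real k / N) y) * cnj (ip (h (real (Suc k) / N) y) (h (real k / N) y)))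
        (ip (h (real k / N) y) (h (real k / N) y) * cnj (ip (h (real k / N) y) (h (real k / N) y))) < 1"
    using seg_uniform_partition[of D "\<lambda>t t' y. ip (h t y) (h t' y) * cnj (ip (h t y) (h t' y))" 1]
      compact_convex_compact[OF D] by auto
  define p where "p k y = h (real k / N) y" for k y
  have pX: "p k y \<in> topspace X" if "k \<le> N" "y \<in> D" for k y
    unfolding p_def using that N by (intro hX) auto
  have Pp: "continuous_on D (\<lambda>y. s (p k y) i * cnj (s (p k y) j))" if "k \<le> N" "i < n" "j < n" for k i j
    unfolding p_def using that N by (intro P continuous_intros) auto
  define S where "S k y = ip (p k y) (p (Suc k) y)" for k y
  \<comment> \<open>At equal times the squared modulus is 1; a zero would differ from it by exactly
    1, against the choice of \<open>N\<close>.\<close>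
  have S_nz: "S k y \<noteq> 0" if "k < N" "y \<in> D" for k y
  proof
    assume "S k y = 0"
    moreover have "ip (p (Suc k) y) (p k y) = cnj (S k y)" by (simp add: S_def ip_def mult_ac)
    moreover have "ip (p k y) (p k y) = 1" using unit[OF pX[of k y]] that by (simp add: ip_def)
    ultimately show False using N(2)[OF that, folded p_def] by simp
  qed
  have S_cont: "continuous_on D (\<lambda>y. complex_of_real (cmod (S k y)))" if "k < N" for k
  proof -
    have "continuous_on D (\<lambda>y. S k y * cnj (S k y))"
      unfolding S_def ip_sq[symmetric] using that by (intro continuous_intros Pp) auto
    moreover have "S k y * cnj (S k y) = complex_of_real ((cmod (S k y))\<^sup>2)" for y
      by (rule complex_norm_square[symmetric])
    ultimately have "continuous_on D (\<lambda>y. Re (complex_of_real ((cmod (S k y))\<^sup>2)))"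
      by (intro continuous_on_Re) simp
    then have "continuous_on D (\<lambda>y. complex_of_real (sqrt (Re (complex_of_real ((cmod (S k y))\<^sup>2)))))"
      by (intro continuous_on_of_real continuous_on_real_sqrt)
    then show ?thesis by simp
  qed
  \<comment> \<open>Projecting \<open>s (p k y)\<close> onto the next line gives
    \<open>S k y\<close> times the next \<open>s\<close>. The product of the normalized factors is
    therefore the phase, relative to \<open>s\<close>, of the vector obtained from
    \<open>s (f a)\<close> by \<open>m\<close> successive normalized projections.\<close>
  define z where "z m y = (\<Prod>k<m. S k y / complex_of_real (cmod (S k y)))" for m y
  have "sec D (p m) (z m)" if "m \<le> N" for m
    using that
  proof (induction m)
    case 0
    have "p 0 y = f a" for y by (simp add: p_def h_def)
    then show ?case by (simp add: sec_def z_def)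
  next
    case (Suc m)
    then have m: "m < N" and IH: "sec D (p m) (z m)" by auto
    have 1: "cmod (z (Suc m) y) = 1" if "y \<in> D" for y
      using sec_norm[OF IH that] S_nz[OF m that] by (simp add: z_def norm_mult norm_divide)
    have "continuous_on D (\<lambda>y. z (Suc m) y * s (p (Suc m) y) i)" if i: "i < n" for i
    proof -
      \<comment> \<open>The projection matrix of the next line applied to the previous section, then
        divided by its length; only continuous data enter.\<close>
      have "continuous_on D (\<lambda>y. (\<Sum>j<n. (z m y * s (p m y) j) * (s (p (Suc m) y) i * cnj (s (p (Suc m) y) j)))
          / complex_of_real (cmod (S m y)))"
        using S_nz[OF m] Suc(2) i
        by (intro continuous_on_divide S_cont[OF m] continuous_on_sum
            continuous_on_mult[OF sec_cont[OF IH] Pp]) auto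
      moreover have "(\<Sum>j<n. (z m y * s (p m y) j) * (s (p (Suc m) y) i * cnj (s (p (Suc m) y) j)))
          = z m y * S m y * s (p (Suc m) y) i" for y
        by (simp add: S_def ip_def sum_distrib_left sum_distrib_right mult_ac)
      ultimately show ?thesis by (simp add: z_def)
    qed
    with 1 show ?case by (simp add: sec_def)
  qed
  from this[of N] have "sec D (p N) (z N)" by simp
  moreover have "p N y = f y" for y using N by (simp add: p_def h_def)
  ultimately show thesis using that[of "z N"] by (simp add: sec_def)
qed

end

section \<open>Phase change along paths\<close>

declare One_nat_def [simp del] One_nat_def [symmetric, simp] Suc_1 [simp]

abbreviation "I1 \<equiv> standard_simplex 1"
abbreviation "I2 \<equiv> standard_simplex 2"

lemma continuous_map_sing:
  "singular_simplex p X \<sigma> \<Longrightarrow> continuous_map (top_of_set (standard_simplex p)) X \<sigma>"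
  by (simp add: singular_simplex_iff)

lemma singular_simplex_face:
  "singular_simplex (Suc p) X \<sigma> \<Longrightarrow> k \<le> Suc p \<Longrightarrow> singular_simplex p X (singular_face (Suc p) k \<sigma>)"
  using singular_simplex_singular_face[of "Suc p" X \<sigma> k] by simp

lemma I1_edge:
  assumes "y \<in> I1" shows "edge 0 1 (y 1) = y" "0 \<le> y 1" "y 1 \<le> 1" "y 0 = 1 - y 1" "\<And>i. i > 1 \<Longrightarrow> y i = 0"
proof -
  have "{..1::nat} = {0, 1}" by auto
  then have "(\<Sum>i\<le>1. y i) = y 0 + y 1" by simp
  then show y: "0 \<le> y 1" "y 1 \<le> 1" "y 0 = 1 - y 1" "\<And>i. i > 1 \<Longrightarrow> y i = 0"
    using assms by (auto simp: standard_simplex_def)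
  show "edge 0 1 (y 1) = y"
  proof
    fix i :: nat
    consider "i = 0" | "i = 1" | "i > 1" by linarith
    then show "edge 0 1 (y 1) i = y i" using y by cases (auto simp: edge_def seg_def vtx_def)
  qed
qed

lemma simplical_face_edge:
  assumes y: "y \<in> I1" and "k \<le> 2"
  shows "simplical_face k y = edge (if 0 < k then 0 else 1) (if 1 < k then 1 else 2) (y 1)"
proof
  fix i :: nat
  consider "i = 0" | "i = 1" | "i = 2" | "i > 2" by linarith
  moreover have "k = 0 \<or> k = 1 \<or> k = 2" using \<open>k \<le> 2\<close> by linarith
  ultimately show "simplical_face k y i = edge (if 0 < k then 0 else 1) (if 1 < k then 1 else 2) (y 1) i"
    using I1_edge[OF y] by cases (auto simp: simplical_face_def edge_def seg_def vtx_def)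
qed

lemma continuous_map_compose_top_of_set:
  assumes "continuous_map (top_of_set D) X f" "continuous_on D' g" "g ` D' \<subseteq> D"
  shows "continuous_map (top_of_set D') X (\<lambda>y. f (g y))"
proof -
  have "continuous_map (top_of_set D') (top_of_set D) g" using assms by auto
  from continuous_map_compose[OF this assms(1)] show ?thesis by (simp add: comp_def)
qed

context line_field
begin

definition transport :: "((nat \<Rightarrow> real) \<Rightarrow> 'a) \<Rightarrow> (nat \<Rightarrow> real) \<Rightarrow> complex" where
  "transport \<gamma> = (SOME z. sec I1 \<gamma> z \<and> z (vtx 0) = 1 \<and> z (vtx 1) = 1)"

text \<open>The real total rotation of the section \<open>z\<close> against
  \<open>transport \<gamma>\<close> from start to end. Any two continuous lifts
  \<open>\<eta>\<close> differ by a constant, so the choice determines a unique number once a lift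
  exists.\<close>

definition phase :: "((nat \<Rightarrow> real) \<Rightarrow> 'a) \<Rightarrow> ((nat \<Rightarrow> real) \<Rightarrow> complex) \<Rightarrow> real" where
  "phase \<gamma> z = (SOME r. \<exists>\<eta>. continuous_on I1 \<eta> \<and> (\<forall>y\<in>I1. z y = transport \<gamma> y * cis (\<eta> y)) \<and>
     r = \<eta> (vtx 1) - \<eta> (vtx 0))"

lemma transport:
  assumes "singular_simplex 1 X \<gamma>"
  shows "sec I1 \<gamma> (transport \<gamma>)" "transport \<gamma> (vtx 0) = 1" "transport \<gamma> (vtx 1) = 1"
proof -
  obtain z where z: "sec I1 \<gamma> z"
    using sec_exists[OF compact_convex_standard_simplex continuous_map_sing[OF assms]] .
  \<comment> \<open>A correction of the phase that is linear in the barycentric coordinates and has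
    the value needed at each of the two ends.\<close>
  define \<eta> where "\<eta> y = - (y 0 * Arg (z (vtx 0)) + y 1 * Arg (z (vtx 1)))" for y :: "nat \<Rightarrow> real"
  have "cis (- Arg (z (vtx i))) = cnj (z (vtx i))" if "i \<le> 1" for i
    using sec_norm[OF z, of "vtx i"] sec_nonzero[OF z, of "vtx i"] that
    by (simp add: cis_cnj[symmetric] cis_Arg sgn_eq)
  moreover have "z (vtx i) * cnj (z (vtx i)) = 1" if "i \<le> 1" for i
    using complex_norm_square[of "z (vtx i)"] sec_norm[OF z, of "vtx i"] that by simp
  ultimately have c: "z (vtx i) * cis (- Arg (z (vtx i))) = 1" if "i \<le> 1" for i using that by simp
  have "z (vtx i) * cis (\<eta> (vtx i)) = 1" if "i \<le> 1" for i
  proof -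
    have "i = 0 \<or> i = 1" using that by linarith
    then have "\<eta> (vtx i) = - Arg (z (vtx i))" by (auto simp: \<eta>_def vtx_def)
    then show ?thesis using c[OF that] by simp
  qed
  moreover have "continuous_on I1 \<eta>" unfolding \<eta>_def by (intro continuous_intros)
  ultimately have "\<exists>z. sec I1 \<gamma> z \<and> z (vtx 0) = 1 \<and> z (vtx 1) = 1"
    by (intro exI[of _ "\<lambda>y. z y * cis (\<eta> y)"]) (auto intro: sec_mult_cis z)
  from someI_ex[OF this, folded transport_def]
  show "sec I1 \<gamma> (transport \<gamma>)" "transport \<gamma> (vtx 0) = 1" "transport \<gamma> (vtx 1) = 1" by auto
qed

lemma phase_eqI:
  assumes \<gamma>: "singular_simplex 1 X \<gamma>"
    and \<eta>: "continuous_on I1 \<eta>" "\<And>y. y \<in> I1 \<Longrightarrow> z y = transport \<gamma> y * cis (\<eta> y)"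
  shows "phase \<gamma> z = \<eta> (vtx 1) - \<eta> (vtx 0)"
  unfolding phase_def
proof (rule some_equality)
  fix r assume "\<exists>\<eta>'. continuous_on I1 \<eta>' \<and> (\<forall>y\<in>I1. z y = transport \<gamma> y * cis (\<eta>' y)) \<and>
     r = \<eta>' (vtx 1) - \<eta>' (vtx 0)"
  then obtain \<eta>' where \<eta>': "continuous_on I1 \<eta>'" "\<And>y. y \<in> I1 \<Longrightarrow> z y = transport \<gamma> y * cis (\<eta>' y)"
    "r = \<eta>' (vtx 1) - \<eta>' (vtx 0)" by blast
  have "\<eta>' (vtx 1) - \<eta> (vtx 1) = \<eta>' (vtx 0) - \<eta> (vtx 0)"
  proof (rule cis_eq_1_constant[OF compact_convex_connected[OF compact_convex_standard_simplex],
        where k = "\<lambda>y. \<eta>' y - \<eta> y"])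
    show "cis (\<eta>' y - \<eta> y) = 1" if "y \<in> I1" for y
      using \<eta>(2)[OF that] \<eta>'(2)[OF that] sec_nonzero[OF transport(1)[OF \<gamma>] that]
      by (simp flip: cis_divide)
  qed (auto intro!: continuous_intros \<eta> \<eta>')
  then show "r = \<eta> (vtx 1) - \<eta> (vtx 0)" using \<eta>'(3) by simp
qed (use \<eta> in blast)

lemma phase_lift:
  assumes \<gamma>: "singular_simplex 1 X \<gamma>" and z: "sec I1 \<gamma> z"
  obtains \<eta> where "continuous_on I1 \<eta>" "\<And>y. y \<in> I1 \<Longrightarrow> z y = transport \<gamma> y * cis (\<eta> y)"
    "phase \<gamma> z = \<eta> (vtx 1) - \<eta> (vtx 0)"
proof -
  obtain \<eta> where "continuous_on I1 \<eta>" "\<And>y. y \<in> I1 \<Longrightarrow> z y = transport \<gamma> y * cis (\<eta> y)"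
    using sec_ratio_lift[OF compact_convex_standard_simplex continuous_map_sing[OF \<gamma>] transport(1)[OF \<gamma>] z] by blast
  then show thesis using that phase_eqI[OF \<gamma>] by blast
qed

lemma phase_cong:
  assumes "\<And>y. y \<in> I1 \<Longrightarrow> z y = z' y"
  shows "phase \<gamma> z = phase \<gamma> z'"
  unfolding phase_def using assms by simp

lemma phase_mult_cis:
  assumes \<gamma>: "singular_simplex 1 X \<gamma>" and z: "sec I1 \<gamma> z" and \<eta>: "continuous_on I1 \<eta>"
  shows "phase \<gamma> (\<lambda>y. z y * cis (\<eta> y)) = phase \<gamma> z + (\<eta> (vtx 1) - \<eta> (vtx 0))"
proof -
  obtain \<eta>' where \<eta>': "continuous_on I1 \<eta>'" "\<And>y. y \<in> I1 \<Longrightarrow> z y = transport \<gamma> y * cis (\<eta>' y)"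
    "phase \<gamma> z = \<eta>' (vtx 1) - \<eta>' (vtx 0)" using phase_lift[OF \<gamma> z] by blast
  have "phase \<gamma> (\<lambda>y. z y * cis (\<eta> y)) = (\<eta>' (vtx 1) + \<eta> (vtx 1)) - (\<eta>' (vtx 0) + \<eta> (vtx 0))"
    by (rule phase_eqI[OF \<gamma>, where \<eta> = "\<lambda>y. \<eta>' y + \<eta> y"])
       (auto intro!: continuous_intros \<eta> \<eta>' simp: \<eta>'(2) cis_mult[symmetric])
  then show ?thesis using \<eta>'(3) by simp
qed

lemma phase_cis:
  assumes \<gamma>: "singular_simplex 1 X \<gamma>" and z: "sec I1 \<gamma> z"
  shows "z (vtx 1) = z (vtx 0) * cis (phase \<gamma> z)"
proof -
  obtain \<eta> where \<eta>: "continuous_on I1 \<eta>" "\<And>y. y \<in> I1 \<Longrightarrow> z y = transport \<gamma> y * cis (\<eta> y)"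
    "phase \<gamma> z = \<eta> (vtx 1) - \<eta> (vtx 0)" using phase_lift[OF \<gamma> z] by blast
  show ?thesis using \<eta>(2)[of "vtx 0"] \<eta>(2)[of "vtx 1"] transport[OF \<gamma>]
    by (simp add: \<eta>(3) cis_mult)
qed

section \<open>The curvature cocycle\<close>

definition dphase :: "((nat \<Rightarrow> real) \<Rightarrow> 'a) \<Rightarrow> ((nat \<Rightarrow> real) \<Rightarrow> complex) \<Rightarrow> real" where
  "dphase \<sigma> z =
    phase (singular_face 2 0 \<sigma>) (\<lambda>y. z (simplical_face 0 y)) -
    phase (singular_face 2 1 \<sigma>) (\<lambda>y. z (simplical_face 1 y)) +
    phase (singular_face 2 2 \<sigma>) (\<lambda>y. z (simplical_face 2 y))"

text \<open>Up to sign, the winding number of the loop formed by the three transports along the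
  edges, measured against a section \<open>z\<close> over the whole triangle.\<close>

definition curv :: "((nat \<Rightarrow> real) \<Rightarrow> 'a) \<Rightarrow> int" where
  "curv \<sigma> = (SOME k. \<forall>z. sec I2 \<sigma> z \<longrightarrow> dphase \<sigma> z = 2 * pi * real_of_int k)"

lemma sec_face:
  assumes "sec (standard_simplex (Suc p)) \<sigma> z" "k \<le> Suc p"
  shows "sec (standard_simplex p) (singular_face (Suc p) k \<sigma>) (\<lambda>y. z (simplical_face k y))"
proof (rule sec_cong[where f = "\<lambda>y. \<sigma> (simplical_face k y)"])
  show "sec (standard_simplex p) (\<lambda>y. \<sigma> (simplical_face k y)) (\<lambda>y. z (simplical_face k y))"
    by (rule sec_compose[OF assms(1) continuous_on_simplical_face])
       (use assms(2) simplical_face_in in auto)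
qed (auto simp: singular_face_eq)

lemma face2:
  assumes "singular_simplex 2 X \<sigma>" "k \<le> 2"
  shows "singular_simplex 1 X (singular_face 2 k \<sigma>)"
    "sec I2 \<sigma> z \<Longrightarrow> sec I1 (singular_face 2 k \<sigma>) (\<lambda>y. z (simplical_face k y))"
  using singular_simplex_face[of 1 X \<sigma> k] sec_face[of 1 \<sigma> z k] assms
  by simp_all

text \<open>\<open>\<eta>\<close> is single-valued on the triangle, so its increments along the
  three edges cancel: each vertex occurs once with either sign.\<close>

lemma dphase_mult_cis:
  assumes \<sigma>: "singular_simplex 2 X \<sigma>" and z: "sec I2 \<sigma> z" and \<eta>: "continuous_on I2 \<eta>"
  shows "dphase \<sigma> (\<lambda>y. z y * cis (\<eta> y)) = dphase \<sigma> z"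
proof -
  have "phase (singular_face 2 k \<sigma>) (\<lambda>y. z (simplical_face k y) * cis (\<eta> (simplical_face k y))) =
      phase (singular_face 2 k \<sigma>) (\<lambda>y. z (simplical_face k y)) +
        (\<eta> (simplical_face k (vtx 1)) - \<eta> (simplical_face k (vtx 0)))" if "k \<le> 2" for k
  proof (rule phase_mult_cis[OF face2(1)[OF \<sigma> that] face2(2)[OF \<sigma> that z]])
    show "continuous_on I1 (\<lambda>y. \<eta> (simplical_face k y))"
      by (rule continuous_on_compose2[OF \<eta> continuous_on_simplical_face])
         (use simplical_face_in[of k 1] that in auto)
  qed
  from this[of 0] this[of 1] this[of 2] show ?thesis
    by (simp add: dphase_def simplical_face_vtx)
qed

text \<open>Integrality: the end values of \<open>z\<close> on the edges multiply consistently
  around the triangle, so the alternating sum of the phases has \<open>cis\<close> equal to 1.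
  Independence of \<open>z\<close>: two sections over the triangle differ by a continuous real
  phase, which \<open>dphase_mult_cis\<close> discards.\<close>

lemma curv:
  assumes \<sigma>: "singular_simplex 2 X \<sigma>" and z: "sec I2 \<sigma> z"
  shows "dphase \<sigma> z = 2 * pi * real_of_int (curv \<sigma>)"
proof -
  have ph: "z (simplical_face k (vtx 1)) = z (simplical_face k (vtx 0)) *
      cis (phase (singular_face 2 k \<sigma>) (\<lambda>y. z (simplical_face k y)))" if "k \<le> 2" for k
    by (rule phase_cis[OF face2(1)[OF \<sigma> that] face2(2)[OF \<sigma> that z]])
  define a where "a k = phase (singular_face 2 k \<sigma>) (\<lambda>y. z (simplical_face k y))" for k
  have e: "z (vtx 2) = z (vtx 1) * cis (a 0)" "z (vtx 2) = z (vtx 0) * cis (a 1)"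
    "z (vtx 1) = z (vtx 0) * cis (a 2)"
    using ph[of 0] ph[of 1] ph[of 2] by (simp_all add: simplical_face_vtx a_def)
  have "z (vtx 0) \<noteq> 0" using sec_nonzero[OF z, of "vtx 0"] by simp
  then have "cis (a 2) * cis (a 0) = cis (a 1)" using e by (simp add: mult.assoc)
  then have "cis (a 0 - a 1 + a 2) = 1"
  proof -
    have "cis (a 0 - a 1 + a 2) = cis (a 2 + a 0) / cis (a 1)" by (simp add: cis_divide algebra_simps)
    also have "cis (a 2 + a 0) = cis (a 1)"
      using \<open>cis (a 2) * cis (a 0) = cis (a 1)\<close> by (simp add: cis_mult)
    finally show ?thesis by simp
  qed
  then obtain k :: int where "a 0 - a 1 + a 2 = 2 * pi * real_of_int k"
    by (auto simp: complex_eq_iff cos_one_2pi_int mult_ac)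
  then have k: "dphase \<sigma> z = 2 * pi * real_of_int k" by (simp add: dphase_def a_def)
  have "\<forall>z'. sec I2 \<sigma> z' \<longrightarrow> dphase \<sigma> z' = 2 * pi * real_of_int k"
  proof (intro allI impI)
    fix z' assume z': "sec I2 \<sigma> z'"
    obtain \<eta> where \<eta>: "continuous_on I2 \<eta>" "\<And>y. y \<in> I2 \<Longrightarrow> z' y = z y * cis (\<eta> y)"
      using sec_ratio_lift[OF compact_convex_standard_simplex continuous_map_sing[OF \<sigma>] z z'] by blast
    have "phase (singular_face 2 k \<sigma>) (\<lambda>y. z' (simplical_face k y)) =
        phase (singular_face 2 k \<sigma>) (\<lambda>y. z (simplical_face k y) * cis (\<eta> (simplical_face k y)))" if "k \<le> 2" for k
      by (rule phase_cong) (use \<eta>(2) simplical_face_in[of k 1] that in auto)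
    then have "dphase \<sigma> z' = dphase \<sigma> (\<lambda>y. z y * cis (\<eta> y))" by (simp add: dphase_def)
    then show "dphase \<sigma> z' = 2 * pi * real_of_int k"
      using dphase_mult_cis[OF \<sigma> z \<eta>(1)] k by simp
  qed
  then have "\<exists>k. \<forall>z. sec I2 \<sigma> z \<longrightarrow> dphase \<sigma> z = 2 * pi * real_of_int k" by blast
  from someI_ex[OF this, folded curv_def] z show ?thesis by blast
qed

text \<open>A single section over the tetrahedron restricts to all four faces and computes all four
  curvatures. Each of the six edges then contributes \<open>T k j\<close> twice with opposite
  signs.\<close>

lemma curv_cocycle:
  assumes \<tau>: "singular_simplex 3 X \<tau>"
  shows "curv (singular_face 3 0 \<tau>) - curv (singular_face 3 1 \<tau>) +
    curv (singular_face 3 2 \<tau>) - curv (singular_face 3 3 \<tau>) = 0"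
proof -
  obtain z where z: "sec (standard_simplex 3) \<tau> z"
    using sec_exists[OF compact_convex_standard_simplex continuous_map_sing[OF \<tau>]] .
  define T where "T k j = phase (sing 1 (\<lambda>y. \<tau> (simplical_face k (simplical_face j y))))
    (\<lambda>y. z (simplical_face k (simplical_face j y)))" for k j
  have ff: "singular_face 2 j (singular_face 3 k \<tau>) = sing 1 (\<lambda>y. \<tau> (simplical_face k (simplical_face j y)))"
    if "k \<le> 3" "j \<le> 2" for j k
    using singular_face_eq[of 2 k \<tau>] singular_face_sing[of j 1 "\<lambda>y. \<tau> (simplical_face k y)"] that
    by simp
  have K: "2 * pi * real_of_int (curv (singular_face 3 k \<tau>)) = T k 0 - T k 1 + T k 2" if k: "k \<le> 3" for k
  proof -
    have "singular_simplex 2 X (singular_face 3 k \<tau>)"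
      "sec I2 (singular_face 3 k \<tau>) (\<lambda>y. z (simplical_face k y))"
      using singular_simplex_face[of 2 X \<tau> k] sec_face[of 2 \<tau> z k] \<tau> z k
      by simp_all
    from curv[OF this] show ?thesis using ff[OF k] by (simp add: dphase_def T_def)
  qed
  have "T k j = T (Suc j) k" if "k \<le> j" for k j
    unfolding T_def simplical_face_commute[OF that] ..
  note this[of 0 0] this[of 0 1] this[of 0 2] this[of 1 1] this[of 1 2] this[of 2 2]
  then have "2 * pi * real_of_int (curv (singular_face 3 0 \<tau>) - curv (singular_face 3 1 \<tau>) +
    curv (singular_face 3 2 \<tau>) - curv (singular_face 3 3 \<tau>)) = 0"
    using K[of 0] K[of 1] K[of 2] K[of 3] by (simp add: algebra_simps Suc_numeral)
  then show ?thesis by (simp only: mult_eq_0_iff of_int_eq_0_iff) simp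
qed

text \<open>Fix a path \<open>P x\<close> from a base point to each \<open>x\<close>. The triangle
  \<open>T \<gamma>\<close> fills the loop made of \<open>P\<close> to the start of
  \<open>\<gamma>\<close>, \<open>\<gamma>\<close> itself and \<open>P\<close> to its end, and
  \<open>b \<gamma>\<close> is its curvature. For a 2-simplex, the fillings of its three edges and
  the simplex itself bound a closed surface, on which the cocycle vanishes.\<close>

lemma curv_coboundary:
  assumes sc: "simply_connected_space X" and Hom: "Hom_to_int_trivial (homology_group 2 X)"
  obtains b where "\<And>\<sigma>. singular_simplex 2 X \<sigma> \<Longrightarrow>
    curv \<sigma> = b (singular_face 2 0 \<sigma>) - b (singular_face 2 1 \<sigma>) + b (singular_face 2 2 \<sigma>)"
proof (cases "topspace X = {}")
  case True
  then show thesis using that singular_simplex_empty by metis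
next
  case False
  then obtain x0 where x0: "x0 \<in> topspace X" by blast
  have "\<exists>p. pathin X p \<and> p 0 = x0 \<and> p 1 = x" if "x \<in> topspace X" for x
    using sc that x0 by (simp add: simply_connected_space_def path_connected_space_def)
  then obtain p where p: "\<And>x. x \<in> topspace X \<Longrightarrow> pathin X (p x) \<and> p x 0 = x0 \<and> p x 1 = x" by metis
  define P where "P x = sing 1 (\<lambda>v. p x (v 1))" for x
  have "\<exists>\<sigma>. singular_simplex 2 X \<sigma> \<and> singular_face 2 0 \<sigma> = \<gamma> \<and>
      singular_face 2 1 \<sigma> = P (\<gamma> (vtx 1)) \<and> singular_face 2 2 \<sigma> = P (\<gamma> (vtx 0))"
    if \<gamma>: "singular_simplex 1 X \<gamma>" for \<gamma>
  proof -
    have cm: "continuous_map (top_of_set I1) X \<gamma>" by (rule continuous_map_sing[OF \<gamma>])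
    have e_in: "edge 0 1 t \<in> I1" if "t \<in> {0..1}" for t
      unfolding edge_def using that by (intro seg_in compact_convex_standard_simplex) auto
    have "pathin X (\<lambda>t. \<gamma> (edge 0 1 t))"
      unfolding pathin_def
      by (rule continuous_map_compose_top_of_set[OF cm])
         (use e_in in \<open>auto simp: edge_def intro!: continuous_intros\<close>)
    moreover have "\<gamma> (vtx i) \<in> topspace X" if "i \<le> 1" for i
      using cm that by (auto simp: continuous_map_def)
    ultimately obtain \<sigma> where \<sigma>: "continuous_map (top_of_set I2) X \<sigma>"
      "\<And>t. t \<in> {0..1} \<Longrightarrow> \<sigma> (edge 0 1 t) = p (\<gamma> (vtx 0)) t"
      "\<And>t. t \<in> {0..1} \<Longrightarrow> \<sigma> (edge 1 2 t) = \<gamma> (edge 0 1 t)"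
      "\<And>t. t \<in> {0..1} \<Longrightarrow> \<sigma> (edge 0 2 t) = p (\<gamma> (vtx 1)) t"
      using simply_connected_triangle[OF sc, of "p (\<gamma> (vtx 0))" "\<lambda>t. \<gamma> (edge 0 1 t)" "p (\<gamma> (vtx 1))"] p
      by (auto simp: edge_def)
    have "singular_face 2 k (sing 2 \<sigma>) = sing 1 (\<lambda>y. \<sigma> (edge (if 0 < k then 0 else 1) (if 1 < k then 1 else 2) (y 1)))"
      if "k \<le> 2" for k
    proof -
      have "singular_face 2 k (sing 2 \<sigma>) = sing 1 (\<lambda>y. \<sigma> (simplical_face k y))"
        using singular_face_sing[of k 1 \<sigma>] that by (simp add: Suc_1)
      moreover have "simplical_face k y = edge (if 0 < k then 0 else 1) (if 1 < k then 1 else 2) (y 1)"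
        if "y \<in> I1" for y
        using simplical_face_edge[OF that \<open>k \<le> 2\<close>] .
      ultimately show ?thesis by (auto intro: sing_cong)
    qed
    from this[of 0] this[of 1] this[of 2]
    have "singular_face 2 0 (sing 2 \<sigma>) = sing 1 \<gamma>" "singular_face 2 1 (sing 2 \<sigma>) = P (\<gamma> (vtx 1))"
       "singular_face 2 2 (sing 2 \<sigma>) = P (\<gamma> (vtx 0))"
      unfolding P_def using I1_edge(2,3)
      by (auto intro!: sing_cong simp: \<sigma>(2,4)) (simp add: \<sigma>(3) I1_edge)
    then show ?thesis
      using singular_simplex_sing[OF \<sigma>(1)] sing_id[OF \<gamma>] by (intro exI[of _ "sing 2 \<sigma>"]) simp
  qed
  then obtain T where T: "\<And>\<gamma>. singular_simplex 1 X \<gamma> \<Longrightarrow> singular_simplex 2 X (T \<gamma>) \<and>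
      singular_face 2 0 (T \<gamma>) = \<gamma> \<and> singular_face 2 1 (T \<gamma>) = P (\<gamma> (vtx 1)) \<and>
      singular_face 2 2 (T \<gamma>) = P (\<gamma> (vtx 0))" by metis
  show thesis
  proof (rule that[of "\<lambda>\<gamma>. curv (T \<gamma>)"])
    fix \<sigma> assume \<sigma>: "singular_simplex 2 X \<sigma>"
    define g where "g k = singular_face 2 k \<sigma>" for k
    have g: "singular_simplex 1 X (g k)" if "k \<le> 2" for k
      unfolding g_def using face2(1)[OF \<sigma> that] .
    have gv: "g k (vtx i) = \<sigma> (simplical_face k (vtx i))" if "i \<le> 1" for k i
    proof -
      have "g k = sing 1 (\<lambda>x. \<sigma> (simplical_face k x))"
        unfolding g_def by (rule singular_face_eq[of 1 k \<sigma>, unfolded Suc_1])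
      then show ?thesis using that by simp
    qed
    \<comment> \<open>The tetrahedron without interior over \<open>\<sigma>\<close>. In its boundary
      the edges of \<open>\<sigma>\<close> cancel, and so do the paths \<open>P\<close>, two of
      which end at each vertex with opposite signs.\<close>
    define w where "w = frag_of (T (g 0)) - frag_of (T (g 1)) + frag_of (T (g 2)) - frag_of \<sigma>"
    have Tg: "singular_simplex 2 X (T (g k))" if "k \<le> 2" for k
      by (rule conjunct1[OF T[OF g[OF that]]])
    have 1: "singular_chain 2 X (frag_of (T (g k)))" if "k \<le> 2" for k
      using Tg[OF that] by (simp only: singular_chain_of)
    have 2: "singular_chain 2 X (frag_of \<sigma>)"
      using \<sigma> by (simp only: singular_chain_of)
    have "singular_chain 2 X w"
      unfolding w_def
      by (rule singular_chain_diff[OF singular_chain_add[OF singular_chain_diff[OF 1 1] 1] 2]) simp_all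
    moreover have "chain_boundary 2 w = 0"
    proof -
      have bT: "chain_boundary 2 (frag_of (T (g k))) =
          frag_of (g k) - frag_of (P (g k (vtx 1))) + frag_of (P (g k (vtx 0)))" if "k \<le> 2" for k
        using T[OF g[OF that]] by (simp only: chain_boundary_2)
      have v: "g 0 (vtx 0) = g 2 (vtx 1)" "g 0 (vtx 1) = g 1 (vtx 1)" "g 1 (vtx 0) = g 2 (vtx 0)"
        by (simp_all add: gv simplical_face_vtx)
      have b\<sigma>: "chain_boundary 2 (frag_of \<sigma>) = frag_of (g 0) - frag_of (g 1) + frag_of (g 2)"
        by (simp only: chain_boundary_2 g_def)
      have "chain_boundary 2 w = chain_boundary 2 (frag_of (T (g 0))) - chain_boundary 2 (frag_of (T (g 1))) +
          chain_boundary 2 (frag_of (T (g 2))) - chain_boundary 2 (frag_of \<sigma>)"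
        by (simp only: w_def chain_boundary_add chain_boundary_diff)
      also have "\<dots> = 0"
        unfolding b\<sigma> using bT[of 0] bT[of 1] bT[of 2] v by simp
      finally show ?thesis .
    qed
    ultimately have "cochain_eval curv w = 0"
      using cocycle_vanishes_on_cycles[of X curv w, OF Hom] curv_cocycle by simp
    then show "curv \<sigma> = curv (T (singular_face 2 0 \<sigma>)) - curv (T (singular_face 2 1 \<sigma>)) +
        curv (T (singular_face 2 2 \<sigma>))"
      by (simp add: w_def g_def)
  qed
qed

end

section \<open>Cones over paths in a convex set\<close>

text \<open>At \<open>r = 0\<close> the quotient need not converge, but \<open>g\<close> is bounded
  on the compact interval and the factor \<open>r\<close> forces the product to 0.\<close>

lemma continuous_on_perspective:
  fixes g :: "real \<Rightarrow> real"
  assumes g: "continuous_on {0..1} g"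
  shows "continuous_on {(r, t). 0 \<le> t \<and> t \<le> r} (\<lambda>(r, t). r * g (t / r))" (is "continuous_on ?S ?f")
  unfolding continuous_on_def
proof
  fix p assume p: "p \<in> ?S"
  obtain r t where rt: "p = (r, t)" "0 \<le> t" "t \<le> r" using p by auto
  show "(?f \<longlongrightarrow> ?f p) (at p within ?S)"
  proof (cases "r = 0")
    case True
    have "compact (g ` {0..1})" by (intro compact_continuous_image g) simp
    then obtain M where M: "\<And>u. u \<in> {0..1} \<Longrightarrow> \<bar>g u\<bar> \<le> M"
      using compact_imp_bounded bounded_iff by (metis imageI real_norm_def)
    have "((\<lambda>q. \<bar>fst q\<bar> * M) \<longlongrightarrow> \<bar>fst p\<bar> * M) (at p within ?S)"
      by (intro tendsto_intros)
    then have lim: "((\<lambda>q. \<bar>fst q\<bar> * M) \<longlongrightarrow> 0) (at p within ?S)" by (simp add: rt True)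
    have "(?f \<longlongrightarrow> 0) (at p within ?S)"
    proof (rule Lim_null_comparison[OF _ lim])
      have "norm (?f q) \<le> \<bar>fst q\<bar> * M" if qS: "q \<in> ?S" for q
      proof -
        obtain r' t' where q: "q = (r', t')" "0 \<le> t'" "t' \<le> r'" using qS by (cases q) auto
        then have "t' / r' \<in> {0..1}" by (cases "r' = 0") auto
        from M[OF this] show ?thesis by (simp add: q abs_mult mult_left_mono)
      qed
      then show "\<forall>\<^sub>F q in at p within ?S. norm (?f q) \<le> \<bar>fst q\<bar> * M"
        by (auto simp: eventually_at_filter)
    qed
    then show ?thesis by (simp add: rt True)
  next
    case False
    let ?T = "{(r, t). 0 \<le> t \<and> t \<le> r \<and> (0::real) < r}"
    have pT: "p \<in> ?T" using rt False by auto
    have "continuous_on ?T (\<lambda>q. fst q * g (snd q / fst q))"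
    proof (intro continuous_intros continuous_on_compose2[OF g])
      show "(\<lambda>q. snd q / fst q) ` ?T \<subseteq> {0..1}" by auto
    qed auto
    then have "((\<lambda>q. fst q * g (snd q / fst q)) \<longlongrightarrow> fst p * g (snd p / fst p)) (at p within ?T)"
      using pT unfolding continuous_on_def by blast
    moreover have "at p within ?T = at p within ?S"
    proof (rule at_within_nhd)
      show "open {q::real \<times> real. 0 < fst q}"
        by (intro open_Collect_less continuous_intros)
    qed (use pT in auto)
    ultimately have "((\<lambda>q. fst q * g (snd q / fst q)) \<longlongrightarrow> fst p * g (snd p / fst p)) (at p within ?S)"
      by simp
    then show ?thesis by (simp add: case_prod_unfold)
  qed
qed

lemma mem_I2:
  assumes "x \<in> I2"
  shows "0 \<le> x 0" "0 \<le> x 1" "0 \<le> x 2" "x 1 + x 2 = 1 - x 0" "x 0 \<le> 1" "x 1 \<le> 1" "x 2 \<le> 1"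
  using assms by (auto simp: mem_standard_simplex_2)

text \<open>At the apex \<open>x 0 = 1\<close> the quotient is \<open>0 / 0 = 0\<close>, which is harmless since its weight vanishes.\<close>

definition path_cone :: "(nat \<Rightarrow> real) \<Rightarrow> ((nat \<Rightarrow> real) \<Rightarrow> nat \<Rightarrow> real) \<Rightarrow> (nat \<Rightarrow> real) \<Rightarrow> nat \<Rightarrow> real" where
  "path_cone a q x = seg (q (edge 0 1 (x 2 / (1 - x 0)))) a (x 0)"

lemma edge_in_I1: "0 \<le> t \<Longrightarrow> t \<le> 1 \<Longrightarrow> edge 0 1 t \<in> I1"
  unfolding edge_def by (intro seg_in compact_convex_standard_simplex) auto

lemma path_cone:
  assumes D: "compact_convex D" and a: "a \<in> D" and q: "continuous_on I1 q" "q ` I1 \<subseteq> D"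
  shows "continuous_on I2 (path_cone a q)" "path_cone a q ` I2 \<subseteq> D"
proof -
  have ratio: "0 \<le> x 2 / (1 - x 0)" "x 2 / (1 - x 0) \<le> 1" if "x \<in> I2" for x
    using mem_I2[OF that] by (auto simp: divide_le_eq_1)
  show "path_cone a q ` I2 \<subseteq> D"
  proof (intro image_subsetI)
    fix x assume x: "x \<in> I2"
    have "q (edge 0 1 (x 2 / (1 - x 0))) \<in> D"
      using edge_in_I1[OF ratio[OF x]] q(2) by blast
    then show "path_cone a q x \<in> D"
      unfolding path_cone_def using mem_I2[OF x] by (intro seg_in[OF D] a)
  qed
  show "continuous_on I2 (path_cone a q)"
  proof (rule continuous_on_coordinatewise_then_product)
    fix i
    have c: "continuous_on {0..1} (\<lambda>t. q (edge 0 1 t) i)"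
    proof (rule continuous_on_product_then_coordinatewise, rule continuous_on_compose2[OF q(1)])
      show "continuous_on {0..1} (edge 0 1)" unfolding edge_def by (intro continuous_intros)
    qed (use edge_in_I1 in auto)
    have "continuous_on I2 (\<lambda>x. (\<lambda>(r, t). r * q (edge 0 1 (t / r)) i) (1 - x 0, x 2))"
      by (rule continuous_on_compose2[OF continuous_on_perspective[OF c]])
         (use mem_I2 in \<open>force intro!: continuous_intros\<close>)+
    then show "continuous_on I2 (\<lambda>x. path_cone a q x i)"
      unfolding path_cone_def seg_def by (auto intro!: continuous_intros)
  qed
qed

lemma path_cone_faces:
  assumes y: "y \<in> I1"
  shows "path_cone a q (simplical_face 0 y) = q y"
    "path_cone a q (simplical_face 1 y) = seg a (q (vtx 1)) (y 1)"
    "path_cone a q (simplical_face 2 y) = seg a (q (vtx 0)) (y 1)"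
proof -
  note e = I1_edge[OF y]
  have seg_swap: "seg u a (1 - t) = seg a u t" for u t by (simp add: seg_def algebra_simps fun_eq_iff)
  have e01: "edge 0 1 1 = vtx 1" "edge 0 1 0 = vtx 0" by (simp_all add: edge_def)
  show "path_cone a q (simplical_face 0 y) = q y"
    using e(1) by (simp add: path_cone_def simplical_face_def)
  \<comment> \<open>On this face the quotient is \<open>y 1 / y 1\<close>; the apex
    \<open>y 1 = 0\<close> is separated because the quotient is 0 there instead of 1.\<close>
  show "path_cone a q (simplical_face 1 y) = seg a (q (vtx 1)) (y 1)"
    using e(4) by (cases "y 1 = 0") (simp_all add: path_cone_def simplical_face_def seg_swap e01)
  show "path_cone a q (simplical_face 2 y) = seg a (q (vtx 0)) (y 1)"
    using e(4) by (simp add: path_cone_def simplical_face_def seg_swap e01)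
qed

section \<open>Potentials\<close>

locale flat_line_field = line_field +
  fixes b :: "((nat \<Rightarrow> real) \<Rightarrow> 'a) \<Rightarrow> int"
  assumes curv_eq: "singular_simplex 2 X \<sigma> \<Longrightarrow>
    curv \<sigma> = b (singular_face 2 0 \<sigma>) - b (singular_face 2 1 \<sigma>) + b (singular_face 2 2 \<sigma>)"
begin

text \<open>Removing whole turns does not affect the relation between the end values of a section,
  and by \<open>curv_eq\<close> it makes the alternating sum over the faces of every triangle
  vanish.\<close>

definition flat_phase :: "((nat \<Rightarrow> real) \<Rightarrow> 'a) \<Rightarrow> ((nat \<Rightarrow> real) \<Rightarrow> complex) \<Rightarrow> real" where
  "flat_phase \<gamma> z = phase \<gamma> z - 2 * pi * real_of_int (b \<gamma>)"

lemma flat_phase_cong: "(\<And>y. y \<in> I1 \<Longrightarrow> z y = z' y) \<Longrightarrow> flat_phase \<gamma> z = flat_phase \<gamma> z'"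
  using phase_cong[of z z' \<gamma>] by (simp add: flat_phase_def)

lemma cis_2pi_int: "cis (r - 2 * pi * real_of_int k) = cis r"
  by (simp add: complex_eq_iff cos_diff sin_diff cos_int_2pin sin_int_2pin)

lemma flat_phase_cis:
  "singular_simplex 1 X \<gamma> \<Longrightarrow> sec I1 \<gamma> z \<Longrightarrow> z (vtx 1) = z (vtx 0) * cis (flat_phase \<gamma> z)"
  using phase_cis[of \<gamma> z] by (simp add: flat_phase_def cis_2pi_int)

lemma flat_phase_triangle:
  assumes "singular_simplex 2 X \<sigma>" "sec I2 \<sigma> z"
  shows "flat_phase (singular_face 2 0 \<sigma>) (\<lambda>y. z (simplical_face 0 y)) =
    flat_phase (singular_face 2 1 \<sigma>) (\<lambda>y. z (simplical_face 1 y)) -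
    flat_phase (singular_face 2 2 \<sigma>) (\<lambda>y. z (simplical_face 2 y))"
proof -
  have "dphase \<sigma> z = 2 * pi * (real_of_int (b (singular_face 2 0 \<sigma>)) -
      real_of_int (b (singular_face 2 1 \<sigma>)) + real_of_int (b (singular_face 2 2 \<sigma>)))"
    using curv[OF assms] curv_eq[OF assms(1)] by simp
  then show ?thesis by (simp add: flat_phase_def dphase_def algebra_simps)
qed

text \<open>A real lift of the phase of a section whose increment along every path in
  \<open>D\<close> is the flat phase. It is in general discontinuous, being measured against the
  arbitrary \<open>s\<close>; differences of potentials are continuous, which makes them
  useful.\<close>

definition potential :: "(nat \<Rightarrow> real) set \<Rightarrow> ((nat \<Rightarrow> real) \<Rightarrow> 'a) \<Rightarrow> ((nat \<Rightarrow> real) \<Rightarrow> real) \<Rightarrow> bool" where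
  "potential D f \<beta> \<longleftrightarrow> sec D f (\<lambda>y. cis (\<beta> y)) \<and>
    (\<forall>q. continuous_on I1 q \<and> q ` I1 \<subseteq> D \<longrightarrow>
      \<beta> (q (vtx 1)) - \<beta> (q (vtx 0)) = flat_phase (sing 1 (\<lambda>y. f (q y))) (\<lambda>y. cis (\<beta> (q y))))"

lemma potential_sec: "potential D f \<beta> \<Longrightarrow> sec D f (\<lambda>y. cis (\<beta> y))"
  by (simp add: potential_def)

lemma potential_path:
  "potential D f \<beta> \<Longrightarrow> continuous_on I1 q \<Longrightarrow> q ` I1 \<subseteq> D \<Longrightarrow>
    \<beta> (q (vtx 1)) - \<beta> (q (vtx 0)) = flat_phase (sing 1 (\<lambda>y. f (q y))) (\<lambda>y. cis (\<beta> (q y)))"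
  by (simp add: potential_def)

lemma potential_cong:
  assumes "potential D f \<beta>" "\<And>y. y \<in> D \<Longrightarrow> f y = f' y" "\<And>y. y \<in> D \<Longrightarrow> \<beta> y = \<beta>' y"
  shows "potential D f' \<beta>'"
  unfolding potential_def
proof (intro conjI allI impI)
  show "sec D f' (\<lambda>y. cis (\<beta>' y))"
    by (rule sec_cong[OF potential_sec[OF assms(1)]]) (simp_all add: assms)
  fix q assume q: "continuous_on I1 q \<and> q ` I1 \<subseteq> D"
  then have qD: "q y \<in> D" if "y \<in> I1" for y using that by blast
  have "\<beta> (q (vtx 1)) - \<beta> (q (vtx 0)) = flat_phase (sing 1 (\<lambda>y. f (q y))) (\<lambda>y. cis (\<beta> (q y)))"
    using potential_path[OF assms(1)] q by blast
  moreover have "sing 1 (\<lambda>y. f (q y)) = sing 1 (\<lambda>y. f' (q y))"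
    by (rule sing_cong) (simp add: assms qD)
  moreover have "flat_phase \<gamma> (\<lambda>y. cis (\<beta> (q y))) = flat_phase \<gamma> (\<lambda>y. cis (\<beta>' (q y)))" for \<gamma>
    by (rule flat_phase_cong) (simp add: assms qD)
  ultimately show "\<beta>' (q (vtx 1)) - \<beta>' (q (vtx 0)) = flat_phase (sing 1 (\<lambda>y. f' (q y))) (\<lambda>y. cis (\<beta>' (q y)))"
    using assms(3) qD by simp
qed

lemma potential_compose:
  assumes p: "potential D f \<beta>" and g: "continuous_on D' g" "g ` D' \<subseteq> D"
  shows "potential D' (\<lambda>y. f (g y)) (\<lambda>y. \<beta> (g y))"
  unfolding potential_def
proof (intro conjI allI impI)
  show "sec D' (\<lambda>y. f (g y)) (\<lambda>y. cis (\<beta> (g y)))"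
    by (rule sec_compose[OF potential_sec[OF p] g])
  fix q assume q: "continuous_on I1 q \<and> q ` I1 \<subseteq> D'"
  have "continuous_on I1 (\<lambda>y. g (q y))"
    by (rule continuous_on_compose2[OF g(1)]) (use q in auto)
  moreover have "(\<lambda>y. g (q y)) ` I1 \<subseteq> D" using q g(2) by blast
  ultimately show "\<beta> (g (q (vtx 1))) - \<beta> (g (q (vtx 0))) =
      flat_phase (sing 1 (\<lambda>y. f (g (q y)))) (\<lambda>y. cis (\<beta> (g (q y))))"
    by (rule potential_path[OF p])
qed

lemma potential_add:
  assumes f: "continuous_map (top_of_set D) X f" and p: "potential D f \<beta>" and \<eta>: "continuous_on D \<eta>"
  shows "potential D f (\<lambda>y. \<beta> y + \<eta> y)"
  unfolding potential_def
proof (intro conjI allI impI)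
  show "sec D f (\<lambda>y. cis (\<beta> y + \<eta> y))"
    using sec_mult_cis[OF potential_sec[OF p] \<eta>] by (simp add: cis_mult)
  fix q assume q: "continuous_on I1 q \<and> q ` I1 \<subseteq> D"
  have \<gamma>: "singular_simplex 1 X (sing 1 (\<lambda>y. f (q y)))"
    using q by (intro singular_simplex_sing continuous_map_compose_top_of_set[OF f]) auto
  have s: "sec I1 (sing 1 (\<lambda>y. f (q y))) (\<lambda>y. cis (\<beta> (q y)))"
    by (rule sec_cong[OF sec_compose[OF potential_sec[OF p], of I1 q]]) (use q in auto)
  have "continuous_on I1 (\<lambda>y. \<eta> (q y))"
    by (rule continuous_on_compose2[OF \<eta>]) (use q in auto)
  from phase_mult_cis[OF \<gamma> s this] potential_path[OF p, of q] q
  show "\<beta> (q (vtx 1)) + \<eta> (q (vtx 1)) - (\<beta> (q (vtx 0)) + \<eta> (q (vtx 0))) =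
      flat_phase (sing 1 (\<lambda>y. f (q y))) (\<lambda>y. cis (\<beta> (q y) + \<eta> (q y)))"
    by (simp add: flat_phase_def cis_mult)
qed

text \<open>\<open>\<beta> y\<close> is the flat phase of a section along the segment from a fixed
  \<open>a\<close> to \<open>y\<close>, normalized by \<open>Arg\<close> at \<open>a\<close>. The
  condition on a path \<open>q\<close> is the triangle identity for the cone over \<open>q\<close>
  with apex \<open>a\<close>, two sides of which are such segments.\<close>

lemma potential_exists:
  assumes D: "compact_convex D" and f: "continuous_map (top_of_set D) X f"
  obtains \<beta> where "potential D f \<beta>"
proof (cases "D = {}")
  case True
  then have "potential D f \<beta>" for \<beta>
    using nonempty_standard_simplex[of 1] by (simp add: potential_def sec_def)
  then show thesis using that by blast
next
  case False
  then obtain a where a: "a \<in> D" by auto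
  obtain z where z: "sec D f z" using sec_exists[OF D f] .
  define \<beta> where "\<beta> y = Arg (z a) + flat_phase (sing 1 (\<lambda>v. f (seg a y (v 1)))) (\<lambda>v. z (seg a y (v 1)))" for y
  have sq: "singular_simplex 1 X (sing 1 (\<lambda>v. f (q v)))" "sec I1 (sing 1 (\<lambda>v. f (q v))) (\<lambda>v. z (q v))"
    if "continuous_on I1 q" "q ` I1 \<subseteq> D" for q
  proof -
    show "singular_simplex 1 X (sing 1 (\<lambda>v. f (q v)))"
      using that by (intro singular_simplex_sing continuous_map_compose_top_of_set[OF f]) auto
    show "sec I1 (sing 1 (\<lambda>v. f (q v))) (\<lambda>v. z (q v))"
      by (rule sec_cong[OF sec_compose[OF z that]]) auto
  qed
  have cis_\<beta>: "cis (\<beta> y) = z y" if y: "y \<in> D" for y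
  proof -
    have "continuous_on I1 (\<lambda>v. seg a y (v 1))" by (intro continuous_intros)
    moreover have "(\<lambda>v. seg a y (v 1)) ` I1 \<subseteq> D"
      using I1_edge(2,3) by (intro image_subsetI seg_in[OF D a y]) auto
    ultimately have "z (seg a y (vtx 1 1)) = z (seg a y (vtx 0 1)) *
        cis (flat_phase (sing 1 (\<lambda>v. f (seg a y (v 1)))) (\<lambda>v. z (seg a y (v 1))))"
      using flat_phase_cis[OF sq] by blast
    moreover have "cis (Arg (z a)) = z a"
      using sec_norm[OF z a] sec_nonzero[OF z a] by (simp add: cis_Arg sgn_eq)
    ultimately show ?thesis by (simp add: \<beta>_def vtx_def flip: cis_mult)
  qed
  have "potential D f \<beta>"
    unfolding potential_def
  proof (intro conjI allI impI)
    show "sec D f (\<lambda>y. cis (\<beta> y))" by (rule sec_cong[OF z]) (simp_all add: cis_\<beta>)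
    fix q assume "continuous_on I1 q \<and> q ` I1 \<subseteq> D"
    then have q: "continuous_on I1 q" "q ` I1 \<subseteq> D" by auto
    let ?K = "path_cone a q"
    note K = path_cone[OF D a q]
    let ?\<sigma> = "sing 2 (\<lambda>x. f (?K x))"
    have \<sigma>: "singular_simplex 2 X ?\<sigma>"
      using K by (intro singular_simplex_sing continuous_map_compose_top_of_set[OF f])
    have sz: "sec I2 ?\<sigma> (\<lambda>x. z (?K x))"
      by (rule sec_cong[OF sec_compose[OF z K]]) auto
    have face: "singular_face 2 k ?\<sigma> = sing 1 (\<lambda>y. f (?K (simplical_face k y)))" if "k \<le> 2" for k
      using singular_face_sing[of k 1 "\<lambda>x. f (?K x)"] that by simp
    have f0: "sing 1 (\<lambda>y. f (?K (simplical_face 0 y))) = sing 1 (\<lambda>y. f (q y))"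
      by (rule sing_cong) (simp add: path_cone_faces)
    have f1: "sing 1 (\<lambda>y. f (?K (simplical_face 1 y))) = sing 1 (\<lambda>y. f (seg a (q (vtx 1)) (y 1)))"
      by (rule sing_cong) (simp add: path_cone_faces)
    have f2: "sing 1 (\<lambda>y. f (?K (simplical_face 2 y))) = sing 1 (\<lambda>y. f (seg a (q (vtx 0)) (y 1)))"
      by (rule sing_cong) (simp add: path_cone_faces)
    have "flat_phase (sing 1 (\<lambda>y. f (q y))) (\<lambda>y. z (?K (simplical_face 0 y))) =
      flat_phase (sing 1 (\<lambda>y. f (seg a (q (vtx 1)) (y 1)))) (\<lambda>y. z (?K (simplical_face 1 y))) -
      flat_phase (sing 1 (\<lambda>y. f (seg a (q (vtx 0)) (y 1)))) (\<lambda>y. z (?K (simplical_face 2 y)))"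
      using flat_phase_triangle[OF \<sigma> sz] face[of 0] face[of 1] face[of 2] f0 f1 f2 by simp
    moreover have "flat_phase \<gamma> (\<lambda>y. z (?K (simplical_face 0 y))) = flat_phase \<gamma> (\<lambda>y. cis (\<beta> (q y)))" for \<gamma>
      by (rule flat_phase_cong) (use q(2) in \<open>auto simp: path_cone_faces cis_\<beta>\<close>)
    moreover have "flat_phase \<gamma> (\<lambda>y. z (?K (simplical_face 1 y))) = flat_phase \<gamma> (\<lambda>y. z (seg a (q (vtx 1)) (y 1)))" for \<gamma>
      by (rule flat_phase_cong) (simp add: path_cone_faces)
    moreover have "flat_phase \<gamma> (\<lambda>y. z (?K (simplical_face 2 y))) = flat_phase \<gamma> (\<lambda>y. z (seg a (q (vtx 0)) (y 1)))" for \<gamma>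
      by (rule flat_phase_cong) (simp add: path_cone_faces)
    ultimately show "\<beta> (q (vtx 1)) - \<beta> (q (vtx 0)) =
        flat_phase (sing 1 (\<lambda>y. f (q y))) (\<lambda>y. cis (\<beta> (q y)))"
      by (simp add: \<beta>_def)
  qed
  then show thesis using that by blast
qed

text \<open>The sections of the two potentials differ by a continuous real phase
  \<open>\<zeta>\<close>, so \<open>\<beta> + \<zeta>\<close> and \<open>\<beta>'\<close> belong to
  the same section. Comparing their increments along segments from \<open>a\<close> shows that they
  differ by a constant, not by a varying multiple of 2 pi.\<close>

lemma potential_diff_continuous:
  assumes D: "compact_convex D" and f: "continuous_map (top_of_set D) X f"
    and p: "potential D f \<beta>" and p': "potential D f \<beta>'"
  shows "continuous_on D (\<lambda>y. \<beta>' y - \<beta> y)"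
proof (cases "D = {}")
  case False
  then obtain a where a: "a \<in> D" by auto
  obtain \<zeta> where \<zeta>: "continuous_on D \<zeta>" "\<And>y. y \<in> D \<Longrightarrow> cis (\<beta>' y) = cis (\<beta> y) * cis (\<zeta> y)"
    using sec_ratio_lift[OF D f potential_sec[OF p] potential_sec[OF p']] by blast
  have p'': "potential D f (\<lambda>y. \<beta> y + \<zeta> y)" by (rule potential_add[OF f p \<zeta>(1)])
  have "\<beta>' y - \<beta>' a = (\<beta> y + \<zeta> y) - (\<beta> a + \<zeta> a)" if y: "y \<in> D" for y
  proof -
    define q where "q v = seg a y (v 1)" for v :: "nat \<Rightarrow> real"
    have q: "continuous_on I1 q" unfolding q_def by (intro continuous_intros)
    have qD: "q ` I1 \<subseteq> D"
      unfolding q_def using I1_edge(2,3) by (intro image_subsetI seg_in[OF D a y]) auto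
    have "flat_phase \<gamma> (\<lambda>v. cis (\<beta>' (q v))) = flat_phase \<gamma> (\<lambda>v. cis (\<beta> (q v) + \<zeta> (q v)))" for \<gamma>
      by (rule flat_phase_cong) (use qD \<zeta>(2) in \<open>auto simp: cis_mult\<close>)
    then show ?thesis
      using potential_path[OF p' q qD] potential_path[OF p'' q qD] by (simp add: q_def vtx_def)
  qed
  then have eq: "\<beta>' y - \<beta> y = \<zeta> y + (\<beta>' a - \<beta> a - \<zeta> a)" if "y \<in> D" for y
    using that by (simp add: algebra_simps)
  have "continuous_on D (\<lambda>y. \<zeta> y + (\<beta>' a - \<beta> a - \<zeta> a))" by (intro continuous_intros \<zeta>)
  then show ?thesis by (rule continuous_on_eq) (simp add: eq)
qed auto

end

section \<open>Extending potentials over cells\<close>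

lemma continuous_on_locally_open:
  fixes S :: "'b::t2_space set" and g :: "'b \<Rightarrow> 'c::topological_space"
  assumes "\<And>y. y \<in> S \<Longrightarrow> \<exists>V. open V \<and> y \<in> V \<and> continuous_on (S \<inter> V) g"
  shows "continuous_on S g"
  unfolding continuous_on_eq_continuous_within
proof
  fix y assume y: "y \<in> S"
  obtain V where V: "open V" "y \<in> V" "continuous_on (S \<inter> V) g" using assms[OF y] by blast
  have "continuous (at y within (S \<inter> V)) g"
    using V y by (simp add: continuous_on_eq_continuous_within)
  moreover have "at y within (S \<inter> V) = at y within S"
    by (rule at_within_nhd[OF V(2,1)]) auto
  ultimately show "continuous (at y within S) g" by (simp add: continuous_within)
qed

lemma open_nbhd_by_sequences:
  fixes t :: "'b::metric_space"
  assumes "\<And>\<sigma>. (\<And>k::nat. \<sigma> k \<in> D \<and> \<not> Q (\<sigma> k)) \<Longrightarrow> \<sigma> \<longlonglongrightarrow> t \<Longrightarrow> False"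
  obtains U where "open U" "t \<in> U" "\<And>y. y \<in> D \<Longrightarrow> y \<in> U \<Longrightarrow> Q y"
proof -
  have "\<exists>k::nat. \<forall>y\<in>D. dist y t < 1 / real (Suc k) \<longrightarrow> Q y"
  proof (rule ccontr)
    assume "\<not> ?thesis"
    then have "\<forall>k::nat. \<exists>y. y \<in> D \<and> dist y t < 1 / real (Suc k) \<and> \<not> Q y" by blast
    then obtain \<sigma> where \<sigma>: "\<And>k::nat. \<sigma> k \<in> D \<and> dist (\<sigma> k) t < 1 / real (Suc k) \<and> \<not> Q (\<sigma> k)" by metis
    have "\<sigma> \<longlonglongrightarrow> t"
    proof (rule metric_LIMSEQ_I)
      fix e :: real assume "0 < e"
      then obtain N :: nat where N: "1 / real (Suc N) < e" using nat_approx_posE by blast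
      have "dist (\<sigma> k) t < e" if "k \<ge> N" for k
      proof -
        have "1 / real (Suc k) \<le> 1 / real (Suc N)" using that by (simp add: field_simps)
        then show ?thesis using \<sigma>[of k] N by linarith
      qed
      then show "\<exists>N. \<forall>k\<ge>N. dist (\<sigma> k) t < e" by blast
    qed
    then show False using assms \<sigma> by blast
  qed
  then obtain k :: nat where k: "\<And>y. y \<in> D \<Longrightarrow> dist y t < 1 / real (Suc k) \<Longrightarrow> Q y" by blast
  show thesis
    by (rule that[of "ball t (1 / real (Suc k))"]) (auto simp: k dist_commute)
qed

section \<open>Radial coordinates in a disk\<close>

definition rad :: "nat \<Rightarrow> (nat \<Rightarrow> real) \<Rightarrow> real" where
  "rad k z = sqrt (\<Sum>i<k. (z i)\<^sup>2)"

text \<open>For \<open>s = 1\<close> this is the radial projection \<open>z / |z|\<close>; at the origin all values are \<open>0\<close>.\<close>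

definition push :: "nat \<Rightarrow> real \<Rightarrow> (nat \<Rightarrow> real) \<Rightarrow> nat \<Rightarrow> real" where
  "push k s z = (\<lambda>i. (1 - s + s / rad k z) * z i)"

lemma rad_nonneg: "0 \<le> rad k z"
  by (simp add: rad_def sum_nonneg)

lemma rad_cdisk: "z \<in> cdisk k \<Longrightarrow> rad k z \<le> 1"
  by (simp add: rad_def cdisk_def)

lemma disk_interior_rad: "disk_interior k = {z \<in> cdisk k. rad k z < 1}"
  by (auto simp: disk_interior_eq rad_def)

lemma disk_boundary_rad: "disk_boundary k = {z \<in> cdisk k. rad k z = 1}"
  by (auto simp: disk_boundary_eq rad_def)

lemma continuous_on_rad [continuous_intros]: "continuous_on S (rad k)"
  unfolding rad_def by (intro continuous_intros)

lemma continuous_on_push: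
  assumes "continuous_on S u" "continuous_on S v" "\<And>x. x \<in> S \<Longrightarrow> rad k (v x) \<noteq> 0"
  shows "continuous_on S (\<lambda>x. push k (u x) (v x))"
proof (rule continuous_on_coordinatewise_then_product)
  fix i
  have "continuous_on S (\<lambda>x. rad k (v x))"
    by (rule continuous_on_compose2[OF continuous_on_rad assms(2)]) auto
  then show "continuous_on S (\<lambda>x. push k (u x) (v x) i)"
    unfolding push_def using assms
    by (intro continuous_intros continuous_on_product_then_coordinatewise[OF assms(2)]) auto
qed

lemma push_0 [simp]: "push k 0 z = z"
  by (simp add: push_def)

lemma push_rad_1: "rad k z = 1 \<Longrightarrow> push k s z = z"
  by (simp add: push_def)

lemma rad_push:
  assumes "rad k z \<noteq> 0" "0 \<le> s" "s \<le> 1"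
  shows "rad k (push k s z) = (1 - s) * rad k z + s"
proof -
  have r: "rad k z > 0" using assms rad_nonneg[of k z] by linarith
  define c where "c = 1 - s + s / rad k z"
  have c: "0 \<le> c" using assms r by (simp add: c_def)
  have "rad k (push k s z) = c * rad k z"
    using c by (simp add: rad_def push_def power_mult_distrib real_sqrt_mult
        flip: c_def[unfolded rad_def] sum_distrib_left)
  also have "\<dots> = (1 - s) * rad k z + s" using r by (simp add: c_def algebra_simps)
  finally show ?thesis .
qed

lemma push_in_cdisk:
  assumes "z \<in> cdisk k" "rad k z \<noteq> 0" "0 \<le> s" "s \<le> 1"
  shows "push k s z \<in> cdisk k"
proof -
  have "(1 - s) * rad k z + s \<le> 1"
    using mult_left_mono[OF rad_cdisk[OF assms(1)], of "1 - s"] assms by simp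
  then have "rad k (push k s z) \<le> 1" using rad_push assms by simp
  then show ?thesis using assms(1) by (simp add: cdisk_def rad_def push_def)
qed

lemma push_1_boundary:
  assumes "z \<in> cdisk k" "rad k z \<noteq> 0" shows "push k 1 z \<in> disk_boundary k"
  using push_in_cdisk[OF assms, of 1] rad_push[OF assms(2), of 1] by (simp add: disk_boundary_rad)

text \<open>Homogeneous extension from the sphere to the disk. Away from the origin it is a
  composition of continuous maps; at the origin the factor \<open>rad k z\<close> tends to 0 and
  \<open>\<kappa>\<close> is bounded on the compact sphere. This is where real values matter: a map
  from the sphere into the circle could not be extended this way.\<close>

lemma radial_extension:
  assumes \<kappa>: "continuous_on (disk_boundary k) \<kappa>"
  shows "continuous_on (cdisk k) (\<lambda>z. rad k z * \<kappa> (push k 1 z) :: real)"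
proof -
  have "compact (disk_boundary k)"
  proof -
    have "disk_boundary k = cdisk k \<inter> {z. (\<Sum>i<k. (z i)\<^sup>2) = 1}" by (auto simp: disk_boundary_eq)
    moreover have "closed {z::nat\<Rightarrow>real. (\<Sum>i<k. (z i)\<^sup>2) = 1}"
      by (intro closed_Collect_eq continuous_intros)
    ultimately show ?thesis
      using compact_Int_closed compact_convex_compact[OF compact_convex_cdisk] by metis
  qed
  then have "bounded (\<kappa> ` disk_boundary k)"
    by (intro compact_imp_bounded compact_continuous_image \<kappa>)
  then obtain M where M: "\<And>z. z \<in> disk_boundary k \<Longrightarrow> \<bar>\<kappa> z\<bar> \<le> M"
    by (auto simp: bounded_iff)
  show ?thesis
    unfolding continuous_on_def
  proof
    fix z assume z: "z \<in> cdisk k"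
    show "((\<lambda>z. rad k z * \<kappa> (push k 1 z)) \<longlongrightarrow> rad k z * \<kappa> (push k 1 z)) (at z within cdisk k)"
    proof (cases "rad k z = 0")
      case True
      have "((\<lambda>z. rad k z * M) \<longlongrightarrow> rad k z * M) (at z within cdisk k)"
        using continuous_on_rad[of "cdisk k" k] z by (auto simp: continuous_on_def intro!: tendsto_intros)
      then have lim: "((\<lambda>z. rad k z * M) \<longlongrightarrow> 0) (at z within cdisk k)" by (simp add: True)
      have "norm (rad k w * \<kappa> (push k 1 w)) \<le> rad k w * M" if w: "w \<in> cdisk k" for w
      proof (cases "rad k w = 0")
        case False
        then show ?thesis
          using M[OF push_1_boundary[OF w]] rad_nonneg[of k w] by (simp add: abs_mult mult_left_mono)
      qed simp
      then have "((\<lambda>z. rad k z * \<kappa> (push k 1 z)) \<longlongrightarrow> 0) (at z within cdisk k)"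
        by (intro Lim_null_comparison[OF _ lim]) (auto simp: eventually_at_filter)
      then show ?thesis by (simp add: True)
    next
      case False
      let ?T = "cdisk k \<inter> {z. rad k z \<noteq> 0}"
      have "continuous_on ?T (\<lambda>z. rad k z * \<kappa> (push k 1 z))"
      proof (intro continuous_intros continuous_on_compose2[OF \<kappa>] continuous_on_push)
        show "push k 1 ` ?T \<subseteq> disk_boundary k" using push_1_boundary by blast
      qed auto
      then have "((\<lambda>z. rad k z * \<kappa> (push k 1 z)) \<longlongrightarrow> rad k z * \<kappa> (push k 1 z)) (at z within ?T)"
        using z False unfolding continuous_on_def by blast
      moreover have "at z within ?T = at z within cdisk k"
      proof (rule at_within_nhd)
        show "open {z. rad k z \<noteq> 0}"
          by (intro open_Collect_neq continuous_intros)
      qed (use False in auto)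
      ultimately show ?thesis by simp
    qed
  qed
qed

locale cw_flat = cw_space X E + flat_line_field X n s b
  for X :: "'a topology" and E n s b
begin

text \<open>The induction hypothesis over skeleta. It is stated for all compact convex domains
  mapped into the skeleton, and not only for its cells, because it will be applied to attaching maps
  and to ends of deformations, which may run through several cells.\<close>

definition good :: "nat \<Rightarrow> ('a \<Rightarrow> real) \<Rightarrow> bool" where
  "good k \<alpha> \<longleftrightarrow> (\<forall>D f. compact_convex D \<and> continuous_map (top_of_set D) X f \<and> f ` D \<subseteq> skel k \<longrightarrow>
    potential D f (\<lambda>y. \<alpha> (f y)))"

lemma good_potential:
  "good k \<alpha> \<Longrightarrow> compact_convex D \<Longrightarrow> continuous_map (top_of_set D) X f \<Longrightarrow> f ` D \<subseteq> skel k \<Longrightarrow>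
    potential D f (\<lambda>y. \<alpha> (f y))"
  by (simp add: good_def)

lemma potential_empty: "potential {} f \<beta>"
  using nonempty_standard_simplex[of 1] by (simp add: potential_def sec_def)

lemma good_0: "good 0 \<alpha>"
  by (auto simp: good_def skel_def potential_empty)

text \<open>Correct an arbitrary potential \<open>\<beta>\<close> on the disk by the radial
  extension of its discrepancy \<open>\<kappa>\<close> on the sphere. The sphere is not convex, so
  continuity of \<open>\<kappa>\<close> is obtained locally: a small compact convex
  \<open>D'\<close> away from the centre is retracted onto the sphere by \<open>push k 1\<close>,
  and on \<open>D'\<close> both functions are potentials.\<close>

lemma cell_extension:
  assumes \<alpha>: "good k \<alpha>" and e: "e \<in> E k"
  obtains \<mu> where "potential (cdisk k) (chr k e) \<mu>"
    "\<And>z. z \<in> disk_boundary k \<Longrightarrow> \<mu> z = \<alpha> (chr k e z)"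
proof -
  obtain \<beta> where \<beta>: "potential (cdisk k) (chr k e) \<beta>"
    using potential_exists[OF compact_convex_cdisk chr_cont[OF e]] .
  define \<kappa> where "\<kappa> z = \<alpha> (chr k e z) - \<beta> z" for z
  have "continuous_on (disk_boundary k) \<kappa>"
  proof (rule continuous_on_locally_open)
    fix y assume y: "y \<in> disk_boundary k"
    have U: "open {z. rad k z \<noteq> 0}" by (intro open_Collect_neq continuous_intros)
    have "y \<in> {z. rad k z \<noteq> 0}" "y \<in> cdisk k" using y by (auto simp: disk_boundary_rad)
    from compact_convex_nbhd[OF compact_convex_cdisk U this]
    obtain D' V where D': "compact_convex D'" "D' \<subseteq> cdisk k \<inter> {z. rad k z \<noteq> 0}" "open V" "y \<in> V"
      "cdisk k \<inter> V \<subseteq> D'" .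
    have pc: "continuous_on D' (push k 1)"
      by (rule continuous_on_push) (use D'(2) in \<open>auto intro: continuous_intros\<close>)
    have pb: "push k 1 ` D' \<subseteq> disk_boundary k" using D'(2) push_1_boundary by blast
    then have pd: "push k 1 ` D' \<subseteq> cdisk k" by (auto simp: cdisk_cases)
    have cm: "continuous_map (top_of_set D') X (\<lambda>z. chr k e (push k 1 z))"
      by (rule continuous_map_compose_top_of_set[OF chr_cont[OF e] pc pd])
    have "potential D' (\<lambda>z. chr k e (push k 1 z)) (\<lambda>z. \<alpha> (chr k e (push k 1 z)))"
      by (rule good_potential[OF \<alpha> D'(1) cm]) (use pb chr_boundary_skel[OF e] in blast)
    with potential_compose[OF \<beta> pc pd]
    have c: "continuous_on D' (\<lambda>z. \<kappa> (push k 1 z))"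
      unfolding \<kappa>_def by (rule potential_diff_continuous[OF D'(1) cm])
    have "continuous_on (disk_boundary k \<inter> V) (\<lambda>z. \<kappa> (push k 1 z))"
      by (rule continuous_on_subset[OF c]) (use D'(5) in \<open>auto simp: cdisk_cases\<close>)
    then have "continuous_on (disk_boundary k \<inter> V) \<kappa>"
      by (rule continuous_on_eq) (auto simp: disk_boundary_rad push_rad_1)
    then show "\<exists>V. open V \<and> y \<in> V \<and> continuous_on (disk_boundary k \<inter> V) \<kappa>"
      using D'(3,4) by blast
  qed
  from potential_add[OF chr_cont[OF e] \<beta> radial_extension[OF this]]
  have "potential (cdisk k) (chr k e) (\<lambda>z. \<beta> z + rad k z * \<kappa> (push k 1 z))" .
  moreover have "\<beta> z + rad k z * \<kappa> (push k 1 z) = \<alpha> (chr k e z)" if "z \<in> disk_boundary k" for z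
    using that by (simp add: disk_boundary_rad push_rad_1 \<kappa>_def)
  ultimately show thesis using that by blast
qed

lemma skel_cell_dim:
  assumes "e \<in> E m" "x \<in> e" "x \<in> skel k" shows "m < k"
  using cell_not_skel[OF assms(1,2)] skel_mono[of k m] assms(3) by (meson in_mono not_le)

lemma map_sequence_in_cell:
  assumes "continuous_map (top_of_set D) X f" "\<And>k::nat. \<sigma> k \<in> D" "y \<in> D" "\<sigma> \<longlonglongrightarrow> y"
  shows "\<exists>m e r z zk. e \<in> E m \<and> strict_mono (r :: nat \<Rightarrow> nat) \<and> (\<forall>k. zk k \<in> disk_interior m) \<and>
    (\<forall>k. f (\<sigma> (r k)) = chr m e (zk k)) \<and> z \<in> cdisk m \<and> zk \<longlonglongrightarrow> z \<and> f y = chr m e z"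
proof -
  have lim: "limitin X (\<lambda>k. f (\<sigma> k)) (f y) sequentially"
    by (rule limitin_continuous_map_top_of_set[OF assms])
  have "f (\<sigma> k) \<in> topspace X" for k using assms(1,2) by (auto simp: continuous_map_def)
  then show ?thesis
    by (rule sequence_in_cell[OF lim]) (intro exI conjI allI; assumption)
qed

text \<open>A convergent sequence in \<open>D\<close> has a subsequence whose image lies in one
  cell, where the section is continuous up to the boundary. This controls \<open>\<alpha>\<close>
  only modulo 2 pi; the remaining integer ambiguity is settled in
  \<open>good_near_skel\<close>.\<close>

lemma good_sec:
  assumes pot: "\<And>m e. m < k \<Longrightarrow> e \<in> E m \<Longrightarrow> potential (cdisk m) (chr m e) (\<lambda>z. \<alpha> (chr m e z))"
    and f: "continuous_map (top_of_set D) X f" "f ` D \<subseteq> skel k"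
  shows "sec D f (\<lambda>y. cis (\<alpha> (f y)))"
proof -
  have "continuous_on D (\<lambda>y. cis (\<alpha> (f y)) * s (f y) i)" if i: "i < n" for i
  proof -
    have "continuous_map (top_of_set D) euclidean (\<lambda>y. cis (\<alpha> (f y)) * s (f y) i)"
    proof (rule continuous_map_top_of_set_sequentially)
      fix \<sigma> :: "nat \<Rightarrow> nat \<Rightarrow> real" and y
      assume \<sigma>: "\<And>k. \<sigma> k \<in> D" "y \<in> D" "\<sigma> \<longlonglongrightarrow> y"
      obtain m e r z zk where c: "e \<in> E m" "strict_mono (r :: nat \<Rightarrow> nat)"
        "\<forall>k. zk k \<in> disk_interior m" "\<forall>k. f (\<sigma> (r k)) = chr m e (zk k)" "z \<in> cdisk m" "zk \<longlonglongrightarrow> z"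
        "f y = chr m e z"
        using map_sequence_in_cell[OF f(1) \<sigma>] by blast
      have "chr m e (zk 0) \<in> e" using chr_interior[OF c(1)] c(3) by blast
      moreover have "chr m e (zk 0) \<in> skel k" using f(2) \<sigma>(1)[of "r 0"] c(4)[THEN spec, of 0, symmetric] by (simp add: image_subset_iff)
      ultimately have "m < k" by (rule skel_cell_dim[OF c(1)])
      then have "continuous_on (cdisk m) (\<lambda>z. cis (\<alpha> (chr m e z)) * s (chr m e z) i)"
        using sec_cont[OF potential_sec[OF pot] i] c(1) by blast
      then have "(\<lambda>k. cis (\<alpha> (chr m e (zk k))) * s (chr m e (zk k)) i) \<longlonglongrightarrow> cis (\<alpha> (chr m e z)) * s (chr m e z) i"
        by (rule continuous_on_tendsto_compose[OF _ c(6,5)]) (use c(3) in \<open>auto simp: cdisk_cases\<close>)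
      then show "\<exists>r::nat\<Rightarrow>nat. limitin euclidean (\<lambda>k. cis (\<alpha> (f (\<sigma> (r k)))) * s (f (\<sigma> (r k))) i)
          (cis (\<alpha> (f y)) * s (f y) i) sequentially"
        by (intro exI[of _ r]) (simp add: c(4,7))
    qed simp
    then show ?thesis by simp
  qed
  then show ?thesis by (simp add: sec_def)
qed

section \<open>Radial deformation towards a skeleton\<close>

definition cell_of :: "nat \<Rightarrow> 'a \<Rightarrow> 'a set" where
  "cell_of k x = (SOME e. e \<in> E k \<and> x \<in> e)"

lemma cell_of_eq: "e \<in> E k \<Longrightarrow> x \<in> e \<Longrightarrow> cell_of k x = e"
  unfolding cell_of_def by (rule some_equality) (use cells_disjoint in blast)+

text \<open>Points of open \<open>k\<close>-cells move outward along radii and reach the boundary at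
  time 1, while \<open>skel k\<close> stays fixed. Centres do not move, so the deformation is used
  only away from them.\<close>

definition radial :: "nat \<Rightarrow> real \<Rightarrow> 'a \<Rightarrow> 'a" where
  "radial k t x = (if x \<in> skel k then x
    else chr k (cell_of k x) (push k t (chr_inv k (cell_of k x) x)))"

lemma radial_skel: "x \<in> skel k \<Longrightarrow> radial k t x = x"
  by (simp add: radial_def)

lemma radial_chr:
  assumes e: "e \<in> E k" and z: "z \<in> cdisk k"
  shows "radial k t (chr k e z) = chr k e (push k t z)"
proof (cases "z \<in> disk_interior k")
  case True
  have "chr k e z \<in> e" using chr_interior[OF e True] .
  then show ?thesis
    using cell_not_skel[OF e] by (simp add: radial_def cell_of_eq[OF e] chr_inv_chr[OF e True])
next
  case False
  then have "z \<in> disk_boundary k" using z by (auto simp: cdisk_cases)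
  then show ?thesis
    using chr_boundary_skel[OF e] by (simp add: radial_skel disk_boundary_rad push_rad_1)
qed

lemma radial_0: "x \<in> skel (Suc k) \<Longrightarrow> radial k 0 x = x"
proof (cases "x \<in> skel k")
  case False
  assume "x \<in> skel (Suc k)"
  then obtain e where e: "e \<in> E k" "x \<in> e" using False by (auto simp: skel_Suc)
  then obtain z where "z \<in> disk_interior k" "x = chr k e z" using chr_image[OF e(1)] by blast
  then show ?thesis using radial_chr[OF e(1), of z 0] by (simp add: cdisk_cases)
qed (simp add: radial_skel)

text \<open>The set on which the radial deformation is used. The bound 1/2 keeps points a definite
  distance from the centres, so that limits of such points avoid the centres too.\<close>

definition near_skel :: "nat \<Rightarrow> 'a \<Rightarrow> bool" where
  "near_skel k x \<longleftrightarrow> x \<in> skel k \<or> (\<exists>e\<in>E k. \<exists>z\<in>cdisk k. x = chr k e z \<and> rad k z > 1 / 2)"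

lemma near_skel_cases:
  assumes "near_skel k x"
  obtains "x \<in> skel k" | e z where "e \<in> E k" "z \<in> cdisk k" "x = chr k e z" "rad k z > 1 / 2"
  using assms by (auto simp: near_skel_def)

lemma near_skel_chr:
  assumes e: "e \<in> E k" and z: "z \<in> disk_interior k" and "near_skel k (chr k e z)"
  shows "rad k z > 1 / 2"
  using assms(3)
proof (cases rule: near_skel_cases)
  case 1
  then show ?thesis using cell_not_skel[OF e chr_interior[OF e z]] by simp
next
  case (2 e' z')
  have ne: "chr k e z \<notin> skel k" using cell_not_skel[OF e chr_interior[OF e z]] .
  then have z': "z' \<in> disk_interior k"
    using 2 chr_boundary_skel[OF 2(1)] by (auto simp: cdisk_cases)
  then have "chr k e z \<in> e'" using chr_interior[OF 2(1)] 2(3) by simp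
  from cells_disjoint[OF e 2(1) chr_interior[OF e z] this] have "e' = e" by simp
  then have "chr k e z = chr k e z'" using 2(3) by simp
  from inj_onD[OF chr_inj[OF e] this z z'] show ?thesis using 2(4) by simp
qed

lemma radial_in_skel_Suc:
  assumes "near_skel k x" "0 \<le> t" "t \<le> 1"
  shows "radial k t x \<in> skel (Suc k)" "radial k 1 x \<in> skel k"
proof -
  have "radial k t x \<in> skel (Suc k) \<and> radial k 1 x \<in> skel k"
    using assms(1)
  proof (cases rule: near_skel_cases)
    case 1
    then show ?thesis by (simp add: radial_skel skel_Suc)
  next
    case (2 e z)
    have "rad k z \<noteq> 0" using 2(4) by simp
    then show ?thesis
      using chr_skel[OF 2(1) push_in_cdisk[OF 2(2)]] chr_boundary_skel[OF 2(1) push_1_boundary[OF 2(2)]] assms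
      by (simp add: 2(3) radial_chr[OF 2(1,2)])
  qed
  then show "radial k t x \<in> skel (Suc k)" "radial k 1 x \<in> skel k" by auto
qed

lemma case_nat_comp_Suc [simp]: "case_nat a y \<circ> Suc = y"
  by (simp add: fun_eq_iff)

text \<open>After passing to a subsequence in one cell, either the cell lies in
  \<open>skel k\<close> and nothing moves, or it is a \<open>k\<close>-cell. Then the radii stay
  above 1/2, the limit has radius at least 1/2, and \<open>push\<close> is continuous off the
  centre. The formula \<open>radial_chr\<close> holds on the closed disk, so a limit on the sphere
  causes no trouble.\<close>

lemma radial_cont:
  assumes f: "continuous_map (top_of_set D) X f" and fs: "f ` D \<subseteq> skel (Suc k)"
    and near: "\<And>y. y \<in> D \<Longrightarrow> near_skel k (f y)"
  shows "continuous_map (top_of_set (cylinder D)) X (\<lambda>v. radial k (v 0) (f (v \<circ> Suc)))"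
proof (rule continuous_map_top_of_set_sequentially)
  fix v assume "v \<in> cylinder D"
  then show "radial k (v 0) (f (v \<circ> Suc)) \<in> topspace X"
    using radial_in_skel_Suc(1)[OF near] skel_subset by (force simp: cylinder_def)
next
  fix \<sigma> :: "nat \<Rightarrow> nat \<Rightarrow> real" and v
  assume \<sigma>: "\<And>j. \<sigma> j \<in> cylinder D" "v \<in> cylinder D" "\<sigma> \<longlonglongrightarrow> v"
  have coord: "(\<lambda>j. \<sigma> j i) \<longlonglongrightarrow> v i" for i
    by (rule continuous_on_tendsto_compose[OF continuous_on_coordinate[of UNIV i] \<sigma>(3)]) auto
  have Suc_cont: "continuous_on UNIV (\<lambda>v::nat\<Rightarrow>real. v \<circ> Suc)"
    by (rule continuous_on_coordinatewise_then_product) (auto intro!: continuous_intros)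
  have y: "(\<lambda>j. \<sigma> j \<circ> Suc) \<longlonglongrightarrow> (v \<circ> Suc)"
    by (rule continuous_on_tendsto_compose[OF Suc_cont \<sigma>(3)]) auto
  have yD: "\<sigma> j \<circ> Suc \<in> D" "v \<circ> Suc \<in> D" for j using \<sigma>(1)[of j] \<sigma>(2) by (auto simp: cylinder_def)
  obtain m e r z zk where c: "e \<in> E m" "strict_mono (r :: nat \<Rightarrow> nat)"
      "\<forall>j. zk j \<in> disk_interior m" "\<forall>j. f (\<sigma> (r j) \<circ> Suc) = chr m e (zk j)" "z \<in> cdisk m" "zk \<longlonglongrightarrow> z"
      "f (v \<circ> Suc) = chr m e z"
    using map_sequence_in_cell[OF f yD y] by blast
  have zc: "zk j \<in> cdisk m" for j using c(3) by (auto simp: cdisk_cases)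
  have in_e: "chr m e (zk j) \<in> e" for j using chr_interior[OF c(1)] c(3) by blast
  have "chr m e (zk 0) \<in> skel (Suc k)" using fs yD(1)[of "r 0"] c(4)[THEN spec, of 0, symmetric] by (simp add: image_subset_iff)
  then have "m < Suc k" by (rule skel_cell_dim[OF c(1) in_e])
  then consider "m < k" | "m = k" by linarith
  then have "limitin X (\<lambda>j. radial k (\<sigma> (r j) 0) (f (\<sigma> (r j) \<circ> Suc))) (radial k (v 0) (f (v \<circ> Suc))) sequentially"
  proof cases
    case 1
    then have "chr m e w \<in> skel k" if "w \<in> cdisk m" for w
      using chr_skel[OF c(1) that] skel_mono[of "Suc m" k] by auto
    then have "radial k t (chr m e w) = chr m e w" if "w \<in> cdisk m" for t w
      using that by (simp add: radial_skel)
    moreover have "limitin X (\<lambda>j. chr m e (zk j)) (chr m e z) sequentially"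
      by (rule limitin_continuous_map_top_of_set[OF chr_cont[OF c(1)] zc c(5,6)])
    ultimately show ?thesis using zc c(4,5,7) by simp
  next
    case 2
    note c = c[unfolded 2] and zc = zc[unfolded 2]
    have rj: "rad k (zk j) > 1 / 2" for j
      using near_skel_chr[OF c(1), of "zk j"] c(3,4) near[OF yD(1)[of "r j"]] by simp
    have "(\<lambda>j. rad k (zk j)) \<longlonglongrightarrow> rad k z"
      by (rule continuous_on_tendsto_compose[OF continuous_on_rad[of UNIV] c(6)]) auto
    then have "1 / 2 \<le> rad k z"
      by (rule LIMSEQ_le_const) (use rj in \<open>auto intro: less_imp_le\<close>)
    then have rz: "rad k z \<noteq> 0" by auto
    let ?T = "UNIV \<times> {w. rad k w \<noteq> 0}"
    have pc: "continuous_on ?T (\<lambda>p. push k (fst p) (snd p))"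
      by (rule continuous_on_push) (auto intro!: continuous_intros)
    have t: "(\<lambda>j. \<sigma> (r j) 0) \<longlonglongrightarrow> v 0"
      using LIMSEQ_subseq_LIMSEQ[OF coord[of 0] c(2)] by (simp add: comp_def)
    have lim: "(\<lambda>j. push k (\<sigma> (r j) 0) (zk j)) \<longlonglongrightarrow> push k (v 0) z"
    proof -
      have "(\<lambda>j. push k (fst (\<sigma> (r j) 0, zk j)) (snd (\<sigma> (r j) 0, zk j))) \<longlonglongrightarrow>
          push k (fst (v 0, z)) (snd (v 0, z))"
      proof (rule continuous_on_tendsto_compose[OF pc tendsto_Pair[OF t c(6)]])
        show "(v 0, z) \<in> ?T" using rz by simp
        have "rad k (zk j) \<noteq> 0" for j using rj[of j] by simp
        then show "\<forall>\<^sub>F j in sequentially. (\<sigma> (r j) 0, zk j) \<in> ?T" by simp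
      qed
      then show ?thesis by simp
    qed
    have s01: "0 \<le> \<sigma> j 0" "\<sigma> j 0 \<le> 1" "0 \<le> v 0" "v 0 \<le> 1" for j
      using \<sigma>(1)[of j] \<sigma>(2) by (auto simp: cylinder_def)
    have pin: "push k (\<sigma> (r j) 0) (zk j) \<in> cdisk k" for j
      by (rule push_in_cdisk[OF zc]) (use rj[of j] s01 in auto)
    have "limitin X (\<lambda>j. chr k e (push k (\<sigma> (r j) 0) (zk j))) (chr k e (push k (v 0) z)) sequentially"
      by (rule limitin_continuous_map_top_of_set[OF chr_cont[OF c(1)] pin push_in_cdisk[OF c(5) rz s01(3,4)] lim])
    then show ?thesis
      using c(4,7) radial_chr[OF c(1) zc] radial_chr[OF c(1,5)] by simp
  qed
  then show "\<exists>r::nat\<Rightarrow>nat. limitin X (\<lambda>j. radial k (\<sigma> (r j) 0) (f (\<sigma> (r j) \<circ> Suc)))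
      (radial k (v 0) (f (v \<circ> Suc))) sequentially" by blast
qed

text \<open>Points approaching \<open>t\<close> whose images are not near the skeleton have images,
  along a subsequence, in one \<open>k\<close>-cell at radius at most 1/2. Their limit is in the
  interior of that cell and not in \<open>skel k\<close>.\<close>

lemma near_skel_nbhd:
  fixes D :: "(nat \<Rightarrow> real) set"
  assumes f: "continuous_map (top_of_set D) X f" "f ` D \<subseteq> skel (Suc k)"
    and t: "t \<in> D" "f t \<in> skel k"
  obtains U where "open U" "t \<in> U" "\<And>y. y \<in> D \<Longrightarrow> y \<in> U \<Longrightarrow> near_skel k (f y)"
proof (rule open_nbhd_by_sequences[of D "\<lambda>y. near_skel k (f y)" t])
  fix \<sigma> :: "nat \<Rightarrow> nat \<Rightarrow> real"
  assume \<sigma>: "\<And>j. \<sigma> j \<in> D \<and> \<not> near_skel k (f (\<sigma> j))" "\<sigma> \<longlonglongrightarrow> t"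
  then have \<sigma>D: "\<sigma> j \<in> D" and \<sigma>n: "\<not> near_skel k (f (\<sigma> j))" for j by auto
  obtain m e r z zk where c: "e \<in> E m" "strict_mono (r :: nat \<Rightarrow> nat)"
      "\<forall>j. zk j \<in> disk_interior m" "\<forall>j. f (\<sigma> (r j)) = chr m e (zk j)" "z \<in> cdisk m" "zk \<longlonglongrightarrow> z"
      "f t = chr m e z"
    using map_sequence_in_cell[OF f(1) \<sigma>D t(1) \<sigma>(2)] by blast
  have in_e: "chr m e (zk j) \<in> e" for j using chr_interior[OF c(1)] c(3) by blast
  have zc: "zk j \<in> cdisk m" for j using c(3) by (auto simp: cdisk_cases)
  have "chr m e (zk 0) \<in> skel (Suc k)" using f(2) \<sigma>D[of "r 0"] c(4)[THEN spec, of 0, symmetric] by (simp add: image_subset_iff)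
  then have "m < Suc k" by (rule skel_cell_dim[OF c(1) in_e])
  moreover have "\<not> m < k"
  proof
    assume "m < k"
    then have "chr m e (zk 0) \<in> skel k" using chr_skel[OF c(1) zc] skel_mono[of "Suc m" k] by auto
    then show False using \<sigma>n[of "r 0"] c(4) by (simp add: near_skel_def)
  qed
  ultimately have "m = k" by simp
  note c = c[unfolded \<open>m = k\<close>] and zc = zc[unfolded \<open>m = k\<close>]
  have rj: "rad k (zk j) \<le> 1 / 2" for j
  proof (rule ccontr)
    assume "\<not> rad k (zk j) \<le> 1 / 2"
    then have "near_skel k (chr k e (zk j))" using c(1) zc[of j] unfolding near_skel_def by force
    then show False using \<sigma>n[of "r j"] c(4) by simp
  qed
  have "(\<lambda>j. rad k (zk j)) \<longlonglongrightarrow> rad k z"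
    by (rule continuous_on_tendsto_compose[OF continuous_on_rad[of UNIV] c(6)]) auto
  then have "rad k z \<le> 1 / 2"
    by (rule LIMSEQ_le_const2) (use rj in auto)
  then have "z \<in> disk_interior k" using c(5) by (simp add: disk_interior_rad)
  then show False using cell_not_skel[OF c(1) chr_interior[OF c(1)]] t(2) c(7) by simp
qed (rule that)

text \<open>A \<open>k\<close>-cell is relatively open as far as maps into
  \<open>skel (Suc k)\<close> can see: a limit of points of another cell of dimension at most
  \<open>k\<close> lies in that other cell or in its boundary, which is in
  \<open>skel k\<close>.\<close>

lemma cell_nbhd:
  fixes D :: "(nat \<Rightarrow> real) set"
  assumes f: "continuous_map (top_of_set D) X f" "f ` D \<subseteq> skel (Suc k)"
    and t: "t \<in> D" "f t \<in> e" "e \<in> E k"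
  obtains U where "open U" "t \<in> U" "\<And>y. y \<in> D \<Longrightarrow> y \<in> U \<Longrightarrow> f y \<in> e"
proof (rule open_nbhd_by_sequences[of D "\<lambda>y. f y \<in> e" t])
  fix \<sigma> :: "nat \<Rightarrow> nat \<Rightarrow> real"
  assume \<sigma>: "\<And>j. \<sigma> j \<in> D \<and> \<not> f (\<sigma> j) \<in> e" "\<sigma> \<longlonglongrightarrow> t"
  then have \<sigma>D: "\<sigma> j \<in> D" for j by auto
  obtain m e' r z zk where c: "e' \<in> E m" "strict_mono (r :: nat \<Rightarrow> nat)"
      "\<forall>j. zk j \<in> disk_interior m" "\<forall>j. f (\<sigma> (r j)) = chr m e' (zk j)" "z \<in> cdisk m" "zk \<longlonglongrightarrow> z"
      "f t = chr m e' z"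
    using map_sequence_in_cell[OF f(1) \<sigma>D t(1) \<sigma>(2)] by blast
  have in_e: "chr m e' (zk j) \<in> e'" for j using chr_interior[OF c(1)] c(3) by blast
  have "chr m e' (zk 0) \<in> skel (Suc k)" using f(2) \<sigma>D[of "r 0"] c(4)[THEN spec, of 0, symmetric] by (simp add: image_subset_iff)
  then have m: "m < Suc k" by (rule skel_cell_dim[OF c(1) in_e])
  show False
  proof (cases "z \<in> disk_interior m")
    case True
    then have "e' = e" using cells_disjoint[OF c(1) t(3) chr_interior[OF c(1)]] t(2) c(7) by auto
    then show False using \<sigma>(1)[of "r 0"] in_e[of 0] c(4) by simp
  next
    case False
    then have "chr m e' z \<in> skel m" using chr_boundary_skel[OF c(1)] c(5) by (auto simp: cdisk_cases)
    then have "f t \<in> skel k" using skel_mono[of m k] m c(7) by auto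
    then show False using cell_not_skel[OF t(3,2)] by simp
  qed
qed (rule that)

text \<open>Near a point of the lower skeleton, \<open>f\<close> is deformed radially into that skeleton.  The
  difference \<open>G\<close> of the two phases along the deformation is a lift of a continuous map into the
  circle, and is continuous on the end slice and on every track of the deformation, hence everywhere.\<close>

lemma good_near_skel:
  assumes \<alpha>: "good k \<alpha>"
    and ext: "\<And>x. x \<in> skel k \<Longrightarrow> \<alpha>' x = \<alpha> x"
    and pot: "\<And>m e. m < Suc k \<Longrightarrow> e \<in> E m \<Longrightarrow> potential (cdisk m) (chr m e) (\<lambda>z. \<alpha>' (chr m e z))"
    and D: "compact_convex D" and f: "continuous_map (top_of_set D) X f" "f ` D \<subseteq> skel (Suc k)"
    and near: "\<And>y. y \<in> D \<Longrightarrow> near_skel k (f y)"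
    and \<beta>: "potential D f \<beta>"
  shows "continuous_on D (\<lambda>y. \<alpha>' (f y) - \<beta> y)"
proof -
  define H where "H v = radial k (v 0) (f (v \<circ> Suc))" for v :: "nat \<Rightarrow> real"
  have C: "compact_convex (cylinder D)" by (rule compact_convex_cylinder[OF D])
  have H: "continuous_map (top_of_set (cylinder D)) X H"
    unfolding H_def by (rule radial_cont[OF f near])
  have Hs: "H ` cylinder D \<subseteq> skel (Suc k)"
    unfolding H_def using radial_in_skel_Suc(1)[OF near] by (auto simp: cylinder_def)
  obtain \<beta>H where \<beta>H: "potential (cylinder D) H \<beta>H" using potential_exists[OF C H] .
  define G where "G v = \<alpha>' (H v) - \<beta>H v" for v
  have "continuous_on (cylinder D) (\<lambda>v. cis (\<alpha>' (H v)) / cis (\<beta>H v))"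
    by (rule sec_ratio[OF potential_sec[OF \<beta>H] good_sec[OF pot H Hs]])
       (use H in \<open>auto simp: continuous_map_def\<close>)
  then have "continuous_on (cylinder D) (\<lambda>v. cis (G v))"
    by (simp add: G_def cis_divide)
  then obtain \<Gamma> where \<Gamma>: "continuous_on (cylinder D) \<Gamma>" "\<And>v. v \<in> cylinder D \<Longrightarrow> cis (G v) = cis (\<Gamma> v)"
    using cis_lift[OF C, of "\<lambda>v. cis (G v)"] norm_cis by blast
  \<comment> \<open>\<open>K\<close> takes values in the multiples of 2 pi but is not known to be
    continuous. It is constant on every compact convex piece on which \<open>\<alpha>'\<close> is
    already known to give a potential; the end slice and the tracks are such pieces and together
    connect all points of the time-0 slice.\<close>
  define K where "K v = G v - \<Gamma> v" for v
  have K1: "cis (K v) = 1" if "v \<in> cylinder D" for v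
    using \<Gamma>(2)[OF that] by (simp add: K_def flip: cis_divide)
  have cyl: "case_nat t y \<in> cylinder D" if "0 \<le> t" "t \<le> 1" "y \<in> D" for t y
    using that by (simp add: cylinder_def)
  have const: "K (j a) = K (j b)"
    if D': "compact_convex D'" and j: "continuous_on D' j" "j ` D' \<subseteq> cylinder D"
      and p: "potential D' (\<lambda>v. H (j v)) (\<lambda>v. \<alpha>' (H (j v)))" and ab: "a \<in> D'" "b \<in> D'"
    for D' j a b
  proof -
    have Hj: "continuous_map (top_of_set D') X (\<lambda>v. H (j v))"
      by (rule continuous_map_compose_top_of_set[OF H j])
    have "continuous_on D' (\<lambda>v. G (j v))"
      unfolding G_def
      by (rule potential_diff_continuous[OF D' Hj potential_compose[OF \<beta>H j] p])
    moreover have "continuous_on D' (\<lambda>v. \<Gamma> (j v))"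
      by (rule continuous_on_compose2[OF \<Gamma>(1) j])
    ultimately have "continuous_on D' (\<lambda>v. K (j v))"
      unfolding K_def by (rule continuous_on_diff)
    then show ?thesis
      by (rule cis_eq_1_constant[OF compact_convex_connected[OF D'] _ _ ab]) (use K1 j(2) in blast)
  qed
  have slice: "continuous_on D (\<lambda>y. case_nat t y)" "case_nat t ` D \<subseteq> cylinder D" if "0 \<le> t" "t \<le> 1" for t
    using cyl that by (auto intro!: continuous_on_case_nat continuous_intros)
  have top: "K (case_nat 1 a) = K (case_nat 1 b)" if "a \<in> D" "b \<in> D" for a b
  proof (rule const[OF D slice _ that])
    have cm: "continuous_map (top_of_set D) X (\<lambda>y. H (case_nat 1 y))"
      by (rule continuous_map_compose_top_of_set[OF H slice]) auto
    have sk: "H (case_nat 1 y) \<in> skel k" if "y \<in> D" for y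
      using radial_in_skel_Suc(2)[OF near[OF that], of 1] by (simp add: H_def)
    show "potential D (\<lambda>y. H (case_nat 1 y)) (\<lambda>y. \<alpha>' (H (case_nat 1 y)))"
      by (rule potential_cong[OF good_potential[OF \<alpha> D cm]]) (use sk ext in auto)
  qed auto
  have track: "K (case_nat 0 y) = K (case_nat 1 y)" if y: "y \<in> D" for y
  proof -
    define j where "j v = case_nat (v 1) y" for v :: "nat \<Rightarrow> real"
    have "case_nat (v 1) y \<in> cylinder D" if "v \<in> I1" for v
      by (rule cyl[OF I1_edge(2,3)[OF that] y])
    then have j: "continuous_on I1 j" "j ` I1 \<subseteq> cylinder D"
      unfolding j_def by (auto intro!: continuous_on_case_nat continuous_intros)
    have Hj: "H (j v) = radial k (v 1) (f y)" for v by (simp add: H_def j_def)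
    have "potential I1 (\<lambda>v. H (j v)) (\<lambda>v. \<alpha>' (H (j v)))"
      using near[OF y]
    proof (cases rule: near_skel_cases)
      case 1
      then have "f y \<in> topspace X" using skel_subset by blast
      then have "potential I1 (\<lambda>v. f y) (\<lambda>v. \<alpha> (f y))"
        by (intro good_potential[OF \<alpha> compact_convex_standard_simplex]) (use 1 in auto)
      then show ?thesis
        by (rule potential_cong) (simp_all add: Hj radial_skel 1 ext)
    next
      case (2 e z)
      have rz: "rad k z \<noteq> 0" using 2(4) by simp
      have p: "continuous_on I1 (\<lambda>v. push k (v 1) z)"
        by (intro continuous_on_push continuous_intros) (simp add: rz)
      have "(\<lambda>v. push k (v 1) z) ` I1 \<subseteq> cdisk k"
        using push_in_cdisk[OF 2(2) rz] I1_edge(2,3) by blast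
      from potential_compose[OF pot[OF _ 2(1)] p this]
      show ?thesis by (simp add: Hj 2(3) radial_chr[OF 2(1,2)])
    qed
    from const[OF compact_convex_standard_simplex j this, of "vtx 0" "vtx 1"]
    show ?thesis by (simp add: j_def vtx_def)
  qed
  show ?thesis
  proof (cases "D = {}")
    case False
    then obtain a where a: "a \<in> D" by auto
    have 1: "continuous_on D (\<lambda>y. \<Gamma> (case_nat 0 y) + K (case_nat 0 a))"
      by (intro continuous_intros continuous_on_compose2[OF \<Gamma>(1) slice]) auto
    have H0: "H (case_nat 0 y) = f y" if "y \<in> D" for y
      using radial_0 f(2) that by (auto simp: H_def)
    \<comment> \<open>At time 0 the deformation is \<open>f\<close>, so the auxiliary potential
      restricts to a potential of \<open>f\<close> and may be exchanged for
      \<open>\<beta>\<close>.\<close>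
    have "potential D (\<lambda>y. H (case_nat 0 y)) (\<lambda>y. \<beta>H (case_nat 0 y))"
      by (rule potential_compose[OF \<beta>H slice]) auto
    then have "potential D f (\<lambda>y. \<beta>H (case_nat 0 y))"
      by (rule potential_cong) (simp_all add: H0)
    then have 2: "continuous_on D (\<lambda>y. \<beta>H (case_nat 0 y) - \<beta> y)"
      by (rule potential_diff_continuous[OF D f(1) \<beta>])
    have "\<Gamma> (case_nat 0 y) + K (case_nat 0 a) + (\<beta>H (case_nat 0 y) - \<beta> y) = \<alpha>' (f y) - \<beta> y"
      if y: "y \<in> D" for y
    proof -
      have "K (case_nat 0 a) = K (case_nat 0 y)"
        using top[OF a y] track[OF a] track[OF y] by simp
      then show ?thesis by (simp add: K_def G_def H0[OF y])
    qed
    with continuous_on_add[OF 1 2] show ?thesis by (rule continuous_on_eq)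
  qed simp
qed

text \<open>\<open>\<alpha>'\<close> is defined on each new cell by \<open>cell_extension\<close>.
  To see that it is good, compare it on \<open>D\<close> with an existing potential
  \<open>\<beta>\<close>: it is enough that the difference is continuous, and this is local. Near a
  point sent into an open \<open>k\<close>-cell, \<open>f\<close> factors through the disk; near a
  point sent into \<open>skel k\<close>, \<open>good_near_skel\<close> applies.\<close>

lemma good_step:
  assumes \<alpha>: "good k \<alpha>"
  obtains \<alpha>' where "good (Suc k) \<alpha>'" "\<And>x. x \<in> skel k \<Longrightarrow> \<alpha>' x = \<alpha> x"
proof -
  have "\<exists>\<mu>. potential (cdisk k) (chr k e) \<mu> \<and> (\<forall>z\<in>disk_boundary k. \<mu> z = \<alpha> (chr k e z))" if "e \<in> E k" for e
    by (rule cell_extension[OF \<alpha> that]) blast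
  then obtain \<mu> where \<mu>: "\<And>e. e \<in> E k \<Longrightarrow> potential (cdisk k) (chr k e) (\<mu> e)"
    "\<And>e z. e \<in> E k \<Longrightarrow> z \<in> disk_boundary k \<Longrightarrow> \<mu> e z = \<alpha> (chr k e z)" by metis
  define \<alpha>' where "\<alpha>' x = (if x \<in> skel k then \<alpha> x else \<mu> (cell_of k x) (chr_inv k (cell_of k x) x))" for x
  have ext: "\<alpha>' x = \<alpha> x" if "x \<in> skel k" for x using that by (simp add: \<alpha>'_def)
  have \<alpha>'_chr: "\<alpha>' (chr k e z) = \<mu> e z" if e: "e \<in> E k" and z: "z \<in> cdisk k" for e z
  proof (cases "z \<in> disk_interior k")
    case True
    then show ?thesis
      using cell_not_skel[OF e chr_interior[OF e True]]
      by (simp add: \<alpha>'_def cell_of_eq[OF e chr_interior[OF e True]] chr_inv_chr[OF e])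
  next
    case False
    then have "z \<in> disk_boundary k" using z by (auto simp: cdisk_cases)
    then show ?thesis using chr_boundary_skel[OF e] \<mu>(2)[OF e] by (simp add: ext)
  qed
  have pot: "potential (cdisk m) (chr m e) (\<lambda>z. \<alpha>' (chr m e z))" if m: "m < Suc k" and e: "e \<in> E m" for m e
  proof (cases "m = k")
    case True
    then show ?thesis using potential_cong[OF \<mu>(1)[of e]] \<alpha>'_chr[of e] e by simp
  next
    case False
    then have sk: "chr m e ` cdisk m \<subseteq> skel k"
      using chr_skel[OF e] skel_mono[of "Suc m" k] m by fastforce
    show ?thesis
      by (rule potential_cong[OF good_potential[OF \<alpha> compact_convex_cdisk chr_cont[OF e] sk]])
         (use sk ext in auto)
  qed
  have "good (Suc k) \<alpha>'"
    unfolding good_def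
  proof (intro allI impI)
    fix D f assume "compact_convex D \<and> continuous_map (top_of_set D) X f \<and> f ` D \<subseteq> skel (Suc k)"
    then have D: "compact_convex D" and f: "continuous_map (top_of_set D) X f" "f ` D \<subseteq> skel (Suc k)" by auto
    obtain \<beta> where \<beta>: "potential D f \<beta>" using potential_exists[OF D f(1)] .
    have sub: "continuous_map (top_of_set D') X f" "potential D' f \<beta>" "f ` D' \<subseteq> skel (Suc k)" if "D' \<subseteq> D" for D'
      using continuous_map_from_subtopology_mono[OF f(1) that] potential_compose[OF \<beta> continuous_on_id, of D']
        f(2) that by auto
    have "continuous_on D (\<lambda>y. \<alpha>' (f y) - \<beta> y)"
    proof (rule continuous_on_locally_open)
      fix t assume t: "t \<in> D"
      have "\<exists>U. open U \<and> t \<in> U \<and> (\<forall>D'. compact_convex D' \<longrightarrow> D' \<subseteq> D \<inter> U \<longrightarrow>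
          continuous_on D' (\<lambda>y. \<alpha>' (f y) - \<beta> y))"
      proof (cases "f t \<in> skel k")
        case True
        obtain U where U: "open U" "t \<in> U" "\<And>y. y \<in> D \<Longrightarrow> y \<in> U \<Longrightarrow> near_skel k (f y)"
          using near_skel_nbhd[OF f t True] by blast
        have "continuous_on D' (\<lambda>y. \<alpha>' (f y) - \<beta> y)" if D': "compact_convex D'" "D' \<subseteq> D \<inter> U" for D'
        proof -
          have "D' \<subseteq> D" using D' by auto
          then show ?thesis
            using U(3) D' by (intro good_near_skel[OF \<alpha> ext pot D'(1) sub(1) sub(3) _ sub(2)]) auto
        qed
        then show ?thesis using U by blast
      next
        case False
        then obtain e where e: "e \<in> E k" "f t \<in> e" using f(2) t by (force simp: skel_Suc)
        obtain U where U: "open U" "t \<in> U" "\<And>y. y \<in> D \<Longrightarrow> y \<in> U \<Longrightarrow> f y \<in> e"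
          using cell_nbhd[OF f t e(2,1)] by blast
        have "continuous_on D' (\<lambda>y. \<alpha>' (f y) - \<beta> y)" if D': "compact_convex D'" "D' \<subseteq> D \<inter> U" for D'
        proof -
          have D'D: "D' \<subseteq> D" using D' by auto
          have fe: "f y \<in> e" if "y \<in> D'" for y using U(3) that D'(2) by auto
          define h where "h y = chr_inv k e (f y)" for y
          have fh: "chr k e (h y) = f y" "h y \<in> disk_interior k" if "y \<in> D'" for y
            using chr_inv[OF e(1) fe[OF that]] by (auto simp: h_def)
          have "continuous_map (top_of_set D') (subtopology X e) f"
            using sub(1)[OF D'D] fe by (auto simp: continuous_map_in_subtopology)
          from continuous_map_compose[OF this chr_inv_cont[OF e(1)]]
          have h: "continuous_on D' h"
            by (auto simp: comp_def h_def[abs_def] continuous_map_in_subtopology)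
          have "h ` D' \<subseteq> cdisk k" using fh(2) by (auto simp: cdisk_cases)
          from potential_compose[OF pot[OF _ e(1)] h this]
          have "potential D' (\<lambda>y. chr k e (h y)) (\<lambda>y. \<alpha>' (chr k e (h y)))" by simp
          then have "potential D' f (\<lambda>y. \<alpha>' (f y))"
            by (rule potential_cong) (simp_all add: fh)
          then show ?thesis
            by (rule potential_diff_continuous[OF D'(1) sub(1)[OF D'D] sub(2)[OF D'D]])
        qed
        then show ?thesis using U by blast
      qed
      then obtain U where U: "open U" "t \<in> U" "\<And>D'. compact_convex D' \<Longrightarrow> D' \<subseteq> D \<inter> U \<Longrightarrow>
          continuous_on D' (\<lambda>y. \<alpha>' (f y) - \<beta> y)" by blast
      obtain D' V where D': "compact_convex D'" "D' \<subseteq> D \<inter> U" "open V" "t \<in> V" "D \<inter> V \<subseteq> D'"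
        using compact_convex_nbhd[OF D U(1,2) t] .
      show "\<exists>V. open V \<and> t \<in> V \<and> continuous_on (D \<inter> V) (\<lambda>y. \<alpha>' (f y) - \<beta> y)"
        using D' continuous_on_subset[OF U(3)[OF D'(1,2)] D'(5)] by blast
    qed
    from potential_add[OF f(1) \<beta> this] show "potential D f (\<lambda>y. \<alpha>' (f y))" by simp
  qed
  then show thesis using that ext by blast
qed

text \<open>Each extension leaves the lower skeleton unchanged, so the functions glue over all
  dimensions. No limit argument is needed for continuity, as the weak topology tests it on closed
  cells, each of which lies in one skeleton.\<close>

theorem global_section:
  obtains \<alpha> where "\<And>i. i < n \<Longrightarrow> continuous_map X euclidean (\<lambda>x. cis (\<alpha> x) * s x i)"
proof -
  have "\<exists>F. \<forall>k. good k (F k) \<and> (\<forall>x\<in>skel k. F (Suc k) x = F k x)"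
  proof (rule dependent_nat_choice)
    show "\<exists>\<alpha>. good 0 \<alpha>" using good_0 by blast
    show "\<exists>\<alpha>'. good (Suc k) \<alpha>' \<and> (\<forall>x\<in>skel k. \<alpha>' x = \<alpha> x)" if "good k \<alpha>" for \<alpha> k
      by (rule good_step[OF that]) blast
  qed
  then obtain F where F: "\<And>k. good k (F k)" "\<And>k x. x \<in> skel k \<Longrightarrow> F (Suc k) x = F k x"
    by blast
  have stable: "F m x = F k x" if "x \<in> skel k" "k \<le> m" for k m x
    using that(2)
  proof (induction m rule: dec_induct)
    case (step j)
    then show ?case using F(2)[of x j] skel_mono[of k j] that(1) by auto
  qed simp
  \<comment> \<open>The first skeleton containing \<open>x\<close>; from there on the values at
    \<open>x\<close> are stable.\<close>
  define d where "d x = (LEAST k. x \<in> skel k)" for x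
  define \<alpha> where "\<alpha> x = F (d x) x" for x
  have \<alpha>: "\<alpha> x = F k x" if "x \<in> skel k" for x k
    using stable[of x "d x" k] that LeastI[of "\<lambda>k. x \<in> skel k" k] Least_le[of "\<lambda>k. x \<in> skel k" k]
    by (simp add: \<alpha>_def d_def)
  show thesis
  proof (rule that[of \<alpha>], rule continuous_map_cellwise)
    fix i k e assume i: "i < n" and e: "e \<in> E k"
    have "potential (cdisk k) (chr k e) (\<lambda>z. F (Suc k) (chr k e z))"
      by (rule good_potential[OF F(1) compact_convex_cdisk chr_cont[OF e]]) (use chr_skel[OF e] in auto)
    then have "potential (cdisk k) (chr k e) (\<lambda>z. \<alpha> (chr k e z))"
      by (rule potential_cong) (simp_all add: \<alpha>[OF chr_skel[OF e]])
    from sec_cont[OF potential_sec[OF this] i]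
    show "continuous_on (cdisk k) (\<lambda>z. cis (\<alpha> (chr k e z)) * s (chr k e z) i)" .
  qed
qed

end

theorem line_field_trivial:
  assumes "CW_complex X" "simply_connected_space X" "Hom_to_int_trivial (homology_group 2 X)"
    and "line_field X n s"
  obtains \<alpha> where "\<And>i. i < n \<Longrightarrow> continuous_map X euclidean (\<lambda>x. cis (\<alpha> x) * s x i)"
proof -
  interpret line_field X n s by fact
  obtain E where "cw_structure X E" using assms(1) by (auto simp: CW_complex_def)
  moreover obtain b where "\<And>\<sigma>. singular_simplex 2 X \<sigma> \<Longrightarrow>
    curv \<sigma> = b (singular_face 2 0 \<sigma>) - b (singular_face 2 1 \<sigma>) + b (singular_face 2 2 \<sigma>)"
    using curv_coboundary[OF assms(2,3)] by blast
  ultimately interpret cw_flat X E n s b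
    by unfold_locales
  show thesis using global_section that by blast
qed

section \<open>Finite subsets of the plane varying continuously\<close>

lemma eventually_continuous_map:
  fixes D :: "'m::topological_space set"
  assumes "continuous_map (top_of_set D) X g" "y \<in> D" "openin X W" "g y \<in> W"
  shows "\<forall>\<^sub>F z in at y within D. g z \<in> W"
proof -
  have "openin (top_of_set D) {z \<in> D. g z \<in> W}"
    using assms(1,3) by (simp add: continuous_map_def)
  then obtain U where "open U" "{z \<in> D. g z \<in> W} = D \<inter> U" by (auto simp: openin_open)
  then show ?thesis using assms(2,4) unfolding eventually_at_topological by blast
qed

text \<open>\<open>lower\<close> is only lower semicontinuity: points of a fibre persist nearby.
  Since all fibres have \<open>n\<close> points, no new points can appear, and the sets vary
  continuously.\<close>

locale continuous_spectra =
  fixes X :: "'a topology" and n :: nat and Sp :: "'a \<Rightarrow> complex set"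
  assumes finite_Sp: "x \<in> topspace X \<Longrightarrow> finite (Sp x)"
    and card_Sp: "x \<in> topspace X \<Longrightarrow> card (Sp x) = n"
    and lower: "x \<in> topspace X \<Longrightarrow> r \<in> Sp x \<Longrightarrow> 0 < \<tau> \<Longrightarrow>
      \<exists>W. openin X W \<and> x \<in> W \<and> (\<forall>x'\<in>W. \<exists>r'\<in>Sp x'. dist r r' < \<tau>)"
begin

text \<open>A metric form of even covering: over \<open>W\<close> any two fibres are matched by
  distance less than \<open>\<epsilon>\<close>. The case \<open>x = x'\<close> says that distinct
  points of one fibre are at least \<open>\<epsilon>\<close> apart.\<close>

definition separated :: "'a set \<Rightarrow> real \<Rightarrow> bool" where
  "separated W \<epsilon> \<longleftrightarrow> (\<forall>x\<in>W. \<forall>x'\<in>W. \<forall>r\<in>Sp x. \<exists>r'\<in>Sp x'.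
    dist r r' < \<epsilon> \<and> (\<forall>r''\<in>Sp x'. r'' \<noteq> r' \<longrightarrow> \<epsilon> \<le> dist r r''))"

text \<open>Let \<open>d\<close> be at most the smallest gap in the fibre over \<open>x0\<close>.
  Following each of its points within \<open>d / 4\<close> is injective, hence bijective by
  cardinality. Two fibres over \<open>W\<close> are then matched through the one over
  \<open>x0\<close> within \<open>d / 2\<close>, and unmatched points are at least
  \<open>d / 2\<close> apart.\<close>

lemma separated_nbhd:
  assumes x0: "x0 \<in> topspace X"
  obtains W \<epsilon> where "openin X W" "x0 \<in> W" "0 < \<epsilon>" "separated W \<epsilon>"
proof -
  have fin: "finite (Sp x0)" using finite_Sp[OF x0] .
  obtain d where d: "d > 0" "\<And>r r'. r \<in> Sp x0 \<Longrightarrow> r' \<in> Sp x0 \<Longrightarrow> r \<noteq> r' \<Longrightarrow> d \<le> dist r r'"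
  proof -
    let ?P = "{(r, r'). r \<in> Sp x0 \<and> r' \<in> Sp x0 \<and> r \<noteq> r'}"
    have "finite ?P" by (rule finite_subset[of _ "Sp x0 \<times> Sp x0"]) (use fin in auto)
    \<comment> \<open>The added 1 keeps the minimum meaningful when the fibre has fewer than two
      points.\<close>
    then have f: "finite (insert 1 ((\<lambda>(r, r'). dist r r') ` ?P))" by auto
    have "Min (insert 1 ((\<lambda>(r, r'). dist r r') ` ?P)) > 0"
      using f by (subst Min_gr_iff) auto
    moreover have "Min (insert 1 ((\<lambda>(r, r'). dist r r') ` ?P)) \<le> dist r r'"
      if "r \<in> Sp x0" "r' \<in> Sp x0" "r \<noteq> r'" for r r'
      by (rule Min_le[OF f]) (use that in auto)
    ultimately show thesis using that by blast
  qed
  have "\<exists>W. openin X W \<and> x0 \<in> W \<and> (\<forall>x'\<in>W. \<exists>r'\<in>Sp x'. dist r r' < d / 4)" if "r \<in> Sp x0" for r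
    using lower[OF x0 that, of "d / 4"] d(1) by simp
  then obtain U where U: "\<And>r. r \<in> Sp x0 \<Longrightarrow> openin X (U r) \<and> x0 \<in> U r \<and> (\<forall>x'\<in>U r. \<exists>r'\<in>Sp x'. dist r r' < d / 4)"
    by metis
  define W where "W = topspace X \<inter> (\<Inter>r\<in>Sp x0. U r)"
  have "openin X W"
  proof (cases "Sp x0 = {}")
    case False
    then show ?thesis
      unfolding W_def using U fin by (intro openin_Int openin_INT2) auto
  qed (simp add: W_def)
  moreover have "x0 \<in> W" using U x0 by (auto simp: W_def)
  moreover have "separated W (d / 2)"
  proof -
    have near: "\<exists>g. bij_betw g (Sp x0) (Sp x) \<and> (\<forall>r\<in>Sp x0. dist r (g r) < d / 4)" if x: "x \<in> W" for x
    proof -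
      have "\<exists>r'\<in>Sp x. dist r r' < d / 4" if "r \<in> Sp x0" for r
        using U[OF that] x that by (auto simp: W_def)
      then obtain g where g: "\<And>r. r \<in> Sp x0 \<Longrightarrow> g r \<in> Sp x \<and> dist r (g r) < d / 4" by metis
      have "inj_on g (Sp x0)"
      proof (rule inj_onI, rule ccontr)
        fix r r' assume r: "r \<in> Sp x0" "r' \<in> Sp x0" "g r = g r'" "r \<noteq> r'"
        have "dist r r' \<le> dist r (g r) + dist r' (g r')"
          using dist_triangle2[of r r' "g r"] r(3) by simp
        then show False using g[OF r(1)] g[OF r(2)] d(2)[OF r(1,2,4)] d(1) by linarith
      qed
      moreover have "x \<in> topspace X" using x by (simp add: W_def)
      then have "card (Sp x) = card (Sp x0)" "finite (Sp x)"
        using card_Sp x0 finite_Sp by auto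
      ultimately have "bij_betw g (Sp x0) (Sp x)"
        using g by (intro bij_betw_imageI card_subset_eq) (auto simp: card_image)
      then show ?thesis using g by blast
    qed
    show ?thesis
      unfolding separated_def
    proof (intro ballI)
      fix x x' r assume x: "x \<in> W" "x' \<in> W" and r: "r \<in> Sp x"
      obtain g where g: "bij_betw g (Sp x0) (Sp x)" "\<forall>r\<in>Sp x0. dist r (g r) < d / 4" using near[OF x(1)] by blast
      obtain g' where g': "bij_betw g' (Sp x0) (Sp x')" "\<forall>r\<in>Sp x0. dist r (g' r) < d / 4" using near[OF x(2)] by blast
      obtain r0 where r0: "r0 \<in> Sp x0" "r = g r0" using g(1) r by (auto simp: bij_betw_def)
      show "\<exists>r'\<in>Sp x'. dist r r' < d / 2 \<and> (\<forall>r''\<in>Sp x'. r'' \<noteq> r' \<longrightarrow> d / 2 \<le> dist r r'')"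
      proof (intro bexI[of _ "g' r0"] conjI ballI impI)
        show "g' r0 \<in> Sp x'" using g'(1) r0(1) by (auto simp: bij_betw_def)
        have gr: "dist r0 r < d / 4" using g(2) r0 by simp
        have "dist r0 (g' r0) < d / 4" using g'(2) r0(1) by simp
        then show "dist r (g' r0) < d / 2"
          using gr dist_triangle3[of r "g' r0" r0] by linarith
        fix r'' assume r'': "r'' \<in> Sp x'" "r'' \<noteq> g' r0"
        then obtain r1 where r1: "r1 \<in> Sp x0" "r'' = g' r1" using g'(1) by (auto simp: bij_betw_def)
        have "dist r1 r'' < d / 4" using g'(2) r1 by simp
        moreover have "d \<le> dist r0 r1" using d(2) r0 r1 r'' by metis
        moreover have "dist r0 r1 \<le> dist r0 r + dist r r'' + dist r1 r''"
          using dist_triangle[of r0 r1 r] dist_triangle2[of r r1 r''] by linarith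
        ultimately show "d / 2 \<le> dist r r''" using gr by linarith
      qed
    qed
  qed
  ultimately show thesis using that[of W "d / 2"] d(1) by simp
qed

definition nearest :: "'a \<Rightarrow> complex \<Rightarrow> complex" where
  "nearest x' r = (SOME r'. r' \<in> Sp x' \<and> (\<forall>r''\<in>Sp x'. dist r r' \<le> dist r r''))"

lemma nearest_separated:
  assumes W: "separated W \<epsilon>" and x: "x \<in> W" "x' \<in> W" and r: "r \<in> Sp x"
  shows "nearest x' r \<in> Sp x'" "dist r (nearest x' r) < \<epsilon>"
    "\<And>r'. r' \<in> Sp x' \<Longrightarrow> dist r r' < \<epsilon> \<Longrightarrow> r' = nearest x' r"
proof -
  obtain r' where r': "r' \<in> Sp x'" "dist r r' < \<epsilon>" "\<And>r''. r'' \<in> Sp x' \<Longrightarrow> r'' \<noteq> r' \<Longrightarrow> \<epsilon> \<le> dist r r''"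
    using W x r unfolding separated_def by meson
  have "nearest x' r = r'"
    unfolding nearest_def
  proof (rule some_equality)
    show "r' \<in> Sp x' \<and> (\<forall>r''\<in>Sp x'. dist r r' \<le> dist r r'')"
    proof (intro conjI ballI r'(1))
      fix r'' assume "r'' \<in> Sp x'"
      then show "dist r r' \<le> dist r r''" using r'(2) r'(3)[of r''] by (cases "r'' = r'") auto
    qed
    fix r1 assume r1: "r1 \<in> Sp x' \<and> (\<forall>r''\<in>Sp x'. dist r r1 \<le> dist r r'')"
    then have "dist r r1 \<le> dist r r'" using r'(1) by blast
    then show "r1 = r'" using r'(2) r'(3)[of r1] r1 by force
  qed
  then show "nearest x' r \<in> Sp x'" "dist r (nearest x' r) < \<epsilon>"
    "\<And>r''. r'' \<in> Sp x' \<Longrightarrow> dist r r'' < \<epsilon> \<Longrightarrow> r'' = nearest x' r"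
    using r' by (auto simp: not_less) (meson not_less)
qed

section \<open>Continuation of eigenvalues over compact convex sets\<close>

definition spsec :: "(nat \<Rightarrow> real) set \<Rightarrow> ((nat \<Rightarrow> real) \<Rightarrow> 'a) \<Rightarrow> ((nat \<Rightarrow> real) \<Rightarrow> complex) \<Rightarrow> bool" where
  "spsec D f \<mu> \<longleftrightarrow> continuous_on D \<mu> \<and> (\<forall>y\<in>D. \<mu> y \<in> Sp (f y))"

lemma spsec_compose:
  "spsec D f \<mu> \<Longrightarrow> continuous_on D' g \<Longrightarrow> g ` D' \<subseteq> D \<Longrightarrow> spsec D' (\<lambda>y. f (g y)) (\<lambda>y. \<mu> (g y))"
  unfolding spsec_def by (auto intro: continuous_on_compose2[of D \<mu> D' g])

lemma spsec_cong:
  "spsec D f \<mu> \<Longrightarrow> (\<And>y. y \<in> D \<Longrightarrow> f y = f' y) \<Longrightarrow> spsec D f' \<mu>"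
  by (simp add: spsec_def)

definition close :: "'a \<Rightarrow> 'a \<Rightarrow> bool" where
  "close x x' \<longleftrightarrow> (\<exists>W \<epsilon>. openin X W \<and> x \<in> W \<and> x' \<in> W \<and> separated W \<epsilon>)"

lemma spsec_step:
  assumes g: "continuous_map (top_of_set D) X g" and g': "continuous_map (top_of_set D) X g'"
    and \<mu>: "spsec D g \<mu>" and cl: "\<And>y. y \<in> D \<Longrightarrow> close (g y) (g' y)"
  shows "spsec D g' (\<lambda>y. nearest (g' y) (\<mu> y))"
proof -
  have mem: "nearest (g' y) (\<mu> y) \<in> Sp (g' y)" if y: "y \<in> D" for y
    using cl[OF y] nearest_separated(1) \<mu> y unfolding close_def spsec_def by blast
  have "((\<lambda>y. nearest (g' y) (\<mu> y)) \<longlongrightarrow> nearest (g' y) (\<mu> y)) (at y within D)" if y: "y \<in> D" for y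
  proof (rule tendstoI)
    fix e :: real assume e: "0 < e"
    obtain W \<epsilon> where W: "openin X W" "g y \<in> W" "g' y \<in> W" "separated W \<epsilon>"
      using cl[OF y] by (auto simp: close_def)
    have \<mu>y: "\<mu> y \<in> Sp (g y)" using \<mu> y by (simp add: spsec_def)
    define r where "r = nearest (g' y) (\<mu> y)"
    have r: "r \<in> Sp (g' y)" "dist (\<mu> y) r < \<epsilon>"
      using nearest_separated(1,2)[OF W(4,2,3) \<mu>y] by (auto simp: r_def)
    \<comment> \<open>With this choice two errors of size \<open>\<tau>\<close> still leave a point
      at distance below \<open>\<epsilon>\<close> from \<open>\<mu> z\<close>, and there is only one
      such point in the fibre.\<close>
    define \<tau> where "\<tau> = min e ((\<epsilon> - dist (\<mu> y) r) / 2)"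
    have \<tau>: "\<tau> > 0" "\<tau> \<le> e" "dist (\<mu> y) r + 2 * \<tau> \<le> \<epsilon>" using e r(2) by (auto simp: \<tau>_def min_def field_simps)
    have "g' y \<in> topspace X" using g' y by (auto simp: continuous_map_def)
    from lower[OF this r(1) \<tau>(1)]
    obtain W' where W': "openin X W'" "g' y \<in> W'" "\<And>x'. x' \<in> W' \<Longrightarrow> \<exists>r'\<in>Sp x'. dist r r' < \<tau>" by blast
    have "(\<mu> \<longlongrightarrow> \<mu> y) (at y within D)" using \<mu> y by (auto simp: spsec_def continuous_on_def)
    then have 1: "\<forall>\<^sub>F z in at y within D. dist (\<mu> z) (\<mu> y) < \<tau>" using \<tau>(1) by (rule tendstoD)
    have 2: "\<forall>\<^sub>F z in at y within D. z \<in> D" by (auto simp: eventually_at_filter)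
    show "\<forall>\<^sub>F z in at y within D. dist (nearest (g' z) (\<mu> z)) (nearest (g' y) (\<mu> y)) < e"
      using 1 2 eventually_continuous_map[of D X g y W, OF g y W(1,2)] eventually_continuous_map[of D X g' y W, OF g' y W(1,3)]
        eventually_continuous_map[of D X g' y W', OF g' y W'(1,2)]
    proof eventually_elim
      case (elim z)
      obtain r' where r': "r' \<in> Sp (g' z)" "dist r r' < \<tau>" using W'(3)[OF elim(5)] by blast
      have "dist (\<mu> z) r' \<le> dist (\<mu> z) (\<mu> y) + dist (\<mu> y) r + dist r r'"
        using dist_triangle[of "\<mu> z" r' "\<mu> y"] dist_triangle[of "\<mu> y" r' r] by linarith
      then have "dist (\<mu> z) r' < \<epsilon>" using elim(1) r'(2) \<tau>(3) by linarith
      moreover have "\<mu> z \<in> Sp (g z)" using \<mu> elim(2) by (simp add: spsec_def)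
      ultimately have "r' = nearest (g' z) (\<mu> z)"
        using nearest_separated(3)[OF W(4) elim(3,4)] r'(1) by blast
      then show ?case using r'(2) \<tau>(2) by (simp add: r_def[symmetric] dist_commute)
    qed
  qed
  then show ?thesis using mem by (simp add: spsec_def continuous_on_def)
qed

text \<open>A Lebesgue number argument by sequences. If every subdivision failed, the failing pairs
  of consecutive times and endpoints would have a convergent subsequence; both times of a pair tend
  to the same limit, and a separated neighbourhood of the image of that limit contains both images
  for some late index.\<close>

lemma close_partition:
  assumes D: "compact_convex D" and f: "continuous_map (top_of_set D) X f" and a: "a \<in> D"
  obtains N :: nat where "N > 0" "\<And>k y. k < N \<Longrightarrow> y \<in> D \<Longrightarrow>
    close (f (seg a y (real k / N))) (f (seg a y (real (Suc k) / N)))"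
proof -
  have "\<exists>N. \<forall>k y. k < Suc N \<longrightarrow> y \<in> D \<longrightarrow>
    close (f (seg a y (real k / Suc N))) (f (seg a y (real (Suc k) / Suc N)))"
  proof (rule ccontr)
    assume "\<not> ?thesis"
    then have "\<forall>N. \<exists>k y. k < Suc N \<and> y \<in> D \<and>
      \<not> close (f (seg a y (real k / Suc N))) (f (seg a y (real (Suc k) / Suc N)))" by blast
    then obtain k y where ky: "\<And>N. k N < Suc N \<and> y N \<in> D \<and>
      \<not> close (f (seg a (y N) (real (k N) / Suc N))) (f (seg a (y N) (real (Suc (k N)) / Suc N)))" by metis
    define t where "t N = real (k N) / Suc N" for N
    define t' where "t' N = real (Suc (k N)) / Suc N" for N
    have t01: "t N \<in> {0..1}" "t' N \<in> {0..1}" "t' N = t N + inverse (real (Suc N))" for N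
      using ky[of N] by (auto simp: t_def t'_def field_simps)
    have "seq_compact ({0..1::real} \<times> D)"
      using compact_Times[OF compact_Icc compact_convex_compact[OF D]] compact_eq_seq_compact_metric by blast
    moreover have "\<forall>N. (t N, y N) \<in> {0..1} \<times> D" using t01 ky by auto
    ultimately have "\<exists>l\<in>{0..1} \<times> D. \<exists>r::nat\<Rightarrow>nat. strict_mono r \<and> ((\<lambda>N. (t N, y N)) \<circ> r) \<longlonglongrightarrow> l"
      unfolding seq_compact_def by (elim allE[of _ "\<lambda>N. (t N, y N)"]) simp
    then obtain l r where l: "l \<in> {0..1} \<times> D" "strict_mono (r::nat\<Rightarrow>nat)" "((\<lambda>N. (t N, y N)) \<circ> r) \<longlonglongrightarrow> l" by blast
    have lt: "(\<lambda>j. t (r j)) \<longlonglongrightarrow> fst l" and ly: "(\<lambda>j. y (r j)) \<longlonglongrightarrow> snd l"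
      using tendsto_fst[OF l(3)] tendsto_snd[OF l(3)] by (simp_all add: comp_def)
    have "(\<lambda>j. t (r j) + inverse (real (Suc (r j)))) \<longlonglongrightarrow> fst l + 0"
      using LIMSEQ_subseq_LIMSEQ[OF LIMSEQ_inverse_real_of_nat l(2)]
      by (intro tendsto_add lt) (simp add: comp_def)
    then have lt': "(\<lambda>j. t' (r j)) \<longlonglongrightarrow> fst l" by (simp add: t01(3))
    have sc: "continuous_on UNIV (\<lambda>p. seg a (snd p) (fst p))" by (intro continuous_intros)
    have lim: "limitin X (\<lambda>j. f (seg a (y (r j)) (u (r j)))) (f (seg a (snd l) (fst l))) sequentially"
      if u: "(\<lambda>j. u (r j)) \<longlonglongrightarrow> fst l" "\<And>N. u N \<in> {0..1}" for u
    proof (rule limitin_continuous_map_top_of_set[OF f])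
      show "seg a (y (r j)) (u (r j)) \<in> D" for j using ky[of "r j"] u(2)[of "r j"] by (intro seg_in[OF D a]) auto
      show "seg a (snd l) (fst l) \<in> D" using l(1) by (intro seg_in[OF D a]) auto
      show "(\<lambda>j. seg a (y (r j)) (u (r j))) \<longlonglongrightarrow> seg a (snd l) (fst l)"
        using continuous_on_tendsto_compose[OF sc tendsto_Pair[OF u(1) ly]] by simp
    qed
    let ?x = "f (seg a (snd l) (fst l))"
    have "?x \<in> topspace X" using limitin_topspace[OF lim[OF lt t01(1)]] .
    from separated_nbhd[OF this] obtain W \<epsilon> where W: "openin X W" "?x \<in> W" "0 < \<epsilon>" "separated W \<epsilon>" .
    have "\<forall>\<^sub>F j in sequentially. f (seg a (y (r j)) (t (r j))) \<in> W \<and> f (seg a (y (r j)) (t' (r j))) \<in> W"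
      using limitinD[OF lim[OF lt t01(1)] W(1,2)] limitinD[OF lim[OF lt' t01(2)] W(1,2)]
      by (rule eventually_conj)
    then obtain j where "f (seg a (y (r j)) (t (r j))) \<in> W" "f (seg a (y (r j)) (t' (r j))) \<in> W"
      using eventually_happens'[OF sequentially_bot] by blast
    then have "close (f (seg a (y (r j)) (t (r j)))) (f (seg a (y (r j)) (t' (r j))))"
      using W by (auto simp: close_def)
    then show False using ky[of "r j"] by (simp add: t_def t'_def)
  qed
  then obtain N where "\<forall>k y. k < Suc N \<longrightarrow> y \<in> D \<longrightarrow>
    close (f (seg a y (real k / Suc N))) (f (seg a y (real (Suc k) / Suc N)))" by blast
  then show thesis using that[of "Suc N"] by blast
qed

text \<open>Start with the constant \<open>r\<close> over the constant map to \<open>f a\<close> and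
  carry it outward along all segments from \<open>a\<close> simultaneously, one
  \<open>spsec_step\<close> per time step. The segment from \<open>a\<close> to itself is constant,
  so the value at \<open>a\<close> stays \<open>r\<close>.\<close>

lemma spsec_exists:
  assumes D: "compact_convex D" and f: "continuous_map (top_of_set D) X f" and a: "a \<in> D" and r: "r \<in> Sp (f a)"
  obtains \<mu> where "spsec D f \<mu>" "\<mu> a = r"
proof -
  obtain N :: nat where N: "N > 0" "\<And>k y. k < N \<Longrightarrow> y \<in> D \<Longrightarrow>
    close (f (seg a y (real k / N))) (f (seg a y (real (Suc k) / N)))"
    using close_partition[OF D f a] by blast
  have seg_aa: "seg a a t = a" for t by (simp add: seg_def algebra_simps)
  have cm: "continuous_map (top_of_set D) X (\<lambda>y. f (seg a y (real k / N)))" if "k \<le> N" for k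
    by (rule continuous_map_compose_top_of_set[OF f])
       (use that N(1) in \<open>auto intro!: continuous_intros seg_in[OF D a]\<close>)
  have "\<exists>\<mu>. spsec D (\<lambda>y. f (seg a y (real k / N))) \<mu> \<and> \<mu> a = r" if "k \<le> N" for k
    using that
  proof (induction k)
    case 0
    then show ?case using r by (intro exI[of _ "\<lambda>_. r"]) (simp add: spsec_def)
  next
    case (Suc k)
    then obtain \<mu> where \<mu>: "spsec D (\<lambda>y. f (seg a y (real k / N))) \<mu>" "\<mu> a = r" by auto
    have k: "k < N" "k \<le> N" using Suc.prems by auto
    have st: "spsec D (\<lambda>y. f (seg a y (real (Suc k) / N))) (\<lambda>y. nearest (f (seg a y (real (Suc k) / N))) (\<mu> y))"
      by (rule spsec_step[OF cm[OF k(2)] cm[OF Suc.prems] \<mu>(1) N(2)[OF k(1)]])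
    obtain W \<epsilon> where W: "f a \<in> W" "separated W \<epsilon>"
      using N(2)[OF k(1) a] by (auto simp: close_def seg_aa)
    have "0 < \<epsilon>" using nearest_separated(2)[OF W(2,1,1) r] zero_le_dist[of r "nearest (f a) r"] by linarith
    then have "nearest (f a) r = r" using nearest_separated(3)[OF W(2,1,1) r r] by simp
    then show ?case using st \<mu>(2)
      by (intro exI[of _ "\<lambda>y. nearest (f (seg a y (real (Suc k) / N))) (\<mu> y)"] conjI) (simp_all only: seg_aa)
  qed
  from this[of N] N(1) show thesis using that by auto
qed

text \<open>Agreement propagates locally: over a separated neighbourhood, two selections that agree
  at one point stay within \<open>\<epsilon>\<close> of a common value, and only one point of each
  fibre is that close.\<close>

lemma spsec_unique:
  assumes D: "connected D" and f: "continuous_map (top_of_set D) X f"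
    and \<mu>: "spsec D f \<mu>" and \<mu>': "spsec D f \<mu>'" and a: "a \<in> D" "\<mu> a = \<mu>' a" and b: "b \<in> D"
  shows "\<mu> b = \<mu>' b"
proof (rule connected_induction_simple[where P = "\<lambda>y. \<mu> y = \<mu>' y", OF D a(1) b a(2)])
  fix y assume y: "y \<in> D"
  then have "f y \<in> topspace X" using f by (auto simp: continuous_map_def)
  from separated_nbhd[OF this] obtain W \<epsilon> where W: "openin X W" "f y \<in> W" "0 < \<epsilon>" "separated W \<epsilon>" .
  define T where "T = {z \<in> D. f z \<in> W} \<inter> ((D \<inter> \<mu> -` ball (\<mu> y) (\<epsilon> / 2)) \<inter> (D \<inter> \<mu>' -` ball (\<mu>' y) (\<epsilon> / 2)))"
  have "openin (top_of_set D) T"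
    unfolding T_def
  proof (rule openin_Int[OF _ openin_Int])
    show "openin (top_of_set D) {z \<in> D. f z \<in> W}" using f W(1) by (simp add: continuous_map_def)
    show "openin (top_of_set D) (D \<inter> \<mu> -` ball (\<mu> y) (\<epsilon> / 2))"
      using \<mu> by (intro continuous_openin_preimage_gen) (auto simp: spsec_def)
    show "openin (top_of_set D) (D \<inter> \<mu>' -` ball (\<mu>' y) (\<epsilon> / 2))"
      using \<mu>' by (intro continuous_openin_preimage_gen) (auto simp: spsec_def)
  qed
  moreover have "y \<in> T" using y W by (simp add: T_def)
  moreover have "\<mu> w = \<mu>' w" if z: "z \<in> T" and w: "w \<in> T" and eq: "\<mu> z = \<mu>' z" for z w
  proof -
    have "dist (\<mu> z) (\<mu> w) < \<epsilon>"
      using z w dist_triangle3[of "\<mu> z" "\<mu> w" "\<mu> y"] by (auto simp: T_def)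
    moreover have "dist (\<mu> z) (\<mu>' w) < \<epsilon>"
      unfolding eq using z w dist_triangle3[of "\<mu>' z" "\<mu>' w" "\<mu>' y"] by (auto simp: T_def)
    moreover have zw: "f z \<in> W" "f w \<in> W" "\<mu> z \<in> Sp (f z)" "\<mu> w \<in> Sp (f w)" "\<mu>' w \<in> Sp (f w)"
      using z w \<mu> \<mu>' by (auto simp: T_def spsec_def)
    ultimately show ?thesis using nearest_separated(3)[OF W(4) zw(1,2,3)] zw(4,5) by metis
  qed
  ultimately show "\<exists>T. openin (top_of_set D) T \<and> y \<in> T \<and> (\<forall>z\<in>T. \<forall>w\<in>T. \<mu> z = \<mu>' z \<longrightarrow> \<mu> w = \<mu>' w)"
    by blast
qed

text \<open>\<open>lam r x\<close> continues the eigenvalue \<open>r\<close> over a base point along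
  a chosen path to \<open>x\<close>. The paths are chosen without any continuity in
  \<open>x\<close>; it is the compatibility \<open>along\<close> with arbitrary paths that makes
  \<open>lam r\<close> agree on each disk with one continuous selection.\<close>

lemma continuous_eigenvalues:
  assumes X: "CW_complex X" and sc: "simply_connected_space X"
  obtains l where "\<And>k. k < n \<Longrightarrow> continuous_map X euclidean (l k)"
    "\<And>x. x \<in> topspace X \<Longrightarrow> bij_betw (\<lambda>k. l k x) {..<n} (Sp x)"
proof (cases "topspace X = {}")
  case True
  then show thesis using that[of "\<lambda>_ _. 0"] by (simp add: continuous_map_def)
next
  case False
  then obtain x0 where x0: "x0 \<in> topspace X" by blast
  obtain E where "cw_structure X E" using X by (auto simp: CW_complex_def)
  then interpret cw_space X E by unfold_locales
  have "\<exists>p. pathin X p \<and> p 0 = x0 \<and> p 1 = x" if "x \<in> topspace X" for x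
    using sc that x0 by (simp add: simply_connected_space_def path_connected_space_def)
  then obtain p where p: "\<And>x. x \<in> topspace X \<Longrightarrow> pathin X (p x) \<and> p x 0 = x0 \<and> p x 1 = x" by metis
  have cI1: "connected I1" by (rule compact_convex_connected[OF compact_convex_standard_simplex])
  have path: "continuous_map (top_of_set I1) X (\<lambda>v. g (v 1))" if "pathin X g" for g
    by (rule continuous_map_compose_top_of_set[OF that[unfolded pathin_def]])
       (use I1_edge(2,3) in \<open>auto intro!: continuous_intros\<close>)
  define lam where "lam r x = (SOME c. \<exists>\<mu>. spsec I1 (\<lambda>v. p x (v 1)) \<mu> \<and> \<mu> (vtx 0) = r \<and> \<mu> (vtx 1) = c)" for r x
  have lam_eq: "lam r x = \<mu> (vtx 1)"
    if x: "x \<in> topspace X" and \<mu>: "spsec I1 (\<lambda>v. p x (v 1)) \<mu>" "\<mu> (vtx 0) = r" for r x \<mu>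
    unfolding lam_def
  proof (rule some_equality)
    fix c assume "\<exists>\<mu>. spsec I1 (\<lambda>v. p x (v 1)) \<mu> \<and> \<mu> (vtx 0) = r \<and> \<mu> (vtx 1) = c"
    then obtain \<mu>' where \<mu>': "spsec I1 (\<lambda>v. p x (v 1)) \<mu>'" "\<mu>' (vtx 0) = r" "\<mu>' (vtx 1) = c" by blast
    show "c = \<mu> (vtx 1)"
      using spsec_unique[OF cI1 path \<mu>'(1) \<mu>(1), of "vtx 0" "vtx 1"] p[OF x] \<mu>(2) \<mu>'(2,3) by simp
  qed (use \<mu> in blast)
  have lam_ex: "\<exists>\<mu>. spsec I1 (\<lambda>v. p x (v 1)) \<mu> \<and> \<mu> (vtx 0) = r \<and> \<mu> (vtx 1) = lam r x"
    if x: "x \<in> topspace X" and r: "r \<in> Sp x0" for r x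
  proof -
    have "vtx 0 \<in> I1" "r \<in> Sp (p x (vtx 0 1))" using r p[OF x] by (simp_all add: vtx_def)
    from spsec_exists[OF compact_convex_standard_simplex path[OF conjunct1[OF p[OF x]]] this]
    obtain \<mu> where \<mu>: "spsec I1 (\<lambda>v. p x (v 1)) \<mu>" "\<mu> (vtx 0) = r" using p[OF x] by blast
    then show ?thesis using lam_eq[OF x \<mu>] by auto
  qed
  have lam_Sp: "lam r x \<in> Sp x" if x: "x \<in> topspace X" and r: "r \<in> Sp x0" for r x
  proof -
    obtain \<mu> where \<mu>: "spsec I1 (\<lambda>v. p x (v 1)) \<mu>" "\<mu> (vtx 1) = lam r x" using lam_ex[OF x r] by blast
    have "\<mu> (vtx 1) \<in> Sp (p x (vtx 1 1))" using \<mu>(1) by (simp add: spsec_def)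
    then show ?thesis using \<mu>(2) p[OF x] by (simp add: vtx_def)
  qed
  \<comment> \<open>Monodromy: the two chosen paths and \<open>g\<close> bound a triangle, and a
    selection over the whole triangle restricts on its sides to the three continuations.\<close>
  have along: "\<mu> (vtx 1) = lam r (g 1)"
    if g: "pathin X g" and r: "r \<in> Sp x0" and \<mu>: "spsec I1 (\<lambda>v. g (v 1)) \<mu>" "\<mu> (vtx 0) = lam r (g 0)" for g r \<mu>
  proof -
    have gX: "g 0 \<in> topspace X" "g 1 \<in> topspace X"
      using g by (auto simp: pathin_def continuous_map_def)
    obtain \<sigma> where \<sigma>: "continuous_map (top_of_set I2) X \<sigma>"
      "\<And>t. t \<in> {0..1} \<Longrightarrow> \<sigma> (edge 0 1 t) = p (g 0) t"
      "\<And>t. t \<in> {0..1} \<Longrightarrow> \<sigma> (edge 1 2 t) = g t"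
      "\<And>t. t \<in> {0..1} \<Longrightarrow> \<sigma> (edge 0 2 t) = p (g 1) t"
      using simply_connected_triangle[OF sc, of "p (g 0)" g "p (g 1)"] p gX g by metis
    have v0: "vtx 0 \<in> I2" by simp
    have e0: "edge i j 0 = vtx i" "edge i j 1 = vtx j" for i j by (simp_all add: edge_def)
    have "\<sigma> (vtx 0) = x0" using \<sigma>(2)[of 0] p[OF gX(1)] by (simp add: e0)
    then obtain M where M: "spsec I2 \<sigma> M" "M (vtx 0) = r"
      using spsec_exists[OF compact_convex_standard_simplex \<sigma>(1) v0, of r] r by metis
    have ME: "spsec I1 (\<lambda>v. \<sigma> (edge i j (v 1))) (\<lambda>v. M (edge i j (v 1)))" if "i \<le> 2" "j \<le> 2" for i j
    proof (rule spsec_compose[OF M(1)])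
      show "continuous_on I1 (\<lambda>v. edge i j (v 1))" unfolding edge_def by (intro continuous_intros)
      show "(\<lambda>v. edge i j (v 1)) ` I1 \<subseteq> I2"
        unfolding edge_def using I1_edge(2,3) that
        by (auto intro!: seg_in compact_convex_standard_simplex)
    qed
    have M01: "spsec I1 (\<lambda>v. p (g 0) (v 1)) (\<lambda>v. M (edge 0 1 (v 1)))"
      by (rule spsec_cong[OF ME]) (use I1_edge(2,3) \<sigma>(2) in auto)
    have M02: "spsec I1 (\<lambda>v. p (g 1) (v 1)) (\<lambda>v. M (edge 0 2 (v 1)))"
      by (rule spsec_cong[OF ME]) (use I1_edge(2,3) \<sigma>(4) in auto)
    have M12: "spsec I1 (\<lambda>v. g (v 1)) (\<lambda>v. M (edge 1 2 (v 1)))"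
      by (rule spsec_cong[OF ME]) (use I1_edge(2,3) \<sigma>(3) in auto)
    have v: "vtx 0 1 = 0" "vtx 1 1 = 1" by (simp_all add: vtx_def)
    have 1: "lam r (g 0) = M (vtx 1)" using lam_eq[OF gX(1) M01] M(2) by (simp add: v e0)
    have 2: "lam r (g 1) = M (vtx 2)" using lam_eq[OF gX(2) M02] M(2) by (simp add: v e0)
    have "\<mu> (vtx 1) = M (edge 1 2 (vtx 1 1))"
      by (rule spsec_unique[OF cI1 path[OF g] \<mu>(1) M12, of "vtx 0"]) (simp_all add: v e0 \<mu>(2) 1)
    then show ?thesis using 2 by (simp add: v e0)
  qed
  have cont: "continuous_map X euclidean (lam r)" if r: "r \<in> Sp x0" for r
  proof (rule continuous_map_cellwise)
    fix m e assume e: "e \<in> E m"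
    show "continuous_on (cdisk m) (\<lambda>z. lam r (chr m e z))"
    proof (cases "cdisk m = {}")
      case False
      then obtain a where a: "a \<in> cdisk m" by auto
      have cX: "chr m e z \<in> topspace X" if "z \<in> cdisk m" for z
        using chr_cont[OF e] that by (auto simp: continuous_map_def)
      obtain M where M: "spsec (cdisk m) (chr m e) M" "M a = lam r (chr m e a)"
        using spsec_exists[OF compact_convex_cdisk chr_cont[OF e] a lam_Sp[OF cX[OF a] r]] .
      have "M y = lam r (chr m e y)" if y: "y \<in> cdisk m" for y
      proof -
        have sin: "seg a y t \<in> cdisk m" if "t \<in> {0..1}" for t
          using seg_in[OF compact_convex_cdisk a y] that by auto
        have "pathin X (\<lambda>t. chr m e (seg a y t))"
          unfolding pathin_def
          by (rule continuous_map_compose_top_of_set[OF chr_cont[OF e]])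
             (use sin in \<open>auto intro!: continuous_intros\<close>)
        moreover have "spsec I1 (\<lambda>v. chr m e (seg a y (v 1))) (\<lambda>v. M (seg a y (v 1)))"
          by (rule spsec_compose[OF M(1)]) (use sin I1_edge(2,3) in \<open>auto intro!: continuous_intros\<close>)
        ultimately have "M (seg a y (vtx 1 1)) = lam r (chr m e (seg a y 1))"
          by (rule along[OF _ r]) (simp add: vtx_def M(2))
        then show ?thesis by (simp add: vtx_def)
      qed
      moreover have "continuous_on (cdisk m) M" using M(1) by (simp add: spsec_def)
      ultimately show ?thesis by (rule continuous_on_eq[rotated])
    qed simp
  qed
  \<comment> \<open>Uniqueness used backwards: continuations that meet at the end of the path agree
    at its start.\<close>
  have inj: "inj_on (\<lambda>r. lam r x) (Sp x0)" if x: "x \<in> topspace X" for x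
  proof (rule inj_onI)
    fix r r' assume r: "r \<in> Sp x0" "r' \<in> Sp x0" "lam r x = lam r' x"
    obtain \<mu> where \<mu>: "spsec I1 (\<lambda>v. p x (v 1)) \<mu>" "\<mu> (vtx 0) = r" "\<mu> (vtx 1) = lam r x"
      using lam_ex[OF x r(1)] by blast
    obtain \<mu>' where \<mu>': "spsec I1 (\<lambda>v. p x (v 1)) \<mu>'" "\<mu>' (vtx 0) = r'" "\<mu>' (vtx 1) = lam r' x"
      using lam_ex[OF x r(2)] by blast
    show "r = r'"
      using spsec_unique[OF cI1 path \<mu>(1) \<mu>'(1), of "vtx 1" "vtx 0"] p[OF x] \<mu>(2,3) \<mu>'(2,3) r(3) by simp
  qed
  obtain h where h: "bij_betw h {..<n} (Sp x0)"
    using ex_bij_betw_nat_finite[OF finite_Sp[OF x0]] card_Sp[OF x0] by (metis lessThan_atLeast0)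
  show thesis
  proof (rule that[of "\<lambda>k. lam (h k)"])
    show "continuous_map X euclidean (lam (h k))" if "k < n" for k
      using cont h that by (auto simp: bij_betw_def)
    show "bij_betw (\<lambda>k. lam (h k) x) {..<n} (Sp x)" if x: "x \<in> topspace X" for x
    proof -
      have "card ((\<lambda>r. lam r x) ` Sp x0) = card (Sp x)"
        using card_image[OF inj[OF x]] card_Sp x x0 by simp
      moreover have "(\<lambda>r. lam r x) ` Sp x0 \<subseteq> Sp x" using lam_Sp[OF x] by auto
      ultimately have "bij_betw (\<lambda>r. lam r x) (Sp x0) (Sp x)"
        using inj[OF x] finite_Sp[OF x] by (intro bij_betw_imageI card_subset_eq) auto
      from bij_betw_trans[OF h this] show ?thesis by (simp add: comp_def)
    qed
  qed
qed

end

section \<open>Normal matrices with distinct eigenvalues\<close>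

lemma mult_entry:
  "A \<in> carrier_mat n n \<Longrightarrow> B \<in> carrier_mat n n \<Longrightarrow> i < n \<Longrightarrow> j < n \<Longrightarrow>
    (A * B) $$ (i, j) = (\<Sum>k<n. A $$ (i, k) * B $$ (k, j))"
  by (auto simp: scalar_prod_def lessThan_atLeast0)

lemma adjoint_entry:
  fixes A :: "complex mat"
  shows "A \<in> carrier_mat n n \<Longrightarrow> i < n \<Longrightarrow> j < n \<Longrightarrow> mat_adjoint A $$ (i, j) = cnj (A $$ (j, i))"
  unfolding mat_adjoint_def by (simp add: mat_of_rows_def)

lemma adjoint_carrier: "(A :: complex mat) \<in> carrier_mat n n \<Longrightarrow> mat_adjoint A \<in> carrier_mat n n"
  unfolding mat_adjoint_def by (auto simp: mat_of_rows_def)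

definition eigen :: "nat \<Rightarrow> complex mat \<Rightarrow> complex \<Rightarrow> (nat \<Rightarrow> complex) \<Rightarrow> bool" where
  "eigen n M r v \<longleftrightarrow> (\<forall>i<n. (\<Sum>j<n. M $$ (i, j) * v j) = r * v i)"

definition ip :: "nat \<Rightarrow> (nat \<Rightarrow> complex) \<Rightarrow> (nat \<Rightarrow> complex) \<Rightarrow> complex" where
  "ip n v w = (\<Sum>i<n. v i * cnj (w i))"

lemma ip_self: "ip n v v = complex_of_real (\<Sum>i<n. (cmod (v i))\<^sup>2)"
  by (simp only: ip_def of_real_sum complex_norm_square)

lemma ip_self_eq_0: "ip n v v = 0 \<Longrightarrow> i < n \<Longrightarrow> v i = 0"
  unfolding ip_self of_real_eq_0_iff by (simp add: sum_nonneg_eq_0_iff)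

lemma spectrum_unit_eigenvector:
  assumes M: "M \<in> carrier_mat n n" and r: "r \<in> spectrum M"
  obtains v where "eigen n M r v" "ip n v v = 1"
proof -
  obtain w where w: "w \<in> carrier_vec n" "w \<noteq> 0\<^sub>v n" "M *\<^sub>v w = r \<cdot>\<^sub>v w"
    using r M by (auto simp: spectrum_def eigenvalue_def eigenvector_def)
  have e: "(\<Sum>j<n. M $$ (i, j) * w $ j) = r * w $ i" if "i < n" for i
  proof -
    have "(M *\<^sub>v w) $ i = (\<Sum>j<n. M $$ (i, j) * w $ j)"
      using M w(1) that by (auto simp: scalar_prod_def lessThan_atLeast0)
    then show ?thesis using w that by simp
  qed
  define c where "c = (\<Sum>i<n. (cmod (w $ i))\<^sup>2)"
  have "c \<noteq> 0"
  proof
    assume "c = 0"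
    then have "w $ i = 0" if "i < n" for i using that by (simp add: c_def sum_nonneg_eq_0_iff)
    then have "w = 0\<^sub>v n" using w(1) by (intro eq_vecI) auto
    then show False using w(2) by simp
  qed
  moreover have "c \<ge> 0" by (simp add: c_def sum_nonneg)
  ultimately have c: "c > 0" by simp
  define v where "v i = w $ i / complex_of_real (sqrt c)" for i
  have "eigen n M r v"
    unfolding eigen_def v_def using e by (simp flip: sum_divide_distrib)
  moreover have "ip n v v = 1"
    unfolding ip_self using c
    by (simp add: v_def norm_divide power_divide c_def flip: sum_divide_distrib)
  ultimately show thesis using that by blast
qed

text \<open>Both sides expand to the quadratic form of \<open>v\<close>, once with \<open>b\<close>
  times its adjoint and once with the factors in the other order.\<close>

lemma normal_adjoint_norm:
  assumes "\<And>i j. i < n \<Longrightarrow> j < n \<Longrightarrow> (\<Sum>k<n. b i k * cnj (b j k)) = (\<Sum>k<n. cnj (b k i) * b k j)"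
  shows "ip n (\<lambda>i. \<Sum>j<n. cnj (b j i) * v j) (\<lambda>i. \<Sum>j<n. cnj (b j i) * v j) =
    ip n (\<lambda>i. \<Sum>j<n. b i j * v j) (\<lambda>i. \<Sum>j<n. b i j * v j)"
proof -
  have "ip n (\<lambda>i. \<Sum>j<n. cnj (b j i) * v j) (\<lambda>i. \<Sum>j<n. cnj (b j i) * v j) =
      (\<Sum>i<n. \<Sum>j<n. \<Sum>k<n. v j * cnj (v k) * (b k i * cnj (b j i)))"
    by (simp add: ip_def sum_product mult_ac)
  also have "\<dots> = (\<Sum>j<n. \<Sum>i<n. \<Sum>k<n. v j * cnj (v k) * (b k i * cnj (b j i)))"
    by (rule sum.swap)
  also have "\<dots> = (\<Sum>j<n. \<Sum>k<n. \<Sum>i<n. v j * cnj (v k) * (b k i * cnj (b j i)))"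
    by (intro sum.cong refl sum.swap)
  also have "\<dots> = (\<Sum>j<n. \<Sum>k<n. v j * cnj (v k) * (\<Sum>i<n. b k i * cnj (b j i)))"
    by (simp add: sum_distrib_left)
  also have "\<dots> = (\<Sum>j<n. \<Sum>k<n. v j * cnj (v k) * (\<Sum>i<n. cnj (b i k) * b i j))"
    by (intro sum.cong refl) (simp add: assms)
  also have "\<dots> = (\<Sum>j<n. \<Sum>k<n. \<Sum>i<n. v j * cnj (v k) * (cnj (b i k) * b i j))"
    by (simp add: sum_distrib_left)
  also have "\<dots> = (\<Sum>j<n. \<Sum>i<n. \<Sum>k<n. v j * cnj (v k) * (cnj (b i k) * b i j))"
    by (intro sum.cong refl sum.swap)
  also have "\<dots> = (\<Sum>i<n. \<Sum>j<n. \<Sum>k<n. v j * cnj (v k) * (cnj (b i k) * b i j))"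
    by (rule sum.swap)
  also have "\<dots> = ip n (\<lambda>i. \<Sum>j<n. b i j * v j) (\<lambda>i. \<Sum>j<n. b i j * v j)"
    by (simp add: ip_def sum_product mult_ac)
  finally show ?thesis .
qed

text \<open>With \<open>M\<close> also \<open>b = M - r\<close> is normal. It kills
  \<open>v\<close>, so by equality of norms its adjoint kills \<open>v\<close> as well.\<close>

lemma normal_adjoint_eigen:
  assumes M: "M \<in> carrier_mat n n" "M * mat_adjoint M = mat_adjoint M * M" and v: "eigen n M r v" and i: "i < n"
  shows "(\<Sum>j<n. cnj (M $$ (j, i)) * v j) = cnj r * v i"
proof -
  define b where "b i j = M $$ (i, j) - (if i = j then r else 0)" for i j
  have N: "(\<Sum>k<n. M $$ (i, k) * cnj (M $$ (j, k))) = (\<Sum>k<n. cnj (M $$ (k, i)) * M $$ (k, j))"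
    if "i < n" "j < n" for i j
    using arg_cong[OF M(2), of "\<lambda>A. A $$ (i, j)"] that adjoint_carrier[OF M(1)]
    by (simp add: mult_entry[OF M(1) adjoint_carrier[OF M(1)]] mult_entry[OF adjoint_carrier[OF M(1)] M(1)]
        adjoint_entry[OF M(1)])
  have bN: "(\<Sum>k<n. b i k * cnj (b j k)) = (\<Sum>k<n. cnj (b k i) * b k j)" if ij: "i < n" "j < n" for i j
  proof -
    have "(\<Sum>k<n. b i k * cnj (b j k)) = (\<Sum>k<n. M $$ (i, k) * cnj (M $$ (j, k)))
        - r * cnj (M $$ (j, i)) - cnj r * M $$ (i, j) + (if i = j then r * cnj r else 0)"
    proof -
      have "b i k * cnj (b j k) = M $$ (i, k) * cnj (M $$ (j, k)) - (if k = i then r * cnj (M $$ (j, k)) else 0)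
          - (if k = j then cnj r * M $$ (i, k) else 0) + (if k = i then if i = j then r * cnj r else 0 else 0)" for k
        by (auto simp: b_def algebra_simps)
      then show ?thesis using ij by (simp add: sum.distrib sum_subtractf)
    qed
    moreover have "(\<Sum>k<n. cnj (b k i) * b k j) = (\<Sum>k<n. cnj (M $$ (k, i)) * M $$ (k, j))
        - r * cnj (M $$ (j, i)) - cnj r * M $$ (i, j) + (if i = j then r * cnj r else 0)"
    proof -
      have "cnj (b k i) * b k j = cnj (M $$ (k, i)) * M $$ (k, j) - (if k = j then r * cnj (M $$ (k, i)) else 0)
          - (if k = i then cnj r * M $$ (k, j) else 0) + (if k = i then if i = j then r * cnj r else 0 else 0)" for k
        by (auto simp: b_def algebra_simps)
      then show ?thesis using ij by (simp add: sum.distrib sum_subtractf)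
    qed
    ultimately show ?thesis using N[OF ij] by simp
  qed
  have split_b: "(\<Sum>j<n. b i j * v j) = (\<Sum>j<n. M $$ (i, j) * v j) - r * v i" if "i < n" for i
  proof -
    have "b i j * v j = M $$ (i, j) * v j - (if j = i then r * v j else 0)" for j
      by (auto simp: b_def algebra_simps)
    then show ?thesis using that by (simp add: sum_subtractf)
  qed
  have split_a: "(\<Sum>j<n. cnj (b j i) * v j) = (\<Sum>j<n. cnj (M $$ (j, i)) * v j) - cnj r * v i"
  proof -
    have "cnj (b j i) * v j = cnj (M $$ (j, i)) * v j - (if j = i then cnj r * v j else 0)" for j
      by (auto simp: b_def algebra_simps)
    then show ?thesis using i by (simp add: sum_subtractf)
  qed
  have "ip n (\<lambda>i. \<Sum>j<n. b i j * v j) (\<lambda>i. \<Sum>j<n. b i j * v j) = 0"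
    using v split_b by (simp add: ip_def eigen_def)
  then have "ip n (\<lambda>i. \<Sum>j<n. cnj (b j i) * v j) (\<lambda>i. \<Sum>j<n. cnj (b j i) * v j) = 0"
    using normal_adjoint_norm[of n b v] bN by simp
  from ip_self_eq_0[OF this i] show ?thesis using split_a by simp
qed

text \<open>Moving \<open>M\<close> to the other side of the inner product as its adjoint, which
  acts on \<open>u\<close> by the conjugate of \<open>r'\<close>. Thus \<open>M - r\<close>
  multiplies the coefficient along \<open>u\<close> by \<open>r' - r\<close>; orthogonality, the
  eigenvalue estimate and the Lagrange projections all rest on this.\<close>

lemma normal_shift_ip:
  assumes M: "M \<in> carrier_mat n n" "M * mat_adjoint M = mat_adjoint M * M" and u: "eigen n M r' u"
  shows "ip n (\<lambda>i. (\<Sum>j<n. M $$ (i, j) * v j) - r * v i) u = (r' - r) * ip n v u"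
proof -
  have "ip n (\<lambda>i. \<Sum>j<n. M $$ (i, j) * v j) u = (\<Sum>i<n. \<Sum>j<n. v j * (M $$ (i, j) * cnj (u i)))"
    by (simp add: ip_def sum_distrib_left sum_distrib_right mult_ac)
  also have "\<dots> = (\<Sum>j<n. \<Sum>i<n. v j * (M $$ (i, j) * cnj (u i)))" by (rule sum.swap)
  also have "\<dots> = (\<Sum>j<n. v j * cnj (\<Sum>i<n. cnj (M $$ (i, j)) * u i))"
    by (simp add: sum_distrib_left)
  also have "\<dots> = (\<Sum>j<n. v j * cnj (cnj r' * u j))"
    by (intro sum.cong refl) (simp only: normal_adjoint_eigen[OF M u] lessThan_iff)
  also have "\<dots> = r' * ip n v u" by (simp add: ip_def sum_distrib_left mult_ac)
  finally have "ip n (\<lambda>i. \<Sum>j<n. M $$ (i, j) * v j) u = r' * ip n v u" .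
  moreover have "ip n (\<lambda>i. f i - r * v i) u = ip n f u - r * ip n v u" for f
    by (simp add: ip_def left_diff_distrib sum_subtractf sum_distrib_left mult.assoc)
  ultimately show ?thesis by (simp add: left_diff_distrib)
qed

section \<open>Orthonormal eigenbases of a normal matrix\<close>

definition eigenbasis :: "nat \<Rightarrow> complex mat \<Rightarrow> (nat \<Rightarrow> complex) \<Rightarrow> (nat \<Rightarrow> nat \<Rightarrow> complex) \<Rightarrow> bool" where
  "eigenbasis n M l u \<longleftrightarrow> (\<forall>k<n. eigen n M (l k) (u k) \<and> ip n (u k) (u k) = 1)"

context
  fixes n M l u
  assumes M: "M \<in> carrier_mat n n" "M * mat_adjoint M = mat_adjoint M * M"
    and l: "inj_on l {..<n}" and u: "eigenbasis n M l u"
begin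

lemma eigenbasis_orthonormal: "k < n \<Longrightarrow> q < n \<Longrightarrow> ip n (u k) (u q) = (if k = q then 1 else 0)"
proof -
  assume kq: "k < n" "q < n"
  have "ip n (\<lambda>i. (\<Sum>j<n. M $$ (i, j) * u k j) - l k * u k i) (u q) = (l q - l k) * ip n (u k) (u q)"
    using u kq by (intro normal_shift_ip[OF M]) (simp add: eigenbasis_def)
  moreover have "ip n (\<lambda>i. (\<Sum>j<n. M $$ (i, j) * u k j) - l k * u k i) (u q) = 0"
    using u kq by (simp add: ip_def eigenbasis_def eigen_def)
  ultimately have "l q = l k \<or> ip n (u k) (u q) = 0" by simp
  then show ?thesis
    using l kq u by (auto simp: inj_on_def eigenbasis_def)
qed

text \<open>Orthonormality says that the matrix with columns \<open>u k\<close> has its adjoint as a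
  left inverse; for square matrices it is a right inverse too.\<close>

lemma eigenbasis_complete: "i < n \<Longrightarrow> j < n \<Longrightarrow> (\<Sum>k<n. u k i * cnj (u k j)) = (if i = j then 1 else 0)"
proof -
  assume ij: "i < n" "j < n"
  define V where "V = mat n n (\<lambda>(i, k). u k i)"
  have V: "V \<in> carrier_mat n n" by (simp add: V_def)
  have "mat_adjoint V * V = 1\<^sub>m n"
  proof (rule eq_matI)
    fix a b assume "a < dim_row (1\<^sub>m n :: complex mat)" "b < dim_col (1\<^sub>m n :: complex mat)"
    then have ab: "a < n" "b < n" by auto
    then show "(mat_adjoint V * V) $$ (a, b) = 1\<^sub>m n $$ (a, b)"
      using eigenbasis_orthonormal[of b a]
      by (simp add: mult_entry[OF adjoint_carrier[OF V] V] adjoint_entry[OF V]) (auto simp: V_def ip_def mult.commute)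
  qed (use adjoint_carrier[OF V] V in auto)
  from mat_mult_left_right_inverse[OF adjoint_carrier[OF V] V this]
  have "(V * mat_adjoint V) $$ (i, j) = 1\<^sub>m n $$ (i, j)" by simp
  then show ?thesis
    using ij by (simp add: mult_entry[OF V adjoint_carrier[OF V]] adjoint_entry[OF V]) (auto simp: V_def)
qed

lemma eigenbasis_expand:
  assumes "i < n" shows "v i = (\<Sum>k<n. ip n v (u k) * u k i)"
proof -
  have "(\<Sum>k<n. ip n v (u k) * u k i) = (\<Sum>k<n. \<Sum>j<n. v j * (u k i * cnj (u k j)))"
    by (simp add: ip_def sum_distrib_left sum_distrib_right mult_ac)
  also have "\<dots> = (\<Sum>j<n. \<Sum>k<n. v j * (u k i * cnj (u k j)))" by (rule sum.swap)
  also have "\<dots> = (\<Sum>j<n. v j * (\<Sum>k<n. u k i * cnj (u k j)))" by (simp add: sum_distrib_left)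
  also have "\<dots> = (\<Sum>j<n. if i = j then v j else 0)"
    by (intro sum.cong refl) (simp add: eigenbasis_complete assms)
  also have "\<dots> = v i" using assms by simp
  finally show ?thesis by simp
qed

lemma eigenbasis_parseval: "ip n v v = (\<Sum>k<n. ip n v (u k) * cnj (ip n v (u k)))"
proof -
  have "ip n v v = (\<Sum>i<n. (\<Sum>k<n. ip n v (u k) * u k i) * cnj (v i))"
    unfolding ip_def[of n v v] by (intro sum.cong refl) (simp flip: eigenbasis_expand)
  also have "\<dots> = (\<Sum>i<n. \<Sum>k<n. ip n v (u k) * (u k i * cnj (v i)))"
    by (simp add: sum_distrib_left sum_distrib_right mult_ac)
  also have "\<dots> = (\<Sum>k<n. \<Sum>i<n. ip n v (u k) * (u k i * cnj (v i)))" by (rule sum.swap)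
  also have "\<dots> = (\<Sum>k<n. ip n v (u k) * cnj (ip n v (u k)))"
    by (simp add: ip_def[of n v] sum_distrib_left mult_ac)
  finally show ?thesis .
qed

text \<open>In the eigenbasis the squared norm of the residual is the average of the squared
  distances from \<open>r\<close> to the eigenvalues, weighted by the squared coefficients of
  \<open>v\<close>, which sum to 1. It cannot be smaller than all these squared distances.\<close>

lemma eigenvalue_near:
  assumes v: "ip n v v = 1" and "0 < \<tau>"
    and small: "(\<Sum>i<n. (cmod ((\<Sum>j<n. M $$ (i, j) * v j) - r * v i))\<^sup>2) < \<tau>\<^sup>2"
  obtains k where "k < n" "dist r (l k) < \<tau>"
proof -
  define w where "w i = (\<Sum>j<n. M $$ (i, j) * v j) - r * v i" for i
  have "ip n w (u k) = (l k - r) * ip n v (u k)" if "k < n" for k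
    unfolding w_def using u that by (intro normal_shift_ip[OF M]) (simp add: eigenbasis_def)
  moreover have "(a * b) * cnj (a * b) = complex_of_real ((cmod a)\<^sup>2 * (cmod b)\<^sup>2)" for a b
    by (simp only: of_real_mult complex_norm_square complex_cnj_mult mult_ac)
  ultimately have "ip n w w = complex_of_real (\<Sum>k<n. (cmod (l k - r))\<^sup>2 * (cmod (ip n v (u k)))\<^sup>2)"
    unfolding eigenbasis_parseval[of w] of_real_sum by (intro sum.cong refl) (simp only: lessThan_iff)
  then have w: "(\<Sum>i<n. (cmod (w i))\<^sup>2) = (\<Sum>k<n. (cmod (l k - r))\<^sup>2 * (cmod (ip n v (u k)))\<^sup>2)"
    unfolding ip_self of_real_eq_iff .
  have "complex_of_real (\<Sum>k<n. (cmod (ip n v (u k)))\<^sup>2) = 1"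
    using v unfolding eigenbasis_parseval[of v] by (simp only: of_real_sum complex_norm_square)
  then have one: "(\<Sum>k<n. (cmod (ip n v (u k)))\<^sup>2) = 1" by (simp only: of_real_eq_1_iff)
  have "\<exists>k<n. dist r (l k) < \<tau>"
  proof (rule ccontr)
    assume "\<not> ?thesis"
    then have "\<tau> \<le> cmod (l k - r)" if "k < n" for k
      using that by (metis dist_norm norm_minus_commute not_less)
    then have "\<tau>\<^sup>2 \<le> (cmod (l k - r))\<^sup>2" if "k < n" for k
      using that \<open>0 < \<tau>\<close> by (intro power_mono) auto
    then have "(\<Sum>k<n. \<tau>\<^sup>2 * (cmod (ip n v (u k)))\<^sup>2) \<le> (\<Sum>k<n. (cmod (l k - r))\<^sup>2 * (cmod (ip n v (u k)))\<^sup>2)"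
      by (intro sum_mono mult_right_mono) auto
    then show False using small w one by (simp add: w_def flip: sum_distrib_left)
  qed
  then show thesis using that by blast
qed

end

section \<open>Matrices of continuous functions\<close>

lemma continuous_map_complex_mult:
  fixes f g :: "'a \<Rightarrow> complex"
  shows "continuous_map X euclidean f \<Longrightarrow> continuous_map X euclidean g \<Longrightarrow> continuous_map X euclidean (\<lambda>x. f x * g x)"
  by (simp add: continuous_map_atin tendsto_mult)

lemma continuous_map_complex_divide:
  fixes f g :: "'a \<Rightarrow> complex"
  shows "continuous_map X euclidean f \<Longrightarrow> continuous_map X euclidean g \<Longrightarrow> (\<And>x. x \<in> topspace X \<Longrightarrow> g x \<noteq> 0) \<Longrightarrow>
    continuous_map X euclidean (\<lambda>x. f x / g x)"
  by (simp add: continuous_map_atin tendsto_divide)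

lemma continuous_map_complex_cnj:
  "continuous_map X euclidean f \<Longrightarrow> continuous_map X euclidean (\<lambda>x. cnj (f x))"
  by (simp add: continuous_map_atin tendsto_cnj)

lemma cmat_carrier: "A \<in> cmat X n \<Longrightarrow> x \<in> topspace X \<Longrightarrow> A x \<in> carrier_mat n n"
  by (simp add: cmat_def)

lemma cmat_entry: "A \<in> cmat X n \<Longrightarrow> i < n \<Longrightarrow> j < n \<Longrightarrow> continuous_map X euclidean (\<lambda>x. A x $$ (i, j))"
  by (simp add: cmat_def)

lemma cmat_mult:
  assumes "A \<in> cmat X n" "B \<in> cmat X n" shows "(\<lambda>x. A x * B x) \<in> cmat X n"
proof -
  have "continuous_map X euclidean (\<lambda>x. (A x * B x) $$ (i, j))" if ij: "i < n" "j < n" for i j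
  proof (rule continuous_map_eq)
    show "continuous_map X euclidean (\<lambda>x. \<Sum>k<n. A x $$ (i, k) * B x $$ (k, j))"
      by (intro continuous_map_sum continuous_map_complex_mult cmat_entry[OF assms(1)] cmat_entry[OF assms(2)])
         (use ij in auto)
    show "(\<Sum>k<n. A x $$ (i, k) * B x $$ (k, j)) = (A x * B x) $$ (i, j)" if "x \<in> topspace X" for x
      by (rule mult_entry[OF cmat_carrier[OF assms(1) that] cmat_carrier[OF assms(2) that] ij, symmetric])
  qed
  moreover have "A x * B x \<in> carrier_mat n n" if "x \<in> topspace X" for x
    by (rule mult_carrier_mat[OF cmat_carrier[OF assms(1) that] cmat_carrier[OF assms(2) that]])
  ultimately show ?thesis by (simp add: cmat_def)
qed

lemma cmat_adjoint:
  assumes "A \<in> cmat X n" shows "(\<lambda>x. mat_adjoint (A x)) \<in> cmat X n"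
proof -
  have "continuous_map X euclidean (\<lambda>x. mat_adjoint (A x) $$ (i, j))" if ij: "i < n" "j < n" for i j
    by (rule continuous_map_eq[OF continuous_map_complex_cnj[OF cmat_entry[OF assms ij(2,1)]]])
       (simp add: adjoint_entry[OF cmat_carrier[OF assms] ij])
  then show ?thesis using adjoint_carrier[OF cmat_carrier[OF assms]] by (simp add: cmat_def)
qed

lemma adjoint_mult:
  assumes A: "(A :: complex mat) \<in> carrier_mat n n" and B: "B \<in> carrier_mat n n"
  shows "mat_adjoint (A * B) = mat_adjoint B * mat_adjoint A"
proof (rule eq_matI)
  note c = adjoint_carrier[OF A] adjoint_carrier[OF B]
  note AB = mult_carrier_mat[OF A B]
  fix i j assume "i < dim_row (mat_adjoint B * mat_adjoint A)" "j < dim_col (mat_adjoint B * mat_adjoint A)"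
  then have ij: "i < n" "j < n" using c by auto
  then show "mat_adjoint (A * B) $$ (i, j) = (mat_adjoint B * mat_adjoint A) $$ (i, j)"
    by (simp add: adjoint_entry[OF AB] mult_entry[OF A B] mult_entry[OF c(2,1)] adjoint_entry[OF A] adjoint_entry[OF B]
        mult.commute)
qed (use adjoint_carrier[OF A] adjoint_carrier[OF B] adjoint_carrier[OF mult_carrier_mat[OF A B]] in auto)

lemma adjoint_adjoint:
  assumes A: "(A :: complex mat) \<in> carrier_mat n n"
  shows "mat_adjoint (mat_adjoint A) = A"
  by (rule eq_matI) (use A adjoint_carrier[OF A] adjoint_carrier[OF adjoint_carrier[OF A]] in
    \<open>auto simp: adjoint_entry[OF adjoint_carrier[OF A]] adjoint_entry[OF A]\<close>)

lemma eigenbasis_exists: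
  assumes M: "M \<in> carrier_mat n n" and l: "\<And>k. k < n \<Longrightarrow> l k \<in> spectrum M"
  obtains u where "eigenbasis n M l u"
proof -
  have "\<exists>v. eigen n M (l k) v \<and> ip n v v = 1" if "k < n" for k
    using spectrum_unit_eigenvector[OF M l[OF that]] by blast
  then obtain u where "\<And>k. k < n \<Longrightarrow> eigen n M (l k) (u k) \<and> ip n (u k) (u k) = 1" by metis
  then have "eigenbasis n M l u" by (simp add: eigenbasis_def)
  then show thesis by (rule that)
qed

text \<open>Freeze a unit eigenvector \<open>v\<close> at \<open>x\<close>. Its residual
  \<open>d\<close> is continuous in the point and zero at \<open>x\<close>, so
  \<open>eigenvalue_near\<close> provides an eigenvalue close to \<open>r\<close> at all nearby
  points.\<close>

lemma continuous_spectra_normal: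
  assumes A: "A \<in> cmat X n" "normal_cmat X A" "multiplicity_free X n A"
  shows "continuous_spectra X n (\<lambda>x. spectrum (A x))"
proof
  fix x assume x: "x \<in> topspace X"
  have fin: "finite (spectrum (A x))" if "x \<in> topspace X" for x
    using card_finite_spectrum(1)[OF cmat_carrier[OF A(1) that]] .
  have card: "card (spectrum (A x)) = n" if "x \<in> topspace X" for x
    using A(3) that by (simp add: multiplicity_free_def)
  show "finite (spectrum (A x))" "card (spectrum (A x)) = n" using fin card x by auto
  fix r and \<tau> :: real assume r: "r \<in> spectrum (A x)" and \<tau>: "0 < \<tau>"
  obtain v where v: "eigen n (A x) r v" "ip n v v = 1"
    using spectrum_unit_eigenvector[OF cmat_carrier[OF A(1) x] r] .
  define d where "d x = (\<Sum>i<n. (cmod ((\<Sum>j<n. A x $$ (i, j) * v j) - r * v i))\<^sup>2)" for x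
  have "continuous_map X euclidean d"
    unfolding d_def
    by (intro continuous_map_sum continuous_map_real_pow continuous_map_norm continuous_map_diff
        continuous_map_complex_mult cmat_entry[OF A(1)] continuous_map_canonical_const) auto
  then have "openin X {x \<in> topspace X. d x \<in> {..<\<tau>\<^sup>2}}"
    by (rule openin_continuous_map_preimage) simp
  moreover have "d x = 0" using v(1) by (simp add: d_def eigen_def)
  moreover have "\<exists>r'\<in>spectrum (A x'). dist r r' < \<tau>" if x': "x' \<in> topspace X" "d x' < \<tau>\<^sup>2" for x'
  proof -
    obtain l where l: "bij_betw l {..<n} (spectrum (A x'))"
      using ex_bij_betw_nat_finite[OF fin[OF x'(1)]] card[OF x'(1)] by (metis lessThan_atLeast0)
    then have lS: "l k \<in> spectrum (A x')" if "k < n" for k using that by (auto simp: bij_betw_def)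
    obtain u where u: "eigenbasis n (A x') l u"
      using eigenbasis_exists[OF cmat_carrier[OF A(1) x'(1)] lS] .
    have N: "A x' * mat_adjoint (A x') = mat_adjoint (A x') * A x'"
      using A(2) x'(1) by (simp add: normal_cmat_def)
    obtain k where "k < n" "dist r (l k) < \<tau>"
      using eigenvalue_near[OF cmat_carrier[OF A(1) x'(1)] N bij_betw_imp_inj_on[OF l] u v(2) \<tau>] x'(2)
      unfolding d_def by blast
    then show ?thesis using lS by blast
  qed
  ultimately show "\<exists>W. openin X W \<and> x \<in> W \<and> (\<forall>x'\<in>W. \<exists>r'\<in>spectrum (A x'). dist r r' < \<tau>)"
    using x \<tau> by (intro exI[of _ "{x \<in> topspace X. d x \<in> {..<\<tau>\<^sup>2}}"]) auto
qed

text \<open>The projection onto an eigenline is the Lagrange polynomial \<open>\<Prod>\<^sub>j (A - l j) / (l k - l j)\<close>.\<close>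

lemma eigenprojection_continuous:
  assumes A: "A \<in> cmat X n" "normal_cmat X A"
    and l: "\<And>k. k < n \<Longrightarrow> continuous_map X euclidean (l k)" "\<And>x. x \<in> topspace X \<Longrightarrow> inj_on (\<lambda>k. l k x) {..<n}"
    and u: "\<And>x. x \<in> topspace X \<Longrightarrow> eigenbasis n (A x) (\<lambda>k. l k x) (u x)"
    and k: "k < n" and im: "i < n" "m < n"
  shows "continuous_map X euclidean (\<lambda>x. u x k i * cnj (u x k m))"
proof -
  have N: "A x * mat_adjoint (A x) = mat_adjoint (A x) * A x" if "x \<in> topspace X" for x
    using A(2) that by (simp add: normal_cmat_def)
  have nz: "l k x - l j x \<noteq> 0" if "x \<in> topspace X" "j < n" "j \<noteq> k" for x j
    using l(2)[OF that(1)] that k by (auto simp: inj_on_def)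
  \<comment> \<open>\<open>R x\<close> is the partial Lagrange product applied to the
    \<open>m\<close>-th unit vector. It is built from continuous entries and described by its
    coefficients in the eigenbasis; each factor scales the \<open>q\<close>-th one. After all
    factors only \<open>q = k\<close> survives, leaving the \<open>m\<close>-th column of the
    projection.\<close>
  have lagrange: "\<exists>R. (\<forall>i<n. continuous_map X euclidean (\<lambda>x. R x i)) \<and>
      (\<forall>x\<in>topspace X. \<forall>q<n. ip n (R x) (u x q) = (\<Prod>j\<leftarrow>js. (l q x - l j x) / (l k x - l j x)) * cnj (u x q m))"
    if "set js \<subseteq> {..<n} - {k}" for js
    using that
  proof (induction js)
    case Nil
    have "ip n (\<lambda>i. if i = m then 1 else 0) (u x q) = cnj (u x q m)" for x q
      using im by (simp add: ip_def if_distrib[of "\<lambda>a. a * _"] cong: if_cong)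
    then show ?case by (intro exI[of _ "\<lambda>x i. if i = m then 1 else 0"]) simp
  next
    case (Cons j js)
    then obtain R where R: "\<And>i. i < n \<Longrightarrow> continuous_map X euclidean (\<lambda>x. R x i)"
      "\<And>x q. x \<in> topspace X \<Longrightarrow> q < n \<Longrightarrow>
        ip n (R x) (u x q) = (\<Prod>j\<leftarrow>js. (l q x - l j x) / (l k x - l j x)) * cnj (u x q m)" by auto
    have j: "j < n" "j \<noteq> k" using Cons.prems by auto
    define R' where "R' x i = ((\<Sum>p<n. A x $$ (i, p) * R x p) - l j x * R x i) / (l k x - l j x)" for x i
    have "continuous_map X euclidean (\<lambda>x. R' x i)" if "i < n" for i
      unfolding R'_def using nz j k that
      by (intro continuous_map_complex_divide continuous_map_diff continuous_map_sum
          continuous_map_complex_mult cmat_entry[OF A(1)] l(1) R(1)) auto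
    moreover have "ip n (R' x) (u x q) = (\<Prod>j\<leftarrow>j # js. (l q x - l j x) / (l k x - l j x)) * cnj (u x q m)"
      if x: "x \<in> topspace X" and q: "q < n" for x q
    proof -
      have "ip n (\<lambda>i. (\<Sum>p<n. A x $$ (i, p) * R x p) - l j x * R x i) (u x q) = (l q x - l j x) * ip n (R x) (u x q)"
        using u[OF x] q by (intro normal_shift_ip[OF cmat_carrier[OF A(1) x] N[OF x]]) (simp add: eigenbasis_def)
      moreover have "ip n (R' x) (u x q) =
          ip n (\<lambda>i. (\<Sum>p<n. A x $$ (i, p) * R x p) - l j x * R x i) (u x q) / (l k x - l j x)"
        by (simp add: ip_def R'_def sum_divide_distrib)
      ultimately show ?thesis by (simp add: R(2)[OF x q])
    qed
    ultimately show ?case by (intro exI[of _ R']) blast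
  qed
  define js where "js = filter (\<lambda>j. j \<noteq> k) [0..<n]"
  have js: "set js = {..<n} - {k}" by (auto simp: js_def)
  obtain R where "\<forall>i<n. continuous_map X euclidean (\<lambda>x. R x i)"
    "\<forall>x\<in>topspace X. \<forall>q<n.
      ip n (R x) (u x q) = (\<Prod>j\<leftarrow>js. (l q x - l j x) / (l k x - l j x)) * cnj (u x q m)"
    using lagrange[OF equalityD1[OF js]] by (elim exE conjE) (rule that)
  note R = this[rule_format]
  have "R x i = u x k i * cnj (u x k m)" if x: "x \<in> topspace X" for x
  proof -
    have "(\<Prod>j\<leftarrow>js. (l q x - l j x) / (l k x - l j x)) = (if q = k then 1 else 0)" if q: "q < n" for q
    proof (cases "q = k")
      case True
      have "map (\<lambda>j. (l q x - l j x) / (l k x - l j x)) js = map (\<lambda>j. 1) js"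
        using nz[OF x] True js by auto
      then show ?thesis using True by (simp only: if_True) (simp add: map_replicate_const)
    next
      case False
      then have "q \<in> set js" using q js by simp
      then have "0 \<in> set (map (\<lambda>j. (l q x - l j x) / (l k x - l j x)) js)" by force
      then show ?thesis using False by (simp only: prod_list_zero_iff if_False)
    qed
    then have "ip n (R x) (u x q) = (if q = k then cnj (u x k m) else 0)" if "q < n" for q
      using R(2)[OF x that] that by simp
    then have "(\<Sum>q<n. ip n (R x) (u x q) * u x q i) = (\<Sum>q<n. if q = k then cnj (u x k m) * u x k i else 0)"
      by (intro sum.cong refl) simp
    then show ?thesis
      using eigenbasis_expand[OF cmat_carrier[OF A(1) x] N[OF x] l(2)[OF x] u[OF x] im(1), of "R x"] k
      by (simp add: mult.commute)
  qed
  then show ?thesis by (rule continuous_map_eq[OF R(1)[OF im(1)]])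
qed

section \<open>Diagonalization over the complex\<close>

definition diag :: "nat \<Rightarrow> (nat \<Rightarrow> complex) \<Rightarrow> complex mat" where
  "diag n d = mat n n (\<lambda>(i, j). if i = j then d i else 0)"

lemma diag_carrier [simp]: "diag n d \<in> carrier_mat n n"
  by (simp add: diag_def)

lemma diag_dim [simp]: "dim_row (diag n d) = n" "dim_col (diag n d) = n"
  by (simp_all add: diag_def)

lemma diag_entry: "i < n \<Longrightarrow> j < n \<Longrightarrow> diag n d $$ (i, j) = (if i = j then d i else 0)"
  by (simp add: diag_def)

lemma normal_diagonalization:
  assumes X: "CW_complex X" "simply_connected_space X" "Hom_to_int_trivial (homology_group 2 X)"
    and A: "A \<in> cmat X n" "normal_cmat X A"
    and l: "\<And>k. k < n \<Longrightarrow> continuous_map X euclidean (l k)"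
      "\<And>x. x \<in> topspace X \<Longrightarrow> bij_betw (\<lambda>k. l k x) {..<n} (spectrum (A x))"
  obtains V where "unitary_cmat X n V"
    "\<And>x. x \<in> topspace X \<Longrightarrow> A x = V x * diag n (\<lambda>k. l k x) * mat_adjoint (V x)"
proof -
  have N: "A x * mat_adjoint (A x) = mat_adjoint (A x) * A x" if "x \<in> topspace X" for x
    using A(2) that by (simp add: normal_cmat_def)
  have inj: "inj_on (\<lambda>k. l k x) {..<n}" if "x \<in> topspace X" for x
    using l(2)[OF that] by (rule bij_betw_imp_inj_on)
  have "\<exists>u. eigenbasis n (A x) (\<lambda>k. l k x) u" if x: "x \<in> topspace X" for x
    by (rule eigenbasis_exists[OF cmat_carrier[OF A(1) x], of "\<lambda>k. l k x"])
       (use l(2)[OF x] in \<open>auto simp: bij_betw_def\<close>)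
  then obtain u where u: "\<And>x. x \<in> topspace X \<Longrightarrow> eigenbasis n (A x) (\<lambda>k. l k x) (u x)" by metis
  have "\<exists>\<alpha>. \<forall>i<n. continuous_map X euclidean (\<lambda>x. cis (\<alpha> x) * u x k i)" if k: "k < n" for k
  proof -
    \<comment> \<open>The unit eigenvectors were picked pointwise and need not be continuous; only
      their projections are.\<close>
    have "line_field X n (\<lambda>x. u x k)"
    proof
      show "(\<Sum>i<n. u x k i * cnj (u x k i)) = 1" if "x \<in> topspace X" for x
        using u[OF that] k by (simp add: eigenbasis_def ip_def)
      show "continuous_map X euclidean (\<lambda>x. u x k i * cnj (u x k j))" if "i < n" "j < n" for i j
        by (rule eigenprojection_continuous[OF A l(1) inj u k that])
    qed
    from line_field_trivial[OF X this] show ?thesis by blast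
  qed
  then obtain \<alpha> where \<alpha>: "\<And>k i. k < n \<Longrightarrow> i < n \<Longrightarrow> continuous_map X euclidean (\<lambda>x. cis (\<alpha> k x) * u x k i)" by metis
  define v where "v x k i = cis (\<alpha> k x) * u x k i" for x k i
  define V where "V x = mat n n (\<lambda>(i, k). v x k i)" for x
  have Vc: "V x \<in> carrier_mat n n" for x by (simp add: V_def)
  have Ve: "V x $$ (i, k) = v x k i" if "i < n" "k < n" for x i k using that by (simp add: V_def)
  have v: "eigenbasis n (A x) (\<lambda>k. l k x) (v x)" if x: "x \<in> topspace X" for x
  proof -
    have "eigen n (A x) (l k x) (v x k)" if "k < n" for k
    proof -
      have "(\<Sum>j<n. A x $$ (i, j) * v x k j) = cis (\<alpha> k x) * (\<Sum>j<n. A x $$ (i, j) * u x k j)" for i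
        by (simp add: v_def sum_distrib_left mult_ac)
      then show ?thesis using u[OF x] that by (simp add: eigenbasis_def eigen_def v_def)
    qed
    moreover have "ip n (v x k) (v x k) = 1" if "k < n" for k
    proof -
      have "ip n (v x k) (v x k) = ip n (u x k) (u x k)"
        unfolding ip_self by (simp add: v_def norm_mult)
      then show ?thesis using u[OF x] that by (simp add: eigenbasis_def)
    qed
    ultimately show ?thesis by (simp add: eigenbasis_def)
  qed
  have VV: "mat_adjoint (V x) * V x = 1\<^sub>m n" if x: "x \<in> topspace X" for x
  proof (rule eq_matI)
    fix a b assume "a < dim_row (1\<^sub>m n :: complex mat)" "b < dim_col (1\<^sub>m n :: complex mat)"
    then have ab: "a < n" "b < n" by auto
    have "ip n (v x b) (v x a) = (if b = a then 1 else 0)"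
      by (rule eigenbasis_orthonormal[OF cmat_carrier[OF A(1) x] N[OF x] inj[OF x] v[OF x] ab(2,1)])
    then show "(mat_adjoint (V x) * V x) $$ (a, b) = 1\<^sub>m n $$ (a, b)"
      using ab by (auto simp: mult_entry[OF adjoint_carrier[OF Vc] Vc] adjoint_entry[OF Vc] Ve ip_def mult.commute)
  qed (use adjoint_carrier[OF Vc] Vc in auto)
  then have VV': "V x * mat_adjoint (V x) = 1\<^sub>m n" if "x \<in> topspace X" for x
    using mat_mult_left_right_inverse[OF adjoint_carrier[OF Vc] Vc] that by blast
  have "V \<in> cmat X n"
    using \<alpha> Vc by (simp add: cmat_def Ve v_def)
  then have "unitary_cmat X n V" using VV VV' by (simp add: unitary_cmat_def)
  moreover have "A x = V x * diag n (\<lambda>k. l k x) * mat_adjoint (V x)" if x: "x \<in> topspace X" for x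
  proof -
    note Ac = cmat_carrier[OF A(1) x]
    have AV: "A x * V x = V x * diag n (\<lambda>k. l k x)"
    proof (rule eq_matI)
      fix i k assume "i < dim_row (V x * diag n (\<lambda>k. l k x))" "k < dim_col (V x * diag n (\<lambda>k. l k x))"
      then have ik: "i < n" "k < n" using Vc[of x] by auto
      have "(A x * V x) $$ (i, k) = l k x * v x k i"
        using v[OF x] ik by (simp add: mult_entry[OF Ac Vc] Ve eigenbasis_def eigen_def)
      also have "\<dots> = (\<Sum>j<n. V x $$ (i, j) * (if j = k then l j x else 0))"
        using ik by (simp add: Ve if_distrib[of "\<lambda>a. _ * a"] cong: if_cong)
      also have "\<dots> = (V x * diag n (\<lambda>k. l k x)) $$ (i, k)"
        unfolding mult_entry[OF Vc diag_carrier ik]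
        by (intro sum.cong refl) (auto simp: diag_entry ik)
      finally show "(A x * V x) $$ (i, k) = (V x * diag n (\<lambda>k. l k x)) $$ (i, k)" .
    qed (use Ac Vc[of x] in auto)
    have "A x = A x * (V x * mat_adjoint (V x))" using VV'[OF x] Ac by simp
    also have "\<dots> = A x * V x * mat_adjoint (V x)"
      by (rule assoc_mult_mat[OF Ac Vc adjoint_carrier[OF Vc], symmetric])
    finally show ?thesis by (simp only: AV)
  qed
  ultimately show thesis using that by blast
qed

lemma unitary_cmat_mult_adjoint:
  assumes "unitary_cmat X n U" "unitary_cmat X n V"
  shows "unitary_cmat X n (\<lambda>x. U x * mat_adjoint (V x))"
  unfolding unitary_cmat_def
proof (intro conjI ballI)
  have UV: "U \<in> cmat X n" "V \<in> cmat X n" using assms by (auto simp: unitary_cmat_def)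
  show "(\<lambda>x. U x * mat_adjoint (V x)) \<in> cmat X n" by (rule cmat_mult[OF UV(1) cmat_adjoint[OF UV(2)]])
  fix x assume x: "x \<in> topspace X"
  note Uc = cmat_carrier[OF UV(1) x] and Vc = cmat_carrier[OF UV(2) x]
  note Ua = adjoint_carrier[OF Uc] and Va = adjoint_carrier[OF Vc]
  have adj: "mat_adjoint (U x * mat_adjoint (V x)) = V x * mat_adjoint (U x)"
    by (simp add: adjoint_mult[OF Uc Va] adjoint_adjoint[OF Vc])
  have U: "U x * mat_adjoint (U x) = 1\<^sub>m n" "mat_adjoint (U x) * U x = 1\<^sub>m n"
    and V: "V x * mat_adjoint (V x) = 1\<^sub>m n" "mat_adjoint (V x) * V x = 1\<^sub>m n"
    using assms x by (auto simp: unitary_cmat_def)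
  have "U x * mat_adjoint (V x) * (V x * mat_adjoint (U x)) = U x * (mat_adjoint (V x) * V x) * mat_adjoint (U x)"
    using Uc Vc Ua Va by (simp add: assoc_mult_mat[of _ n n _ n _ n])
  then show "U x * mat_adjoint (V x) * mat_adjoint (U x * mat_adjoint (V x)) = 1\<^sub>m n"
    using Uc by (simp add: adj U V)
  have "V x * mat_adjoint (U x) * (U x * mat_adjoint (V x)) = V x * (mat_adjoint (U x) * U x) * mat_adjoint (V x)"
    using Uc Vc Ua Va by (simp add: assoc_mult_mat[of _ n n _ n _ n])
  then show "mat_adjoint (U x * mat_adjoint (V x)) * (U x * mat_adjoint (V x)) = 1\<^sub>m n"
    using Vc by (simp add: adj U V)
qed

text \<open>The unitary is \<open>W\<close> times the adjoint of \<open>V\<close>: it passes from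
  the frame diagonalizing \<open>A\<close> to the one diagonalizing \<open>B\<close>.\<close>

lemma unitarily_equivalent_common_diagonalization:
  assumes V: "unitary_cmat X n V" and W: "unitary_cmat X n W"
    and D: "\<And>x. x \<in> topspace X \<Longrightarrow> D x \<in> carrier_mat n n"
    and A: "\<And>x. x \<in> topspace X \<Longrightarrow> A x = V x * D x * mat_adjoint (V x)"
    and B: "\<And>x. x \<in> topspace X \<Longrightarrow> B x = W x * D x * mat_adjoint (W x)"
  shows "unitarily_equivalent X n A B"
  unfolding unitarily_equivalent_def
proof (intro exI conjI ballI)
  show "unitary_cmat X n (\<lambda>x. W x * mat_adjoint (V x))" by (rule unitary_cmat_mult_adjoint[OF W V])
  fix x assume x: "x \<in> topspace X"
  have Vc: "V x \<in> carrier_mat n n" and Wc: "W x \<in> carrier_mat n n"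
    and VV: "mat_adjoint (V x) * V x = 1\<^sub>m n"
    using V W x by (auto simp: unitary_cmat_def cmat_def)
  note Va = adjoint_carrier[OF Vc] and Wa = adjoint_carrier[OF Wc]
  have "W x * mat_adjoint (V x) * A x * mat_adjoint (W x * mat_adjoint (V x)) =
      W x * ((mat_adjoint (V x) * V x) * D x * (mat_adjoint (V x) * V x)) * mat_adjoint (W x)"
    unfolding A[OF x] adjoint_mult[OF Wc Va] adjoint_adjoint[OF Vc]
    using Vc Wc Va Wa D[OF x] by (simp add: assoc_mult_mat[of _ n n _ n _ n])
  also have "\<dots> = B x" using D[OF x] by (simp add: VV B[OF x])
  finally show "B x = W x * mat_adjoint (V x) * A x * mat_adjoint (W x * mat_adjoint (V x))" by simp
qed

lemma adjoint_one: "mat_adjoint (1\<^sub>m n) = (1\<^sub>m n :: complex mat)"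
proof (rule eq_matI)
  fix i j assume "i < dim_row (1\<^sub>m n :: complex mat)" "j < dim_col (1\<^sub>m n :: complex mat)"
  then show "mat_adjoint (1\<^sub>m n) $$ (i, j) = (1\<^sub>m n :: complex mat) $$ (i, j)"
    by (simp add: adjoint_entry[OF one_carrier_mat])
qed (use adjoint_carrier[OF one_carrier_mat, of n] in auto)

lemma unitary_cmat_one: "unitary_cmat X n (\<lambda>_. 1\<^sub>m n)"
  by (simp add: unitary_cmat_def cmat_def adjoint_one)

theorem corollary3p3:
  fixes X :: "'a topology"
  assumes "CW_complex X"
    and "simply_connected_space X"
  shows "(torsion_group (homology_group 2 X) \<longrightarrow> Hom_to_int_trivial (homology_group 2 X)) \<and>
    (Hom_to_int_trivial (homology_group 2 X) \<longrightarrow>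
      (\<forall>n::nat.
        (\<forall>A\<in>cmat X n. \<forall>B\<in>cmat X n.
           normal_cmat X A \<and> multiplicity_free X n A \<and>
           normal_cmat X B \<and> multiplicity_free X n B \<and>
           same_eigenvalues X A B \<longrightarrow> unitarily_equivalent X n A B) \<and>
        (\<forall>A\<in>cmat X n.
           normal_cmat X A \<and> multiplicity_free X n A \<longrightarrow> diagonalizable_cmat X n A)))"
proof (intro conjI impI allI ballI)
  assume "torsion_group (homology_group 2 X)"
  then show "Hom_to_int_trivial (homology_group 2 X)"
    by (rule torsion_Hom_to_int_trivial[OF group_relative_homology_group])
next
  fix n A B
  assume Hom: "Hom_to_int_trivial (homology_group 2 X)" and A: "A \<in> cmat X n" and B: "B \<in> cmat X n"
    and "normal_cmat X A \<and> multiplicity_free X n A \<and> normal_cmat X B \<and> multiplicity_free X n B \<and>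
      same_eigenvalues X A B"
  then have nA: "normal_cmat X A" "multiplicity_free X n A" and nB: "normal_cmat X B"
    and same: "\<And>x. x \<in> topspace X \<Longrightarrow> spectrum (A x) = spectrum (B x)"
    by (auto simp: same_eigenvalues_def)
  obtain l where l: "\<And>k. k < n \<Longrightarrow> continuous_map X euclidean (l k)"
    "\<And>x. x \<in> topspace X \<Longrightarrow> bij_betw (\<lambda>k. l k x) {..<n} (spectrum (A x))"
    using continuous_spectra.continuous_eigenvalues[OF continuous_spectra_normal[OF A nA] assms] by blast
  obtain V where V: "unitary_cmat X n V"
    "\<And>x. x \<in> topspace X \<Longrightarrow> A x = V x * diag n (\<lambda>k. l k x) * mat_adjoint (V x)"
    using normal_diagonalization[OF assms Hom A nA(1) l] by blast
  have lB: "bij_betw (\<lambda>k. l k x) {..<n} (spectrum (B x))" if "x \<in> topspace X" for x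
    using l(2)[OF that] same[OF that] by simp
  obtain W where W: "unitary_cmat X n W"
    "\<And>x. x \<in> topspace X \<Longrightarrow> B x = W x * diag n (\<lambda>k. l k x) * mat_adjoint (W x)"
    using normal_diagonalization[OF assms Hom B nB l(1) lB] by blast
  show "unitarily_equivalent X n A B"
    by (rule unitarily_equivalent_common_diagonalization[OF V(1) W(1) diag_carrier V(2) W(2)])
next
  fix n A
  assume Hom: "Hom_to_int_trivial (homology_group 2 X)" and A: "A \<in> cmat X n"
    and "normal_cmat X A \<and> multiplicity_free X n A"
  then have nA: "normal_cmat X A" "multiplicity_free X n A" by auto
  obtain l where l: "\<And>k. k < n \<Longrightarrow> continuous_map X euclidean (l k)"
    "\<And>x. x \<in> topspace X \<Longrightarrow> bij_betw (\<lambda>k. l k x) {..<n} (spectrum (A x))"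
    using continuous_spectra.continuous_eigenvalues[OF continuous_spectra_normal[OF A nA] assms] by blast
  obtain V where V: "unitary_cmat X n V"
    "\<And>x. x \<in> topspace X \<Longrightarrow> A x = V x * diag n (\<lambda>k. l k x) * mat_adjoint (V x)"
    using normal_diagonalization[OF assms Hom A nA(1) l] by blast
  let ?D = "\<lambda>x. diag n (\<lambda>k. l k x)"
  have "?D \<in> cmat X n"
    using l(1) by (auto simp: cmat_def diag_def)
  moreover have "diagonal_mat (?D x)" for x by (simp add: diagonal_mat_def diag_def)
  moreover have "unitarily_equivalent X n A ?D"
  proof (rule unitarily_equivalent_common_diagonalization[OF V(1) unitary_cmat_one diag_carrier V(2)])
    fix x
    show "?D x = 1\<^sub>m n * ?D x * mat_adjoint (1\<^sub>m n)" by (simp add: diag_def adjoint_one)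
  qed
  ultimately show "diagonalizable_cmat X n A" unfolding diagonalizable_cmat_def by (intro bexI[of _ ?D]) auto
qed

end
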